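(* Let $(H,\beta)$ be a Hom-Hopf algebra such that $\beta$ is bijective. Then the category ${}^{H}_{H}\mathfrak{M}^{H}_{H}$ of four-angle Hopf modules over $H$ (with bijective structure maps) is a monoidal category with the following structures. (1) The monoidal product of $(M,\zeta_M)$ and $(N,\zeta_N)$ is the Hom-cotensor product $(M\Box_HN,\zeta_M\otimes\zeta_N)$ with $h\cdot(m\otimes n)=\beta^{-1}(h_1)\cdot m\otimes\beta^{-1}(h_2)\cdot n$, $\rho^l(m\otimes n)=m_{[-1]}\otimes m_{[0]}\otimes\zeta_N(n)$, $(m\otimes n)\cdot h=m\cdot\beta^{-1}(h_1)\otimes n\cdot\beta^{-1}(h_2)$, $\rho^r(m\otimes n)=\zeta_M(m)\otimes n_{(0)}\otimes n_{(1)}$. (2) The unit object is $(H,\beta)$ (with actions given by its multiplication and coactions by its comultiplication). (3) The associativity constraint is $\widehat a_{M,N,P}:(M\Box_HN)\Box_HP\to M\Box_H(N\Box_HP)$, $\widehat a((m\otimes n)\otimes p)=m\otimes(n\otimes p)$. (4) The left unit constraint is $\widehat l:H\Box_HM\to M$, $\widehat l(g\otimes m)=\varepsilon(g)m$. (5) The right unit constraint is $\widehat r:M\Box_HH\to M$, $\widehat r(m\otimes g)=\varepsilon(g)m$.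
   Context: All spaces are over a field $\Bbbk$, $\otimes=\otimes_{\Bbbk}$. A Hom-Hopf algebra $(H,\beta)$ is a linear space $H$ with linear maps $\beta:H\to H$, a multiplication, a unit $1_H$, $\Delta(h)=h_1\otimes h_2$, $\varepsilon$, $S:H\to H$ such that: $\beta(ab)=\beta(a)\beta(b)$, $\beta(a)(bc)=(ab)\beta(c)$, $\beta(1_H)=1_H$, $1_Ha=a1_H=\beta(a)$; $\Delta(\beta(h))=\beta(h_1)\otimes\beta(h_2)$, $\beta(h_1)\otimes\Delta(h_2)=\Delta(h_1)\otimes\beta(h_2)$, $\varepsilon\circ\beta=\varepsilon$, $\varepsilon(h_1)h_2=\beta(h)=h_1\varepsilon(h_2)$; $\Delta(hg)=h_1g_1\otimes h_2g_2$, $\Delta(1_H)=1_H\otimes1_H$, $\varepsilon(hg)=\varepsilon(h)\varepsilon(g)$, $\varepsilon(1_H)=1$; $S(h_1)h_2=\varepsilon(h)1_H=h_1S(h_2)$, $S\beta=\beta S$. A left $H$-module is $(M,\zeta_M)$ with $\zeta_M:M\to M$ linear and an action with $\beta(a)\cdot(b\cdot m)=(ab)\cdot\zeta_M(m)$, $\zeta_M(a\cdot m)=\beta(a)\cdot\zeta_M(m)$, $1_H\cdot m=\zeta_M(m)$. A right $H$-module satisfies $(m\cdot a)\cdot\beta(b)=\zeta_M(m)\cdot(ab)$, $\zeta_M(m\cdot a)=\zeta_M(m)\cdot\beta(a)$, $m\cdot1_H=\zeta_M(m)$. An $H$-bimodule is both, with $\beta(a)\cdot(m\cdot b)=(a\cdot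 m)\cdot\beta(b)$. A left $H$-comodule has $\rho^l(m)=m_{[-1]}\otimes m_{[0]}\in H\otimes M$ with $\rho^l(\zeta_M(m))=\beta(m_{[-1]})\otimes\zeta_M(m_{[0]})$, $\varepsilon(m_{[-1]})m_{[0]}=\zeta_M(m)$, $\beta(m_{[-1]})\otimes\rho^l(m_{[0]})=\Delta(m_{[-1]})\otimes\zeta_M(m_{[0]})$. A right $H$-comodule has $\rho^r(m)=m_{(0)}\otimes m_{(1)}\in M\otimes H$ with $\rho^r(\zeta_M(m))=\zeta_M(m_{(0)})\otimes\beta(m_{(1)})$, $m_{(0)}\varepsilon(m_{(1)})=\zeta_M(m)$, $\rho^r(m_{(0)})\otimes\beta(m_{(1)})=\zeta_M(m_{(0)})\otimes\Delta(m_{(1)})$. An $H$-bicomodule is both, with $\beta(m_{[-1]})\otimes m_{[0](0)}\otimes m_{[0](1)}=m_{(0)[-1]}\otimes m_{(0)[0]}\otimes\beta(m_{(1)})$. A four-angle Hopf module is a pair $(M,\zeta_M)$ with $\zeta_M$ bijective which is an $H$-bimodule and an $H$-bicomodule such that $\rho^l(h\cdot m)=h_1m_{[-1]}\otimes h_2\cdot m_{[0]}$, $\rho^r(h\cdot m)=h_1\cdot m_{(0)}\otimes h_2m_{(1)}$, $\rho^l(m\cdot h)=m_{[-1]}h_1\otimes m_{[0]}\cdot h_2$, $\rho^r(m\cdot h)=m_{(0)}\cdot h_1\otimes m_{(1)}h_2$. Morphisms in ${}^{H}_{H}\mathfrak{M}^{H}_{H}$ are linear maps commuting with the structure maps $\zeta$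 and with all actions and coactions. The Hom-cotensor product is the subspace $M\Box_HN=\{x\in M\otimes N\mid(\rho^r_M\otimes\zeta_N)(x)=(\zeta_M\otimes\rho^l_N)(x)\}$; its elements are written symbolically as $m\otimes n$ (summation understood), and formulas on them are restrictions of the corresponding linear maps on $M\otimes N$. The monoidal product of morphisms is the restriction of $f\otimes g$. *)

theory Defs
  imports "HOL-Algebra.Module" "HOL-Library.FuncSet"
begin

section \<open>Monoidal categories\<close>

text \<open>
  Hom-sets are given as a family and need not be disjoint, so composition, identities and all
  operations on morphisms take the objects involved as arguments:
  \<open>Comp A B C g f\<close> is the composite of \<open>f \<in> Hom A B\<close> and \<open>g \<in> Hom B C\<close>, and
  \<open>TensM A A' B B' f g\<close> is the monoidal product of \<open>f \<in> Hom A A'\<close> and \<open>g \<in> Hom B B'\<close>.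
\<close>

locale category =
  fixes Obj :: "'o set"
    and Hom :: "'o \<Rightarrow> 'o \<Rightarrow> 'm set"
    and Id :: "'o \<Rightarrow> 'm"
    and Comp :: "'o \<Rightarrow> 'o \<Rightarrow> 'o \<Rightarrow> 'm \<Rightarrow> 'm \<Rightarrow> 'm"
  assumes Id_in_Hom: "A \<in> Obj \<Longrightarrow> Id A \<in> Hom A A"
    and Comp_in_Hom: "\<lbrakk>A \<in> Obj; B \<in> Obj; C \<in> Obj; f \<in> Hom A B; g \<in> Hom B C\<rbrakk>
      \<Longrightarrow> Comp A B C g f \<in> Hom A C"
    and Comp_Id: "\<lbrakk>A \<in> Obj; B \<in> Obj; f \<in> Hom A B\<rbrakk> \<Longrightarrow> Comp A A B f (Id A) = f"
    and Id_Comp: "\<lbrakk>A \<in> Obj; B \<in> Obj; f \<in> Hom A B\<rbrakk> \<Longrightarrow> Comp A B B (Id B) f = f"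
    and Comp_assoc: "\<lbrakk>A \<in> Obj; B \<in> Obj; C \<in> Obj; D \<in> Obj;
        f \<in> Hom A B; g \<in> Hom B C; h \<in> Hom C D\<rbrakk>
      \<Longrightarrow> Comp A C D h (Comp A B C g f) = Comp A B D (Comp B C D h g) f"
begin

definition iso :: "'o \<Rightarrow> 'o \<Rightarrow> 'm set" where
  "iso A B = {f \<in> Hom A B. \<exists>g \<in> Hom B A. Comp A B A g f = Id A \<and> Comp B A B f g = Id B}"

end

locale monoidal_category = category Obj Hom Id Comp
  for Obj :: "'o set"
    and Hom :: "'o \<Rightarrow> 'o \<Rightarrow> 'm set"
    and Id :: "'o \<Rightarrow> 'm"
    and Comp :: "'o \<Rightarrow> 'o \<Rightarrow> 'o \<Rightarrow> 'm \<Rightarrow> 'm \<Rightarrow> 'm" +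
  fixes TensO :: "'o \<Rightarrow> 'o \<Rightarrow> 'o"
    and TensM :: "'o \<Rightarrow> 'o \<Rightarrow> 'o \<Rightarrow> 'o \<Rightarrow> 'm \<Rightarrow> 'm \<Rightarrow> 'm"
    and Unit :: 'o
    and Assoc :: "'o \<Rightarrow> 'o \<Rightarrow> 'o \<Rightarrow> 'm"
    and LUnit :: "'o \<Rightarrow> 'm"
    and RUnit :: "'o \<Rightarrow> 'm"
  assumes TensO_in_Obj: "\<lbrakk>A \<in> Obj; B \<in> Obj\<rbrakk> \<Longrightarrow> TensO A B \<in> Obj"
    and TensM_in_Hom: "\<lbrakk>A \<in> Obj; A' \<in> Obj; B \<in> Obj; B' \<in> Obj; f \<in> Hom A A'; g \<in> Hom B B'\<rbrakk>
      \<Longrightarrow> TensM A A' B B' f g \<in> Hom (TensO A B) (TensO A' B')"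
    and TensM_Id: "\<lbrakk>A \<in> Obj; B \<in> Obj\<rbrakk> \<Longrightarrow> TensM A A B B (Id A) (Id B) = Id (TensO A B)"
    and TensM_Comp: "\<lbrakk>A \<in> Obj; A' \<in> Obj; A'' \<in> Obj; B \<in> Obj; B' \<in> Obj; B'' \<in> Obj;
        f \<in> Hom A A'; f' \<in> Hom A' A''; g \<in> Hom B B'; g' \<in> Hom B' B''\<rbrakk>
      \<Longrightarrow> TensM A A'' B B'' (Comp A A' A'' f' f) (Comp B B' B'' g' g)
        = Comp (TensO A B) (TensO A' B') (TensO A'' B'')
            (TensM A' A'' B' B'' f' g') (TensM A A' B B' f g)"
    and Unit_in_Obj: "Unit \<in> Obj"
    and Assoc_iso: "\<lbrakk>A \<in> Obj; B \<in> Obj; C \<in> Obj\<rbrakk>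
      \<Longrightarrow> Assoc A B C \<in> iso (TensO (TensO A B) C) (TensO A (TensO B C))"
    and Assoc_natural: "\<lbrakk>A \<in> Obj; A' \<in> Obj; B \<in> Obj; B' \<in> Obj; C \<in> Obj; C' \<in> Obj;
        f \<in> Hom A A'; g \<in> Hom B B'; h \<in> Hom C C'\<rbrakk>
      \<Longrightarrow> Comp (TensO (TensO A B) C) (TensO (TensO A' B') C') (TensO A' (TensO B' C'))
            (Assoc A' B' C')
            (TensM (TensO A B) (TensO A' B') C C' (TensM A A' B B' f g) h)
        = Comp (TensO (TensO A B) C) (TensO A (TensO B C)) (TensO A' (TensO B' C'))
            (TensM A A' (TensO B C) (TensO B' C') f (TensM B B' C C' g h))
            (Assoc A B C)"
    and LUnit_iso: "A \<in> Obj \<Longrightarrow> LUnit A \<in> iso (TensO Unit A) A"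
    and LUnit_natural: "\<lbrakk>A \<in> Obj; A' \<in> Obj; f \<in> Hom A A'\<rbrakk>
      \<Longrightarrow> Comp (TensO Unit A) (TensO Unit A') A' (LUnit A') (TensM Unit Unit A A' (Id Unit) f)
        = Comp (TensO Unit A) A A' f (LUnit A)"
    and RUnit_iso: "A \<in> Obj \<Longrightarrow> RUnit A \<in> iso (TensO A Unit) A"
    and RUnit_natural: "\<lbrakk>A \<in> Obj; A' \<in> Obj; f \<in> Hom A A'\<rbrakk>
      \<Longrightarrow> Comp (TensO A Unit) (TensO A' Unit) A' (RUnit A') (TensM A A' Unit Unit f (Id Unit))
        = Comp (TensO A Unit) A A' f (RUnit A)"
    and pentagon: "\<lbrakk>A \<in> Obj; B \<in> Obj; C \<in> Obj; D \<in> Obj\<rbrakk>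
      \<Longrightarrow> Comp (TensO (TensO (TensO A B) C) D) (TensO A (TensO (TensO B C) D))
              (TensO A (TensO B (TensO C D)))
            (TensM A A (TensO (TensO B C) D) (TensO B (TensO C D)) (Id A) (Assoc B C D))
            (Comp (TensO (TensO (TensO A B) C) D) (TensO (TensO A (TensO B C)) D)
                (TensO A (TensO (TensO B C) D))
              (Assoc A (TensO B C) D)
              (TensM (TensO (TensO A B) C) (TensO A (TensO B C)) D D (Assoc A B C) (Id D)))
        = Comp (TensO (TensO (TensO A B) C) D) (TensO (TensO A B) (TensO C D))
              (TensO A (TensO B (TensO C D)))
            (Assoc A B (TensO C D)) (Assoc (TensO A B) C D)"
    and triangle: "\<lbrakk>A \<in> Obj; B \<in> Obj\<rbrakk>
      \<Longrightarrow> Comp (TensO (TensO A Unit) B) (TensO A (TensO Unit B)) (TensO A B)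
            (TensM A A (TensO Unit B) B (Id A) (LUnit B)) (Assoc A Unit B)
        = TensM (TensO A Unit) A B B (RUnit A) (Id B)"


section \<open>Linear algebra\<close>

text \<open>
  A vector space over a field \<open>K\<close> is a \<^locale>\<open>module\<close> over \<open>K\<close>.  The fields \<open>mult\<close> and \<open>one\<close> of the
  module record carry no meaning for a plain vector space; they are only used for the
  multiplication and the unit of a Hom-Hopf algebra.
\<close>

definition linear_map ::
  "('k,'r) ring_scheme \<Rightarrow> ('k,'v,'s) module_scheme \<Rightarrow> ('k,'w,'t) module_scheme \<Rightarrow> ('v \<Rightarrow> 'w) \<Rightarrow> bool"
where
  "linear_map K V W f \<longleftrightarrow>
     f \<in> carrier V \<rightarrow> carrier W \<and>
     (\<forall>x \<in> carrier V. \<forall>y \<in> carrier V. f (x \<oplus>\<^bsub>V\<^esub> y) = f x \<oplus>\<^bsub>W\<^esub> f y) \<and>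
     (\<forall>c \<in> carrier K. \<forall>x \<in> carrier V. f (c \<odot>\<^bsub>V\<^esub> x) = c \<odot>\<^bsub>W\<^esub> f x)"

definition linear_functional ::
  "('k,'r) ring_scheme \<Rightarrow> ('k,'v,'s) module_scheme \<Rightarrow> ('v \<Rightarrow> 'k) \<Rightarrow> bool"
where
  "linear_functional K V f \<longleftrightarrow>
     f \<in> carrier V \<rightarrow> carrier K \<and>
     (\<forall>x \<in> carrier V. \<forall>y \<in> carrier V. f (x \<oplus>\<^bsub>V\<^esub> y) = f x \<oplus>\<^bsub>K\<^esub> f y) \<and>
     (\<forall>c \<in> carrier K. \<forall>x \<in> carrier V. f (c \<odot>\<^bsub>V\<^esub> x) = c \<otimes>\<^bsub>K\<^esub> f x)"

definition bilinear_map ::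
  "('k,'r) ring_scheme \<Rightarrow> ('k,'u,'s) module_scheme \<Rightarrow> ('k,'v,'t) module_scheme
     \<Rightarrow> ('k,'w,'q) module_scheme \<Rightarrow> ('u \<Rightarrow> 'v \<Rightarrow> 'w) \<Rightarrow> bool"
where
  "bilinear_map K U V W f \<longleftrightarrow>
     (\<forall>x \<in> carrier U. linear_map K V W (f x)) \<and>
     (\<forall>y \<in> carrier V. linear_map K U W (\<lambda>x. f x y))"

text \<open>
  A category whose objects are vector spaces has to live over a universe closed under tensor
  products.  The carriers of all spaces are subsets of \<open>'a univ\<close>, where \<open>'a\<close> is an arbitrary type:
  every space with carrier in \<open>'a\<close> has a copy there (via \<open>Atom\<close>), and the elements of a tensor
  product are formal sums of pairs, \<open>Formal [(v\<^sub>1, w\<^sub>1), \<dots>, (v\<^sub>n, w\<^sub>n)]\<close> standing for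
  \<open>v\<^sub>1 \<otimes> w\<^sub>1 + \<dots> + v\<^sub>n \<otimes> w\<^sub>n\<close>.
\<close>

datatype 'a univ = Atom 'a | Formal (summands: "('a univ \<times> 'a univ) list")
  where "summands (Atom _) = []"

text \<open>
  The tensor product is the commutative monoid of formal sums modulo the smallest congruence that
  makes \<open>(v, w) \<mapsto> v \<otimes> w\<close> biadditive and balanced over \<open>K\<close>.  Formal sums need no coefficients,
  as \<open>c (v \<otimes> w) = (c v) \<otimes> w\<close>.
\<close>

inductive tensor_eq ::
  "('k,'r) ring_scheme \<Rightarrow> ('k,'v,'s) module_scheme \<Rightarrow> ('k,'w,'t) module_scheme
     \<Rightarrow> ('v \<times> 'w) list \<Rightarrow> ('v \<times> 'w) list \<Rightarrow> bool"
  for K :: "('k,'r) ring_scheme" and V :: "('k,'v,'s) module_scheme"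
    and W :: "('k,'w,'t) module_scheme"
where
  refl: "set xs \<subseteq> carrier V \<times> carrier W \<Longrightarrow> tensor_eq K V W xs xs"
| sym: "tensor_eq K V W xs ys \<Longrightarrow> tensor_eq K V W ys xs"
| trans: "tensor_eq K V W xs ys \<Longrightarrow> tensor_eq K V W ys zs \<Longrightarrow> tensor_eq K V W xs zs"
| append: "tensor_eq K V W xs xs' \<Longrightarrow> tensor_eq K V W ys ys' \<Longrightarrow>
    tensor_eq K V W (xs @ ys) (xs' @ ys')"
| commute: "set xs \<subseteq> carrier V \<times> carrier W \<Longrightarrow> set ys \<subseteq> carrier V \<times> carrier W \<Longrightarrow>
    tensor_eq K V W (xs @ ys) (ys @ xs)"
| add_left: "v \<in> carrier V \<Longrightarrow> v' \<in> carrier V \<Longrightarrow> w \<in> carrier W \<Longrightarrow>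
    tensor_eq K V W [(v \<oplus>\<^bsub>V\<^esub> v', w)] [(v, w), (v', w)]"
| add_right: "v \<in> carrier V \<Longrightarrow> w \<in> carrier W \<Longrightarrow> w' \<in> carrier W \<Longrightarrow>
    tensor_eq K V W [(v, w \<oplus>\<^bsub>W\<^esub> w')] [(v, w), (v, w')]"
| zero: "w \<in> carrier W \<Longrightarrow> tensor_eq K V W [(\<zero>\<^bsub>V\<^esub>, w)] []"
| balanced: "c \<in> carrier K \<Longrightarrow> v \<in> carrier V \<Longrightarrow> w \<in> carrier W \<Longrightarrow>
    tensor_eq K V W [(c \<odot>\<^bsub>V\<^esub> v, w)] [(v, c \<odot>\<^bsub>W\<^esub> w)]"

text \<open>Each congruence class is represented by one chosen formal sum in it.\<close>

definition tensor_class ::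
  "('k,'r) ring_scheme \<Rightarrow> ('k,'a univ,'s) module_scheme \<Rightarrow> ('k,'a univ,'t) module_scheme
     \<Rightarrow> ('a univ \<times> 'a univ) list \<Rightarrow> 'a univ"
where
  "tensor_class K V W xs = Formal (SOME ys. tensor_eq K V W xs ys)"

definition tensor ::
  "('k,'r) ring_scheme \<Rightarrow> ('k,'a univ,'s) module_scheme \<Rightarrow> ('k,'a univ,'t) module_scheme
     \<Rightarrow> ('k,'a univ) module"
where
  "tensor K V W =
    \<lparr>carrier = tensor_class K V W ` {xs. set xs \<subseteq> carrier V \<times> carrier W},
     mult = undefined,
     one = undefined,
     zero = tensor_class K V W [],
     add = (\<lambda>s t. tensor_class K V W (summands s @ summands t)),
     smult = (\<lambda>c t. tensor_class K V W (map (\<lambda>(v, w). (c \<odot>\<^bsub>V\<^esub> v, w)) (summands t)))\<rparr>"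

text \<open>The pure tensor \<open>v \<otimes> w\<close>.\<close>

definition tens ::
  "('k,'r) ring_scheme \<Rightarrow> ('k,'a univ,'s) module_scheme \<Rightarrow> ('k,'a univ,'t) module_scheme
     \<Rightarrow> 'a univ \<Rightarrow> 'a univ \<Rightarrow> 'a univ"
where
  "tens K V W v w = tensor_class K V W [(v, w)]"

text \<open>
  Sweedler notation: \<open>tsum U f t\<close> is the sum of \<open>f v w\<close>, taken in \<open>U\<close>, over the summands
  \<open>v \<otimes> w\<close> of \<open>t\<close>.  For \<open>f\<close> bilinear on \<open>V \<times> W\<close> this is the linear map on \<open>V \<otimes> W\<close> induced by \<open>f\<close>.
\<close>

definition tsum ::
  "('k,'u,'s) module_scheme \<Rightarrow> ('a univ \<Rightarrow> 'a univ \<Rightarrow> 'u) \<Rightarrow> 'a univ \<Rightarrow> 'u"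
where
  "tsum U f t = foldr (\<lambda>(v, w) u. f v w \<oplus>\<^bsub>U\<^esub> u) (summands t) \<zero>\<^bsub>U\<^esub>"

text \<open>The linear map \<open>f \<otimes> g\<close> into \<open>V' \<otimes> W'\<close>.\<close>

definition tmap ::
  "('k,'r) ring_scheme \<Rightarrow> ('k,'a univ,'s) module_scheme \<Rightarrow> ('k,'a univ,'t) module_scheme
     \<Rightarrow> ('a univ \<Rightarrow> 'a univ) \<Rightarrow> ('a univ \<Rightarrow> 'a univ) \<Rightarrow> 'a univ \<Rightarrow> 'a univ"
where
  "tmap K V' W' f g = tsum (tensor K V' W') (\<lambda>v w. tens K V' W' (f v) (g w))"

text \<open>The canonical map \<open>(U \<otimes> V) \<otimes> W \<rightarrow> U \<otimes> (V \<otimes> W)\<close>.\<close>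

definition tassoc ::
  "('k,'r) ring_scheme \<Rightarrow> ('k,'a univ,'s) module_scheme \<Rightarrow> ('k,'a univ,'t) module_scheme
     \<Rightarrow> ('k,'a univ,'q) module_scheme \<Rightarrow> 'a univ \<Rightarrow> 'a univ"
where
  "tassoc K U V W =
     tsum (tensor K U (tensor K V W))
       (\<lambda>t w. tsum (tensor K U (tensor K V W))
         (\<lambda>u v. tens K U (tensor K V W) u (tens K V W v w)) t)"

text \<open>The componentwise operation \<open>(a \<otimes> b, c \<otimes> d) \<mapsto> f a c \<otimes> g b d\<close> into \<open>V \<otimes> W\<close>.\<close>

definition tcomp ::
  "('k,'r) ring_scheme \<Rightarrow> ('k,'a univ,'s) module_scheme \<Rightarrow> ('k,'a univ,'t) module_scheme
     \<Rightarrow> ('a univ \<Rightarrow> 'a univ \<Rightarrow> 'a univ) \<Rightarrow> ('a univ \<Rightarrow> 'a univ \<Rightarrow> 'a univ)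
     \<Rightarrow> 'a univ \<Rightarrow> 'a univ \<Rightarrow> 'a univ"
where
  "tcomp K V W f g s t =
     tsum (tensor K V W)
       (\<lambda>a b. tsum (tensor K V W) (\<lambda>c d. tens K V W (f a c) (g b d)) t) s"


section \<open>Hom-Hopf algebras\<close>

record ('k,'u) hom_space = "('k,'u) module" +
  twist :: "'u \<Rightarrow> 'u"

record ('k,'u) hom_hopf = "('k,'u) hom_space" +
  comult :: "'u \<Rightarrow> 'u"
  counit :: "'u \<Rightarrow> 'k"
  antipode :: "'u \<Rightarrow> 'u"

locale hom_hopf_algebra = module K H
  for K :: "('k,'r) ring_scheme" and H :: "('k,'a univ,'h) hom_hopf_scheme" +
  assumes twist_linear: "linear_map K H H (twist H)"
    and mult_bilinear: "bilinear_map K H H H (mult H)"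
    and one_closed: "\<one>\<^bsub>H\<^esub> \<in> carrier H"
    and comult_linear: "linear_map K H (tensor K H H) (comult H)"
    and counit_linear: "linear_functional K H (counit H)"
    and antipode_linear: "linear_map K H H (antipode H)"
    and twist_mult: "\<lbrakk>a \<in> carrier H; b \<in> carrier H\<rbrakk>
      \<Longrightarrow> twist H (a \<otimes>\<^bsub>H\<^esub> b) = twist H a \<otimes>\<^bsub>H\<^esub> twist H b"
    and hom_assoc: "\<lbrakk>a \<in> carrier H; b \<in> carrier H; c \<in> carrier H\<rbrakk>
      \<Longrightarrow> twist H a \<otimes>\<^bsub>H\<^esub> (b \<otimes>\<^bsub>H\<^esub> c) = (a \<otimes>\<^bsub>H\<^esub> b) \<otimes>\<^bsub>H\<^esub> twist H c"
    and twist_one: "twist H \<one>\<^bsub>H\<^esub> = \<one>\<^bsub>H\<^esub>"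
    and one_mult: "a \<in> carrier H \<Longrightarrow> \<one>\<^bsub>H\<^esub> \<otimes>\<^bsub>H\<^esub> a = twist H a"
    and mult_one: "a \<in> carrier H \<Longrightarrow> a \<otimes>\<^bsub>H\<^esub> \<one>\<^bsub>H\<^esub> = twist H a"
    and comult_twist: "h \<in> carrier H
      \<Longrightarrow> comult H (twist H h) = tmap K H H (twist H) (twist H) (comult H h)"
    and hom_coassoc: "h \<in> carrier H
      \<Longrightarrow> tmap K H (tensor K H H) (twist H) (comult H) (comult H h)
        = tassoc K H H H (tmap K (tensor K H H) H (comult H) (twist H) (comult H h))"
    and counit_twist: "h \<in> carrier H \<Longrightarrow> counit H (twist H h) = counit H h"
    and counit_left: "h \<in> carrier H
      \<Longrightarrow> tsum H (\<lambda>h\<^sub>1 h\<^sub>2. counit H h\<^sub>1 \<odot>\<^bsub>H\<^esub> h\<^sub>2) (comult H h) = twist H h"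
    and counit_right: "h \<in> carrier H
      \<Longrightarrow> tsum H (\<lambda>h\<^sub>1 h\<^sub>2. counit H h\<^sub>2 \<odot>\<^bsub>H\<^esub> h\<^sub>1) (comult H h) = twist H h"
    and comult_mult: "\<lbrakk>h \<in> carrier H; g \<in> carrier H\<rbrakk>
      \<Longrightarrow> comult H (h \<otimes>\<^bsub>H\<^esub> g) = tcomp K H H (mult H) (mult H) (comult H h) (comult H g)"
    and comult_one: "comult H \<one>\<^bsub>H\<^esub> = tens K H H \<one>\<^bsub>H\<^esub> \<one>\<^bsub>H\<^esub>"
    and counit_mult: "\<lbrakk>h \<in> carrier H; g \<in> carrier H\<rbrakk>
      \<Longrightarrow> counit H (h \<otimes>\<^bsub>H\<^esub> g) = counit H h \<otimes>\<^bsub>K\<^esub> counit H g"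
    and counit_one: "counit H \<one>\<^bsub>H\<^esub> = \<one>\<^bsub>K\<^esub>"
    and antipode_left: "h \<in> carrier H
      \<Longrightarrow> tsum H (\<lambda>h\<^sub>1 h\<^sub>2. antipode H h\<^sub>1 \<otimes>\<^bsub>H\<^esub> h\<^sub>2) (comult H h) = counit H h \<odot>\<^bsub>H\<^esub> \<one>\<^bsub>H\<^esub>"
    and antipode_right: "h \<in> carrier H
      \<Longrightarrow> tsum H (\<lambda>h\<^sub>1 h\<^sub>2. h\<^sub>1 \<otimes>\<^bsub>H\<^esub> antipode H h\<^sub>2) (comult H h) = counit H h \<odot>\<^bsub>H\<^esub> \<one>\<^bsub>H\<^esub>"
    and antipode_twist: "h \<in> carrier H
      \<Longrightarrow> antipode H (twist H h) = twist H (antipode H h)"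


section \<open>Four-angle Hopf modules\<close>

text \<open>\<open>lact M h m\<close> is \<open>h \<cdot> m\<close>, and \<open>ract M m h\<close> is \<open>m \<cdot> h\<close>.\<close>

record ('k,'u) hopf_module = "('k,'u) hom_space" +
  lact :: "'u \<Rightarrow> 'u \<Rightarrow> 'u"
  ract :: "'u \<Rightarrow> 'u \<Rightarrow> 'u"
  lcoact :: "'u \<Rightarrow> 'u"
  rcoact :: "'u \<Rightarrow> 'u"

locale left_hom_module = module K M
  for K :: "('k,'r) ring_scheme" and H :: "('k,'a univ,'h) hom_hopf_scheme"
    and M :: "('k,'a univ,'m) hopf_module_scheme" +
  assumes twist_linear: "linear_map K M M (twist M)"
    and lact_bilinear: "bilinear_map K H M M (lact M)"
    and lact_assoc: "\<lbrakk>a \<in> carrier H; b \<in> carrier H; m \<in> carrier M\<rbrakk>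
      \<Longrightarrow> lact M (twist H a) (lact M b m) = lact M (a \<otimes>\<^bsub>H\<^esub> b) (twist M m)"
    and twist_lact: "\<lbrakk>a \<in> carrier H; m \<in> carrier M\<rbrakk>
      \<Longrightarrow> twist M (lact M a m) = lact M (twist H a) (twist M m)"
    and lact_one: "m \<in> carrier M \<Longrightarrow> lact M \<one>\<^bsub>H\<^esub> m = twist M m"

locale right_hom_module = module K M
  for K :: "('k,'r) ring_scheme" and H :: "('k,'a univ,'h) hom_hopf_scheme"
    and M :: "('k,'a univ,'m) hopf_module_scheme" +
  assumes twist_linear: "linear_map K M M (twist M)"
    and ract_bilinear: "bilinear_map K M H M (ract M)"
    and ract_assoc: "\<lbrakk>a \<in> carrier H; b \<in> carrier H; m \<in> carrier M\<rbrakk>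
      \<Longrightarrow> ract M (ract M m a) (twist H b) = ract M (twist M m) (a \<otimes>\<^bsub>H\<^esub> b)"
    and twist_ract: "\<lbrakk>a \<in> carrier H; m \<in> carrier M\<rbrakk>
      \<Longrightarrow> twist M (ract M m a) = ract M (twist M m) (twist H a)"
    and ract_one: "m \<in> carrier M \<Longrightarrow> ract M m \<one>\<^bsub>H\<^esub> = twist M m"

locale hom_bimodule = left_hom_module K H M + right_hom_module K H M
  for K :: "('k,'r) ring_scheme" and H :: "('k,'a univ,'h) hom_hopf_scheme"
    and M :: "('k,'a univ,'m) hopf_module_scheme" +
  assumes lact_ract: "\<lbrakk>a \<in> carrier H; b \<in> carrier H; m \<in> carrier M\<rbrakk>
      \<Longrightarrow> lact M (twist H a) (ract M m b) = ract M (lact M a m) (twist H b)"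

locale left_hom_comodule = module K M
  for K :: "('k,'r) ring_scheme" and H :: "('k,'a univ,'h) hom_hopf_scheme"
    and M :: "('k,'a univ,'m) hopf_module_scheme" +
  assumes twist_linear: "linear_map K M M (twist M)"
    and lcoact_linear: "linear_map K M (tensor K H M) (lcoact M)"
    and lcoact_twist: "m \<in> carrier M
      \<Longrightarrow> lcoact M (twist M m) = tmap K H M (twist H) (twist M) (lcoact M m)"
    and lcoact_counit: "m \<in> carrier M
      \<Longrightarrow> tsum M (\<lambda>a n. counit H a \<odot>\<^bsub>M\<^esub> n) (lcoact M m) = twist M m"
    and lcoact_coassoc: "m \<in> carrier M
      \<Longrightarrow> tmap K H (tensor K H M) (twist H) (lcoact M) (lcoact M m)
        = tassoc K H H M (tmap K (tensor K H H) M (comult H) (twist M) (lcoact M m))"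

locale right_hom_comodule = module K M
  for K :: "('k,'r) ring_scheme" and H :: "('k,'a univ,'h) hom_hopf_scheme"
    and M :: "('k,'a univ,'m) hopf_module_scheme" +
  assumes twist_linear: "linear_map K M M (twist M)"
    and rcoact_linear: "linear_map K M (tensor K M H) (rcoact M)"
    and rcoact_twist: "m \<in> carrier M
      \<Longrightarrow> rcoact M (twist M m) = tmap K M H (twist M) (twist H) (rcoact M m)"
    and rcoact_counit: "m \<in> carrier M
      \<Longrightarrow> tsum M (\<lambda>n a. counit H a \<odot>\<^bsub>M\<^esub> n) (rcoact M m) = twist M m"
    and rcoact_coassoc: "m \<in> carrier M
      \<Longrightarrow> tassoc K M H H (tmap K (tensor K M H) H (rcoact M) (twist H) (rcoact M m))
        = tmap K M (tensor K H H) (twist M) (comult H) (rcoact M m)"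

locale hom_bicomodule = left_hom_comodule K H M + right_hom_comodule K H M
  for K :: "('k,'r) ring_scheme" and H :: "('k,'a univ,'h) hom_hopf_scheme"
    and M :: "('k,'a univ,'m) hopf_module_scheme" +
  assumes lcoact_rcoact: "m \<in> carrier M
      \<Longrightarrow> tmap K H (tensor K M H) (twist H) (rcoact M) (lcoact M m)
        = tassoc K H M H (tmap K (tensor K H M) H (lcoact M) (twist H) (rcoact M m))"

locale four_angle_hopf_module = hom_bimodule K H M + hom_bicomodule K H M
  for K :: "('k,'r) ring_scheme" and H :: "('k,'a univ,'h) hom_hopf_scheme"
    and M :: "('k,'a univ,'m) hopf_module_scheme" +
  assumes twist_bij: "bij_betw (twist M) (carrier M) (carrier M)"
    and lcoact_lact: "\<lbrakk>h \<in> carrier H; m \<in> carrier M\<rbrakk>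
      \<Longrightarrow> lcoact M (lact M h m) = tcomp K H M (mult H) (lact M) (comult H h) (lcoact M m)"
    and rcoact_lact: "\<lbrakk>h \<in> carrier H; m \<in> carrier M\<rbrakk>
      \<Longrightarrow> rcoact M (lact M h m) = tcomp K M H (lact M) (mult H) (comult H h) (rcoact M m)"
    and lcoact_ract: "\<lbrakk>h \<in> carrier H; m \<in> carrier M\<rbrakk>
      \<Longrightarrow> lcoact M (ract M m h) = tcomp K H M (mult H) (ract M) (lcoact M m) (comult H h)"
    and rcoact_ract: "\<lbrakk>h \<in> carrier H; m \<in> carrier M\<rbrakk>
      \<Longrightarrow> rcoact M (ract M m h) = tcomp K M H (ract M) (mult H) (rcoact M m) (comult H h)"


section \<open>The category of four-angle Hopf modules\<close>

definition hopf_Obj ::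
  "('k,'r) ring_scheme \<Rightarrow> ('k,'a univ) hom_hopf \<Rightarrow> ('k,'a univ) hopf_module set"
where
  "hopf_Obj K H = {M. four_angle_hopf_module K H M}"

text \<open>Morphisms are \<^const>\<open>extensional\<close>, so that they are determined by their values on the carrier.\<close>

definition hopf_Hom ::
  "('k,'r) ring_scheme \<Rightarrow> ('k,'a univ) hom_hopf \<Rightarrow> ('k,'a univ) hopf_module
     \<Rightarrow> ('k,'a univ) hopf_module \<Rightarrow> ('a univ \<Rightarrow> 'a univ) set"
where
  "hopf_Hom K H M N = {f \<in> extensional (carrier M).
     linear_map K M N f \<and>
     (\<forall>m \<in> carrier M. f (twist M m) = twist N (f m)) \<and>
     (\<forall>h \<in> carrier H. \<forall>m \<in> carrier M. f (lact M h m) = lact N h (f m)) \<and>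
     (\<forall>h \<in> carrier H. \<forall>m \<in> carrier M. f (ract M m h) = ract N (f m) h) \<and>
     (\<forall>m \<in> carrier M. lcoact N (f m) = tmap K H N id f (lcoact M m)) \<and>
     (\<forall>m \<in> carrier M. rcoact N (f m) = tmap K N H f id (rcoact M m))}"

definition hopf_Id :: "('k,'a univ) hopf_module \<Rightarrow> 'a univ \<Rightarrow> 'a univ" where
  "hopf_Id M = restrict id (carrier M)"

definition hopf_Comp ::
  "('k,'a univ) hopf_module \<Rightarrow> ('k,'a univ) hopf_module \<Rightarrow> ('k,'a univ) hopf_module
     \<Rightarrow> ('a univ \<Rightarrow> 'a univ) \<Rightarrow> ('a univ \<Rightarrow> 'a univ) \<Rightarrow> 'a univ \<Rightarrow> 'a univ"
where
  "hopf_Comp L M N g f = compose (carrier L) g f"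


section \<open>The Hom-cotensor product\<close>

definition cotensor_set ::
  "('k,'r) ring_scheme \<Rightarrow> ('k,'a univ) hom_hopf \<Rightarrow> ('k,'a univ) hopf_module
     \<Rightarrow> ('k,'a univ) hopf_module \<Rightarrow> 'a univ set"
where
  "cotensor_set K H M N = {x \<in> carrier (tensor K M N).
     tassoc K M H N (tmap K (tensor K M H) N (rcoact M) (twist N) x)
     = tmap K M (tensor K H N) (twist M) (lcoact N) x}"

definition cotensor_space ::
  "('k,'r) ring_scheme \<Rightarrow> ('k,'a univ) hom_hopf \<Rightarrow> ('k,'a univ) hopf_module
     \<Rightarrow> ('k,'a univ) hopf_module \<Rightarrow> ('k,'a univ) module"
where
  "cotensor_space K H M N = (tensor K M N)\<lparr>carrier := cotensor_set K H M N\<rparr>"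

text \<open>
  The subspace \<open>M \<box> N\<close> of \<open>M \<otimes> N\<close> gives the subspace \<open>H \<otimes> (M \<box> N)\<close> of \<open>H \<otimes> (M \<otimes> N)\<close>.  In the
  present construction of \<^const>\<open>tensor\<close> the former is not literally a subset of the latter; the
  inclusion is \<open>tmap K H (tensor K M N) id id\<close>.  So a map into \<open>H \<otimes> (M \<box> N)\<close> that is given by
  a formula with values in \<open>H \<otimes> (M \<otimes> N)\<close> picks the element whose image under this inclusion is the
  value of the formula.  The same applies to \<open>(M \<box> N) \<otimes> H\<close> and to the iterated products
  \<open>(M \<box> N) \<box> P\<close> and \<open>M \<box> (N \<box> P)\<close>.
\<close>

definition cotensor ::
  "('k,'r) ring_scheme \<Rightarrow> ('k,'a univ) hom_hopf \<Rightarrow> ('k,'a univ) hopf_module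
     \<Rightarrow> ('k,'a univ) hopf_module \<Rightarrow> ('k,'a univ) hopf_module"
where
  "cotensor K H M N =
    (let C = cotensor_space K H M N; \<beta>' = inv_into (carrier H) (twist H) in
     \<lparr>carrier = carrier C, mult = undefined, one = undefined, zero = zero C, add = add C,
      smult = smult C,
      twist = tmap K M N (twist M) (twist N),
      lact = (\<lambda>h x. tcomp K M N (\<lambda>a. lact M (\<beta>' a)) (\<lambda>b. lact N (\<beta>' b)) (comult H h) x),
      ract = (\<lambda>x h. tcomp K M N (\<lambda>m a. ract M m (\<beta>' a)) (\<lambda>n b. ract N n (\<beta>' b)) x (comult H h)),
      lcoact = (\<lambda>x. THE y. y \<in> carrier (tensor K H C) \<and>
        tmap K H (tensor K M N) id id y
        = tassoc K H M N (tmap K (tensor K H M) N (lcoact M) (twist N) x)),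
      rcoact = (\<lambda>x. THE y. y \<in> carrier (tensor K C H) \<and>
        tassoc K M N H (tmap K (tensor K M N) H id id y)
        = tmap K M (tensor K N H) (twist M) (rcoact N) x)\<rparr>)"

definition cotensor_map ::
  "('k,'r) ring_scheme \<Rightarrow> ('k,'a univ) hom_hopf \<Rightarrow> ('k,'a univ) hopf_module
     \<Rightarrow> ('k,'a univ) hopf_module \<Rightarrow> ('k,'a univ) hopf_module \<Rightarrow> ('k,'a univ) hopf_module
     \<Rightarrow> ('a univ \<Rightarrow> 'a univ) \<Rightarrow> ('a univ \<Rightarrow> 'a univ) \<Rightarrow> 'a univ \<Rightarrow> 'a univ"
where
  "cotensor_map K H M M' N N' f g = restrict (tmap K M' N' f g) (cotensor_set K H M N)"

definition hopf_unit :: "('k,'a univ) hom_hopf \<Rightarrow> ('k,'a univ) hopf_module" where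
  "hopf_unit H =
     \<lparr>carrier = carrier H, mult = undefined, one = undefined, zero = zero H, add = add H,
      smult = smult H, twist = twist H, lact = mult H, ract = mult H,
      lcoact = comult H, rcoact = comult H\<rparr>"

definition hopf_assoc ::
  "('k,'r) ring_scheme \<Rightarrow> ('k,'a univ) hom_hopf \<Rightarrow> ('k,'a univ) hopf_module
     \<Rightarrow> ('k,'a univ) hopf_module \<Rightarrow> ('k,'a univ) hopf_module \<Rightarrow> 'a univ \<Rightarrow> 'a univ"
where
  "hopf_assoc K H M N P =
     restrict
       (\<lambda>x. THE y. y \<in> carrier (cotensor K H M (cotensor K H N P)) \<and>
          tmap K M (tensor K N P) id id y
          = tassoc K M N P (tmap K (tensor K M N) P id id x))
       (carrier (cotensor K H (cotensor K H M N) P))"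

definition hopf_lunit ::
  "('k,'r) ring_scheme \<Rightarrow> ('k,'a univ) hom_hopf \<Rightarrow> ('k,'a univ) hopf_module
     \<Rightarrow> 'a univ \<Rightarrow> 'a univ"
where
  "hopf_lunit K H M =
     restrict (tsum M (\<lambda>g m. counit H g \<odot>\<^bsub>M\<^esub> m)) (carrier (cotensor K H (hopf_unit H) M))"

definition hopf_runit ::
  "('k,'r) ring_scheme \<Rightarrow> ('k,'a univ) hom_hopf \<Rightarrow> ('k,'a univ) hopf_module
     \<Rightarrow> 'a univ \<Rightarrow> 'a univ"
where
  "hopf_runit K H M =
     restrict (tsum M (\<lambda>m g. counit H g \<odot>\<^bsub>M\<^esub> m)) (carrier (cotensor K H M (hopf_unit H)))"

end

theory Submission
  imports Defs
begin

text \<open>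
  The four-angle axioms determine the structure maps of all products by formulas in Sweedler
  notation, so that each law becomes an identity between multilinear sums; the only point that is
  not formal is that these formulas take values in the subspaces at hand.  Over a field, tensoring
  with a fixed space preserves equalizers, whence \<open>H \<otimes> (M \<box> N)\<close> is the equalizer of the two maps
  obtained from those defining \<open>M \<box> N\<close>, and \<open>(M \<box> N) \<box> P\<close> and \<open>M \<box> (N \<box> P)\<close> are both cut out of
  \<open>M \<otimes> N \<otimes> P\<close> by the same two conditions.  The left unit constraint satisfies
  \<open>\<rho>\<^sup>l (l x) = (\<beta> \<otimes> \<zeta>) x\<close>, which exhibits its inverse as \<open>(\<beta>\<^sup>-\<^sup>1 \<otimes> \<zeta>\<^sup>-\<^sup>1) \<circ> \<rho>\<^sup>l\<close>; likewise on the right.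
\<close>

section \<open>Tensor products\<close>

text \<open>The coactions of \<open>M \<box> N\<close> and the associator are definite descriptions,
  because a tensor product whose elements are chosen formal sums does not turn a subspace of a
  factor into a subspace of the product. They are therefore never computed. Each is pinned down by
  its image under an inclusion such as \<open>left_incl\<close>, and equations in a product with a
  cotensor factor are tested after such an inclusion. Injectivity of these inclusions and the
  equalizer property have one source: every linear map f over a field has a linear g with f g f = f,
  so that injections split and equalizers are images of projections, properties that survive
  \<otimes>. The other obstacle is the twists. A Hom-identity carries \<beta> or \<zeta> on both
  sides and does not apply to an untwisted term. Bijectivity of the twists allows solving for that
  term; this is where the inverses \<open>untwist\<close> in the rewrite rules come from. The axioms
  are restated for an arbitrary multilinear F applied to the components, so that they can be used
  below further sums.\<close>

lemma linear_mapI: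
  assumes "\<And>x. x \<in> carrier V \<Longrightarrow> f x \<in> carrier W"
    and "\<And>x y. x \<in> carrier V \<Longrightarrow> y \<in> carrier V \<Longrightarrow> f (x \<oplus>\<^bsub>V\<^esub> y) = f x \<oplus>\<^bsub>W\<^esub> f y"
    and "\<And>c x. c \<in> carrier K \<Longrightarrow> x \<in> carrier V \<Longrightarrow> f (c \<odot>\<^bsub>V\<^esub> x) = c \<odot>\<^bsub>W\<^esub> f x"
  shows "linear_map K V W f"
  using assms by (auto simp: linear_map_def)

lemma linear_mapD:
  assumes "linear_map K V W f"
  shows "x \<in> carrier V \<Longrightarrow> f x \<in> carrier W"
    and "x \<in> carrier V \<Longrightarrow> y \<in> carrier V \<Longrightarrow> f (x \<oplus>\<^bsub>V\<^esub> y) = f x \<oplus>\<^bsub>W\<^esub> f y"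
    and "c \<in> carrier K \<Longrightarrow> x \<in> carrier V \<Longrightarrow> f (c \<odot>\<^bsub>V\<^esub> x) = c \<odot>\<^bsub>W\<^esub> f x"
  using assms by (auto simp: linear_map_def)

lemma linear_map_zero:
  assumes "module K V" "module K W" "linear_map K V W f"
  shows "f \<zero>\<^bsub>V\<^esub> = \<zero>\<^bsub>W\<^esub>"
proof -
  interpret V: module K V by fact
  interpret W: module K W by fact
  have "f (\<zero>\<^bsub>K\<^esub> \<odot>\<^bsub>V\<^esub> \<zero>\<^bsub>V\<^esub>) = \<zero>\<^bsub>K\<^esub> \<odot>\<^bsub>W\<^esub> f \<zero>\<^bsub>V\<^esub>"
    using linear_mapD(3)[OF assms(3)] by blast
  then show ?thesis
    using linear_mapD(1)[OF assms(3)] by simp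
qed

lemma linear_map_minus:
  assumes "module K V" "module K W" "linear_map K V W f" "x \<in> carrier V" "y \<in> carrier V"
  shows "f (x \<ominus>\<^bsub>V\<^esub> y) = f x \<ominus>\<^bsub>W\<^esub> f y"
proof -
  interpret V: module K V by fact
  interpret W: module K W by fact
  note f = linear_mapD[OF assms(3)]
  have "f x = f ((x \<ominus>\<^bsub>V\<^esub> y) \<oplus>\<^bsub>V\<^esub> y)"
    using assms by (simp add: V.minus_eq V.add.m_assoc V.l_neg)
  also have "\<dots> = f (x \<ominus>\<^bsub>V\<^esub> y) \<oplus>\<^bsub>W\<^esub> f y"
    using assms f by simp
  finally have "f x \<ominus>\<^bsub>W\<^esub> f y = (f (x \<ominus>\<^bsub>V\<^esub> y) \<oplus>\<^bsub>W\<^esub> f y) \<ominus>\<^bsub>W\<^esub> f y"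
    by simp
  also have "\<dots> = f (x \<ominus>\<^bsub>V\<^esub> y)"
    using f assms by (simp add: W.minus_eq W.add.m_assoc W.r_neg)
  finally show ?thesis by simp
qed

lemma linear_map_cong:
  assumes "module K V" "\<And>x. x \<in> carrier V \<Longrightarrow> f x = g x"
  shows "linear_map K V W f \<longleftrightarrow> linear_map K V W g"
proof -
  interpret V: module K V by fact
  show ?thesis
    using assms(2) by (auto simp: linear_map_def Pi_iff)
qed

lemma linear_map_compose:
  assumes "linear_map K V W g" "linear_map K U V f"
  shows "linear_map K U W (\<lambda>x. g (f x))"
  using assms by (auto simp: linear_map_def Pi_iff)

lemma linear_map_ident: "linear_map K V V (\<lambda>x. x)"
  by (simp add: linear_map_def)

lemma linear_map_add:
  assumes "module K W" "linear_map K V W f" "linear_map K V W g"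
  shows "linear_map K V W (\<lambda>x. f x \<oplus>\<^bsub>W\<^esub> g x)"
proof -
  interpret W: module K W by fact
  show ?thesis
    using linear_mapD[OF assms(2)] linear_mapD[OF assms(3)]
    by (auto intro!: linear_mapI simp: W.smult_r_distr W.add.m_ac)
qed

lemma linear_map_smult:
  assumes "module K W" "linear_map K V W f" "c \<in> carrier K"
  shows "linear_map K V W (\<lambda>x. c \<odot>\<^bsub>W\<^esub> f x)"
proof -
  interpret W: module K W by fact
  show ?thesis
    using linear_mapD[OF assms(2)] assms(3)
    by (auto intro!: linear_mapI simp: W.smult_r_distr W.R.m_comm simp flip: W.smult_assoc1)
qed

lemma linear_map_diff:
  assumes "module K W" "linear_map K V W f" "linear_map K V W g"
  shows "linear_map K V W (\<lambda>x. f x \<ominus>\<^bsub>W\<^esub> g x)"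
proof -
  interpret W: module K W by fact
  show ?thesis
    using linear_mapD[OF assms(2)] linear_mapD[OF assms(3)]
    by (auto intro!: linear_mapI
        simp: W.smult_r_distr W.add.m_ac W.minus_eq W.minus_add W.smult_r_minus)
qed

lemma bilinear_mapI:
  assumes "\<And>x. x \<in> carrier U \<Longrightarrow> linear_map K V W (f x)"
    and "\<And>y. y \<in> carrier V \<Longrightarrow> linear_map K U W (\<lambda>x. f x y)"
  shows "bilinear_map K U V W f"
  using assms by (auto simp: bilinear_map_def)

lemma bilinear_mapD:
  assumes "bilinear_map K U V W f"
  shows "x \<in> carrier U \<Longrightarrow> linear_map K V W (f x)"
    and "y \<in> carrier V \<Longrightarrow> linear_map K U W (\<lambda>x. f x y)"
  using assms by (auto simp: bilinear_map_def)

lemma bilinear_map_closed: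
  "bilinear_map K U V W f \<Longrightarrow> x \<in> carrier U \<Longrightarrow> y \<in> carrier V \<Longrightarrow> f x y \<in> carrier W"
  by (rule linear_mapD(1)[OF bilinear_mapD(1)])

text \<open>The fold inside \<open>tsum\<close>, taken on bare lists: \<open>tensor_eq\<close>
  relates lists, so invariance under it has to be established before representatives are
  chosen.\<close>

definition lsum ::
  "('k,'u,'s) module_scheme \<Rightarrow> ('v \<Rightarrow> 'w \<Rightarrow> 'u) \<Rightarrow> ('v \<times> 'w) list \<Rightarrow> 'u"
where
  "lsum U F xs = foldr (\<lambda>(v, w) u. F v w \<oplus>\<^bsub>U\<^esub> u) xs \<zero>\<^bsub>U\<^esub>"

lemma lsum_simps [simp]:
  "lsum U F [] = \<zero>\<^bsub>U\<^esub>"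
  "lsum U F ((v, w) # xs) = F v w \<oplus>\<^bsub>U\<^esub> lsum U F xs"
  by (simp_all add: lsum_def)

lemma lsum_cong:
  "xs = ys \<Longrightarrow> (\<And>v w. (v, w) \<in> set ys \<Longrightarrow> F v w = G v w) \<Longrightarrow> lsum U F xs = lsum U G ys"
proof (induction ys arbitrary: xs)
  case (Cons a ys)
  then show ?case by (cases a) auto
qed simp

lemma lsum_closed:
  assumes "module K U" "\<And>v w. (v, w) \<in> set xs \<Longrightarrow> F v w \<in> carrier U"
  shows "lsum U F xs \<in> carrier U"
proof -
  interpret U: module K U by fact
  show ?thesis using assms(2)
    by (induction xs) auto
qed

lemma lsum_append:
  assumes "module K U" "\<And>v w. (v, w) \<in> set (xs @ ys) \<Longrightarrow> F v w \<in> carrier U"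
  shows "lsum U F (xs @ ys) = lsum U F xs \<oplus>\<^bsub>U\<^esub> lsum U F ys"
proof -
  interpret U: module K U by fact
  show ?thesis using assms(2)
  proof (induction xs)
    case Nil
    then show ?case using lsum_closed[OF assms(1), of ys F] by simp
  next
    case (Cons a xs)
    then show ?case
      using lsum_closed[OF assms(1), of ys F] lsum_closed[OF assms(1), of xs F]
      by (cases a) (auto simp: U.add.m_assoc)
  qed
qed

lemma lsum_zero:
  assumes "module K U" "\<And>v w. (v, w) \<in> set xs \<Longrightarrow> F v w = \<zero>\<^bsub>U\<^esub>"
  shows "lsum U F xs = \<zero>\<^bsub>U\<^esub>"
proof -
  interpret U: module K U by fact
  show ?thesis using assms(2) by (induction xs) auto
qed

lemma lsum_add:
  assumes "module K U" "\<And>v w. (v, w) \<in> set xs \<Longrightarrow> F v w \<in> carrier U"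
    and "\<And>v w. (v, w) \<in> set xs \<Longrightarrow> G v w \<in> carrier U"
  shows "lsum U (\<lambda>v w. F v w \<oplus>\<^bsub>U\<^esub> G v w) xs = lsum U F xs \<oplus>\<^bsub>U\<^esub> lsum U G xs"
proof -
  interpret U: module K U by fact
  show ?thesis using assms(2,3)
  proof (induction xs)
    case (Cons a xs)
    then show ?case
      using lsum_closed[OF assms(1), of xs F] lsum_closed[OF assms(1), of xs G]
      by (cases a) (auto simp: U.add.m_ac)
  qed simp
qed

lemma lsum_linear:
  assumes "module K U" "module K U'" "linear_map K U U' g"
    and "\<And>v w. (v, w) \<in> set xs \<Longrightarrow> F v w \<in> carrier U"
  shows "g (lsum U F xs) = lsum U' (\<lambda>v w. g (F v w)) xs"
  using assms(4)
proof (induction xs)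
  case Nil
  then show ?case using linear_map_zero[OF assms(1-3)] by simp
next
  case (Cons a xs)
  then show ?case
    using lsum_closed[OF assms(1), of xs F] linear_mapD[OF assms(3)]
    by (cases a) auto
qed

lemma lsum_swap:
  assumes "module K U"
    and "\<And>v w a b. (v, w) \<in> set xs \<Longrightarrow> (a, b) \<in> set ys \<Longrightarrow> F v w a b \<in> carrier U"
  shows "lsum U (\<lambda>v w. lsum U (\<lambda>a b. F v w a b) ys) xs
    = lsum U (\<lambda>a b. lsum U (\<lambda>v w. F v w a b) xs) ys"
  using assms(2)
proof (induction xs)
  case Nil
  then show ?case by (simp add: lsum_zero[OF assms(1)])
next
  case (Cons x xs)
  obtain v w where x: "x = (v, w)" by (cases x)
  have "lsum U (\<lambda>a b. F v w a b \<oplus>\<^bsub>U\<^esub> lsum U (\<lambda>v w. F v w a b) xs) ys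
    = lsum U (F v w) ys \<oplus>\<^bsub>U\<^esub> lsum U (\<lambda>a b. lsum U (\<lambda>v w. F v w a b) xs) ys"
    using Cons.prems by (intro lsum_add[OF assms(1)] lsum_closed[OF assms(1)]) (auto simp: x)
  then show ?case using Cons by (simp add: x)
qed

lemma linear_map_lsum:
  assumes "module K U"
    and "\<And>v w. (v, w) \<in> set xs \<Longrightarrow> linear_map K X U (\<lambda>x. F x v w)"
  shows "linear_map K X U (\<lambda>x. lsum U (F x) xs)"
  using assms(2)
proof (induction xs)
  case Nil
  interpret U: module K U by fact
  show ?case by (auto intro!: linear_mapI)
next
  case (Cons a xs)
  then show ?case
    by (cases a) (auto intro!: linear_map_add[OF assms(1)])
qed

section \<open>The congruence on formal sums\<close>

context
  fixes K :: "('k,'r) ring_scheme" and V :: "('k,'v,'s) module_scheme"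
    and W :: "('k,'w,'t) module_scheme"
  assumes V: "module K V" and W: "module K W"
begin

lemma tensor_eq_set:
  assumes "tensor_eq K V W xs ys"
  shows "set xs \<subseteq> carrier V \<times> carrier W \<and> set ys \<subseteq> carrier V \<times> carrier W"
proof -
  interpret V: module K V by (rule V)
  interpret W: module K W by (rule W)
  show ?thesis using assms by induction auto
qed

text \<open>Makes scalar multiplication of classes well defined. Scalars act on the left entry only,
  so the case \<open>balanced\<close> needs two scalars on that entry to commute.\<close>

lemma tensor_eq_smult:
  assumes "tensor_eq K V W xs ys" "c \<in> carrier K"
  shows "tensor_eq K V W (map (\<lambda>(v, w). (c \<odot>\<^bsub>V\<^esub> v, w)) xs) (map (\<lambda>(v, w). (c \<odot>\<^bsub>V\<^esub> v, w)) ys)"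
proof -
  interpret V: module K V by (rule V)
  interpret W: module K W by (rule W)
  show ?thesis using assms(1)
  proof induction
    case (refl xs)
    then show ?case using assms(2) by (intro tensor_eq.refl) auto
  next
    case (sym xs ys)
    show ?case by (rule tensor_eq.sym[OF sym.IH])
  next
    case (trans xs ys zs)
    show ?case by (rule tensor_eq.trans[OF trans.IH])
  next
    case (append xs xs' ys ys')
    show ?case unfolding map_append by (rule tensor_eq.append[OF append.IH])
  next
    case (commute xs ys)
    then show ?case unfolding map_append using assms(2) by (intro tensor_eq.commute) auto
  next
    case (add_left v v' w)
    then show ?case
      using tensor_eq.add_left[where K=K, of "c \<odot>\<^bsub>V\<^esub> v" V "c \<odot>\<^bsub>V\<^esub> v'" w W] assms(2)
      by (simp add: V.smult_r_distr)
  next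
    case (add_right v w w')
    then show ?case
      using assms(2) by (simp add: tensor_eq.add_right)
  next
    case (zero w)
    then show ?case
      using assms(2) by (simp add: tensor_eq.zero)
  next
    case (balanced d v w)
    then show ?case
      using tensor_eq.balanced[where K=K, of d "c \<odot>\<^bsub>V\<^esub> v" V w W] assms(2)
      by (simp add: V.R.m_comm flip: V.smult_assoc1)
  qed
qed

text \<open>Formal sums have no negatives of their own; this identity with c = -1 and d = 1 supplies
  them. Additivity in the left entry splits each pair, which interleaves the two lists, and
  \<open>commute\<close> sorts them.\<close>

lemma tensor_eq_add_smult:
  assumes "set xs \<subseteq> carrier V \<times> carrier W" "c \<in> carrier K" "d \<in> carrier K"
  shows "tensor_eq K V W (map (\<lambda>(v, w). ((c \<oplus>\<^bsub>K\<^esub> d) \<odot>\<^bsub>V\<^esub> v, w)) xs)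
    (map (\<lambda>(v, w). (c \<odot>\<^bsub>V\<^esub> v, w)) xs @ map (\<lambda>(v, w). (d \<odot>\<^bsub>V\<^esub> v, w)) xs)"
proof -
  interpret V: module K V by (rule V)
  interpret W: module K W by (rule W)
  let ?f = "\<lambda>c. map (\<lambda>(v, w). (c \<odot>\<^bsub>V\<^esub> v, w))"
  have f: "set (?f c xs) \<subseteq> carrier V \<times> carrier W" if "c \<in> carrier K" "set xs \<subseteq> carrier V \<times> carrier W"
    for c xs using that by auto
  show ?thesis using assms(1)
  proof (induction xs)
    case Nil
    show ?case by (simp add: tensor_eq.refl)
  next
    case (Cons x xs)
    obtain v w where x: "x = (v, w)" "v \<in> carrier V" "w \<in> carrier W"
      using Cons.prems by (cases x) auto
    have xs: "set xs \<subseteq> carrier V \<times> carrier W" using Cons.prems by simp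
    have "tensor_eq K V W ([((c \<oplus>\<^bsub>K\<^esub> d) \<odot>\<^bsub>V\<^esub> v, w)] @ ?f (c \<oplus>\<^bsub>K\<^esub> d) xs)
        ([(c \<odot>\<^bsub>V\<^esub> v, w), (d \<odot>\<^bsub>V\<^esub> v, w)] @ (?f c xs @ ?f d xs))"
      using x assms xs Cons.IH
      by (intro tensor_eq.append) (auto simp: V.smult_l_distr intro!: tensor_eq.add_left)
    moreover have "tensor_eq K V W
        ([(c \<odot>\<^bsub>V\<^esub> v, w)] @ ((([(d \<odot>\<^bsub>V\<^esub> v, w)]) @ ?f c xs) @ ?f d xs))
        ([(c \<odot>\<^bsub>V\<^esub> v, w)] @ ((?f c xs @ [(d \<odot>\<^bsub>V\<^esub> v, w)]) @ ?f d xs))"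
      using x assms xs f
      by (intro tensor_eq.append[OF tensor_eq.refl]
          tensor_eq.append[OF tensor_eq.commute tensor_eq.refl]) auto
    ultimately show ?case
      by (simp add: x) (rule tensor_eq.trans)
  qed
qed

lemma tensor_eq_zero_smult:
  assumes "set xs \<subseteq> carrier V \<times> carrier W"
  shows "tensor_eq K V W (map (\<lambda>(v, w). (\<zero>\<^bsub>K\<^esub> \<odot>\<^bsub>V\<^esub> v, w)) xs) []"
proof -
  interpret V: module K V by (rule V)
  interpret W: module K W by (rule W)
  show ?thesis using assms
  proof (induction xs)
    case Nil
    show ?case by (simp add: tensor_eq.refl)
  next
    case (Cons x xs)
    obtain v w where x: "x = (v, w)" "v \<in> carrier V" "w \<in> carrier W"
      using Cons.prems by (cases x) auto
    have "tensor_eq K V W ([(\<zero>\<^bsub>V\<^esub>, w)] @ map (\<lambda>(v, w). (\<zero>\<^bsub>K\<^esub> \<odot>\<^bsub>V\<^esub> v, w)) xs) ([] @ [])"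
      using Cons x by (intro tensor_eq.append tensor_eq.zero) auto
    then show ?case using x by simp
  qed
qed

text \<open>Half of the universal property: each generator of the congruence is an instance of a law
  that bilinear maps satisfy, and swapping two blocks is commutativity of addition in U.\<close>

lemma lsum_tensor_eq:
  assumes U: "module K U" and F: "bilinear_map K V W U F" and "tensor_eq K V W xs ys"
  shows "lsum U F xs = lsum U F ys"
proof -
  interpret V: module K V by (rule V)
  interpret W: module K W by (rule W)
  interpret U: module K U by (rule U)
  note cl = bilinear_map_closed[OF F]
  note l = linear_mapD[OF bilinear_mapD(1)[OF F]]
  note r = linear_mapD[OF bilinear_mapD(2)[OF F]]
  have sc: "lsum U F xs \<in> carrier U" if "set xs \<subseteq> carrier V \<times> carrier W" for xs
    using that by (intro lsum_closed[OF U] cl) auto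
  show ?thesis using assms(3)
  proof induction
    case (append xs xs' ys ys')
    then have "set (xs @ ys) \<subseteq> carrier V \<times> carrier W" "set (xs' @ ys') \<subseteq> carrier V \<times> carrier W"
      using tensor_eq_set by auto
    then have "lsum U F (xs @ ys) = lsum U F xs \<oplus>\<^bsub>U\<^esub> lsum U F ys"
      "lsum U F (xs' @ ys') = lsum U F xs' \<oplus>\<^bsub>U\<^esub> lsum U F ys'"
      by (auto intro!: lsum_append[OF U] cl)
    then show ?case using append by simp
  next
    case (commute xs ys)
    then have "lsum U F (xs @ ys) = lsum U F xs \<oplus>\<^bsub>U\<^esub> lsum U F ys"
      "lsum U F (ys @ xs) = lsum U F ys \<oplus>\<^bsub>U\<^esub> lsum U F xs"
      by (auto intro!: lsum_append[OF U] cl)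
    then show ?case using commute sc by (simp add: U.add.m_comm)
  next
    case (add_left v v' w)
    then show ?case using r(1,2) by (simp add: cl)
  next
    case (add_right v w w')
    then show ?case using l(1,2) by (simp add: cl)
  next
    case (zero w)
    then show ?case using linear_map_zero[OF V U bilinear_mapD(2)[OF F]] by simp
  next
    case (balanced c v w)
    then show ?case using l(1,3) r(3) by simp
  qed simp_all
qed

end

section \<open>The tensor product as a module\<close>

context
  fixes K :: "('k,'r) ring_scheme" and V :: "('k,'a univ,'s) module_scheme"
    and W :: "('k,'a univ,'t) module_scheme"
  assumes V: "module K V" and W: "module K W"
begin

lemma tensor_eq_summands_class:
  "set xs \<subseteq> carrier V \<times> carrier W \<Longrightarrow> tensor_eq K V W xs (summands (tensor_class K V W xs))"
  unfolding tensor_class_def using someI[of "tensor_eq K V W xs", OF tensor_eq.refl] by simp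

text \<open>Congruent lists give equal predicates \<open>tensor_eq K V W xs\<close> and
  \<open>tensor_eq K V W ys\<close>, hence \<open>SOME\<close> selects the same representative for
  both.\<close>

lemma tensor_class_eqI:
  "tensor_eq K V W xs ys \<Longrightarrow> tensor_class K V W xs = tensor_class K V W ys"
proof -
  assume "tensor_eq K V W xs ys"
  then have "tensor_eq K V W xs = tensor_eq K V W ys"
    by (blast intro: tensor_eq.trans tensor_eq.sym)
  then show ?thesis by (simp add: tensor_class_def)
qed

lemma tensor_carrier_iff:
  "t \<in> carrier (tensor K V W)
    \<longleftrightarrow> (\<exists>xs. set xs \<subseteq> carrier V \<times> carrier W \<and> t = tensor_class K V W xs)"
  by (auto simp: tensor_def)

text \<open>The representative stored in a tensor lies in the class it represents, so a tensor can
  be rebuilt from its summands.\<close>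

lemma tensor_carrierE:
  assumes "t \<in> carrier (tensor K V W)"
  shows "set (summands t) \<subseteq> carrier V \<times> carrier W" "tensor_class K V W (summands t) = t"
proof -
  obtain xs where xs: "set xs \<subseteq> carrier V \<times> carrier W" "t = tensor_class K V W xs"
    using assms tensor_carrier_iff by blast
  have "tensor_eq K V W xs (summands t)"
    using tensor_eq_summands_class xs by simp
  then show "set (summands t) \<subseteq> carrier V \<times> carrier W" "tensor_class K V W (summands t) = t"
    using tensor_eq_set[OF V W] tensor_class_eqI[OF tensor_eq.sym] xs by auto
qed

lemma tensor_class_closed:
  "set xs \<subseteq> carrier V \<times> carrier W \<Longrightarrow> tensor_class K V W xs \<in> carrier (tensor K V W)"
  by (auto simp: tensor_def)

lemma tensor_add_class:
  assumes "set xs \<subseteq> carrier V \<times> carrier W" "set ys \<subseteq> carrier V \<times> carrier W"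
  shows "tensor_class K V W xs \<oplus>\<^bsub>tensor K V W\<^esub> tensor_class K V W ys = tensor_class K V W (xs @ ys)"
  using assms
  by (simp add: tensor_def)
    (intro tensor_class_eqI tensor_eq.append; rule tensor_eq.sym[OF tensor_eq_summands_class])

lemma tensor_smult_class:
  assumes "set xs \<subseteq> carrier V \<times> carrier W" "c \<in> carrier K"
  shows "c \<odot>\<^bsub>tensor K V W\<^esub> tensor_class K V W xs
    = tensor_class K V W (map (\<lambda>(v, w). (c \<odot>\<^bsub>V\<^esub> v, w)) xs)"
  using assms
  by (simp add: tensor_def)
    (intro tensor_class_eqI tensor_eq_smult[OF V W] tensor_eq.sym[OF tensor_eq_summands_class]; simp)

lemma tensor_zero: "\<zero>\<^bsub>tensor K V W\<^esub> = tensor_class K V W []"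
  by (simp add: tensor_def)

lemma module_tensor: "module K (tensor K V W)"
proof -
  interpret V: module K V by (rule V)
  interpret W: module K W by (rule W)
  let ?T = "tensor K V W" and ?cls = "tensor_class K V W"
  let ?f = "\<lambda>c. map (\<lambda>(v, w). (c \<odot>\<^bsub>V\<^esub> v, w))"
  have f: "set (?f c xs) \<subseteq> carrier V \<times> carrier W" if "c \<in> carrier K" "set xs \<subseteq> carrier V \<times> carrier W"
    for c xs using that by auto
  have ex: "\<exists>xs. set xs \<subseteq> carrier V \<times> carrier W \<and> t = ?cls xs" if "t \<in> carrier ?T" for t
    using that tensor_carrier_iff by blast
  have one: "?f \<one>\<^bsub>K\<^esub> xs = xs" if "set xs \<subseteq> carrier V \<times> carrier W" for xs
    using that by (induction xs) auto
  note [simp] = tensor_add_class tensor_smult_class f tensor_class_closed and [simp del] = set_map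
  have grp: "abelian_group ?T"
  proof (rule abelian_groupI)
    show "\<zero>\<^bsub>?T\<^esub> \<in> carrier ?T" by (simp add: tensor_zero)
  next
    fix x y z assume "x \<in> carrier ?T" "y \<in> carrier ?T" "z \<in> carrier ?T"
    then obtain xs ys zs where s: "set xs \<subseteq> carrier V \<times> carrier W" "x = ?cls xs"
        "set ys \<subseteq> carrier V \<times> carrier W" "y = ?cls ys"
        "set zs \<subseteq> carrier V \<times> carrier W" "z = ?cls zs"
      using ex by metis
    show "x \<oplus>\<^bsub>?T\<^esub> y \<in> carrier ?T" using s by simp
    show "x \<oplus>\<^bsub>?T\<^esub> y \<oplus>\<^bsub>?T\<^esub> z = x \<oplus>\<^bsub>?T\<^esub> (y \<oplus>\<^bsub>?T\<^esub> z)" using s by simp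
    show "x \<oplus>\<^bsub>?T\<^esub> y = y \<oplus>\<^bsub>?T\<^esub> x" using s by (simp add: tensor_class_eqI[OF tensor_eq.commute])
    show "\<zero>\<^bsub>?T\<^esub> \<oplus>\<^bsub>?T\<^esub> x = x" using s by (simp add: tensor_zero)
    show "\<exists>y\<in>carrier ?T. y \<oplus>\<^bsub>?T\<^esub> x = \<zero>\<^bsub>?T\<^esub>"
    proof
      show "?cls (?f (\<ominus>\<^bsub>K\<^esub> \<one>\<^bsub>K\<^esub>) xs) \<in> carrier ?T"
        using s by (intro tensor_class_closed f) auto
      \<comment> \<open>Additive inverse: -1 times the list. Appending 1 times the list gives (-1 +
        1) times the list, which is congruent to the empty one.\<close>
      have "tensor_eq K V W (?f (\<ominus>\<^bsub>K\<^esub> \<one>\<^bsub>K\<^esub>) xs @ ?f \<one>\<^bsub>K\<^esub> xs) []"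
        using tensor_eq_add_smult[OF V W, of xs "\<ominus>\<^bsub>K\<^esub> \<one>\<^bsub>K\<^esub>" "\<one>\<^bsub>K\<^esub>"] s
          tensor_eq.trans[OF tensor_eq.sym tensor_eq_zero_smult[OF V W], of xs]
        by (simp add: V.R.l_neg)
      then show "?cls (?f (\<ominus>\<^bsub>K\<^esub> \<one>\<^bsub>K\<^esub>) xs) \<oplus>\<^bsub>?T\<^esub> x = \<zero>\<^bsub>?T\<^esub>"
        using s one by (simp add: tensor_zero tensor_class_eqI)
    qed
  qed
  show ?thesis
  proof (rule moduleI)
    show "cring K" by (rule V.R.is_cring)
    show "abelian_group ?T" by (rule grp)
    fix a b x y assume *: "a \<in> carrier K" "b \<in> carrier K" "x \<in> carrier ?T" "y \<in> carrier ?T"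
    then obtain xs ys where s: "set xs \<subseteq> carrier V \<times> carrier W" "x = ?cls xs"
        "set ys \<subseteq> carrier V \<times> carrier W" "y = ?cls ys"
      using ex by metis
    show "a \<odot>\<^bsub>?T\<^esub> x \<in> carrier ?T" using s * by simp
    show "(a \<oplus>\<^bsub>K\<^esub> b) \<odot>\<^bsub>?T\<^esub> x = a \<odot>\<^bsub>?T\<^esub> x \<oplus>\<^bsub>?T\<^esub> b \<odot>\<^bsub>?T\<^esub> x"
      using s * by (simp add: tensor_class_eqI[OF tensor_eq_add_smult[OF V W]])
    show "a \<odot>\<^bsub>?T\<^esub> (x \<oplus>\<^bsub>?T\<^esub> y) = a \<odot>\<^bsub>?T\<^esub> x \<oplus>\<^bsub>?T\<^esub> a \<odot>\<^bsub>?T\<^esub> y"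
      using s * by simp
    have "?f (a \<otimes>\<^bsub>K\<^esub> b) xs = ?f a (?f b xs)"
      using s * by (auto simp: V.smult_assoc1)
    then show "(a \<otimes>\<^bsub>K\<^esub> b) \<odot>\<^bsub>?T\<^esub> x = a \<odot>\<^bsub>?T\<^esub> (b \<odot>\<^bsub>?T\<^esub> x)"
      using s * by (simp del: map_map)
  next
    fix x assume "x \<in> carrier ?T"
    then obtain xs where "set xs \<subseteq> carrier V \<times> carrier W" "x = ?cls xs"
      using ex by metis
    then show "\<one>\<^bsub>K\<^esub> \<odot>\<^bsub>?T\<^esub> x = x" using one by simp
  qed
qed

lemma tens_closed: "v \<in> carrier V \<Longrightarrow> w \<in> carrier W \<Longrightarrow> tens K V W v w \<in> carrier (tensor K V W)"
  by (simp add: tens_def tensor_class_closed)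

lemma bilinear_map_tens: "bilinear_map K V W (tensor K V W) (tens K V W)"
proof -
  interpret V: module K V by (rule V)
  interpret W: module K W by (rule W)
  have "tens K V W v (w \<oplus>\<^bsub>W\<^esub> w') = tens K V W v w \<oplus>\<^bsub>tensor K V W\<^esub> tens K V W v w'"
    "tens K V W (v \<oplus>\<^bsub>V\<^esub> v') w = tens K V W v w \<oplus>\<^bsub>tensor K V W\<^esub> tens K V W v' w"
    if "v \<in> carrier V" "v' \<in> carrier V" "w \<in> carrier W" "w' \<in> carrier W" for v v' w w'
    using that by (simp_all add: tens_def tensor_add_class
        tensor_class_eqI[OF tensor_eq.add_right] tensor_class_eqI[OF tensor_eq.add_left])
  moreover have "tens K V W v (c \<odot>\<^bsub>W\<^esub> w) = c \<odot>\<^bsub>tensor K V W\<^esub> tens K V W v w"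
    "tens K V W (c \<odot>\<^bsub>V\<^esub> v) w = c \<odot>\<^bsub>tensor K V W\<^esub> tens K V W v w"
    if "v \<in> carrier V" "w \<in> carrier W" "c \<in> carrier K" for v w c
    using that by (simp_all add: tens_def tensor_smult_class
        tensor_class_eqI[OF tensor_eq.sym[OF tensor_eq.balanced]])
  ultimately show ?thesis
    by (intro bilinear_mapI linear_mapI) (simp_all add: tens_closed)
qed

lemma lsum_tens:
  "set xs \<subseteq> carrier V \<times> carrier W \<Longrightarrow> lsum (tensor K V W) (tens K V W) xs = tensor_class K V W xs"
proof (induction xs)
  case Nil
  then show ?case by (simp add: tensor_zero)
next
  case (Cons a xs)
  then show ?case by (cases a) (simp add: tens_def tensor_add_class)
qed

lemma lsum_summands_class:
  assumes "module K U" "bilinear_map K V W U F" "set xs \<subseteq> carrier V \<times> carrier W"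
  shows "lsum U F (summands (tensor_class K V W xs)) = lsum U F xs"
  using lsum_tensor_eq[OF V W assms(1,2) tensor_eq.sym[OF tensor_eq_summands_class[OF assms(3)]]] .

end

section \<open>Splitting linear maps\<close>

text \<open>Zorn's lemma on graphs of partial linear sections of \<open>f\<close>: at a maximal graph, every vector
  outside of its domain can be adjoined, after translating it into the image of \<open>f\<close> if possible.\<close>

lemma linear_generalized_inverse:
  assumes K: "field K" and V: "module K V" and W: "module K W" and f: "linear_map K V W f"
  shows "\<exists>g. linear_map K W V g \<and> (\<forall>x \<in> carrier V. f (g (f x)) = f x)"
proof -
  interpret K: field K by (rule K)
  interpret V: module K V by (rule V)
  interpret W: module K W by (rule W)
  note f_cl = linear_mapD(1)[OF f] and f_add = linear_mapD(2)[OF f] and f_smult = linear_mapD(3)[OF f]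
  define I where "I = f ` carrier V"
  have I_add: "x \<oplus>\<^bsub>W\<^esub> y \<in> I" if "x \<in> I" "y \<in> I" for x y
    using that f_add by (auto simp: I_def simp flip: f_add)
  have I_smult: "c \<odot>\<^bsub>W\<^esub> x \<in> I" if "x \<in> I" "c \<in> carrier K" for x c
    using that by (auto simp: I_def simp flip: f_smult)
  have I_cl: "x \<in> carrier W" if "x \<in> I" for x
    using that f_cl by (auto simp: I_def)
  \<comment> \<open>Pairs are (w, v) with v the value at w. A subspace of W \<times> V that contains
    (0, v) only for v = 0 is the graph of a partial linear map; the last condition makes it a
    section of f wherever its domain meets the image I.\<close>
  define A where "A = {G. G \<subseteq> carrier W \<times> carrier V \<and> (\<zero>\<^bsub>W\<^esub>, \<zero>\<^bsub>V\<^esub>) \<in> G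
    \<and> (\<forall>w v w' v'. (w, v) \<in> G \<longrightarrow> (w', v') \<in> G \<longrightarrow> (w \<oplus>\<^bsub>W\<^esub> w', v \<oplus>\<^bsub>V\<^esub> v') \<in> G)
    \<and> (\<forall>c w v. c \<in> carrier K \<longrightarrow> (w, v) \<in> G \<longrightarrow> (c \<odot>\<^bsub>W\<^esub> w, c \<odot>\<^bsub>V\<^esub> v) \<in> G)
    \<and> (\<forall>v. (\<zero>\<^bsub>W\<^esub>, v) \<in> G \<longrightarrow> v = \<zero>\<^bsub>V\<^esub>)
    \<and> (\<forall>w v. (w, v) \<in> G \<longrightarrow> w \<in> I \<longrightarrow> f v = w)}"
  have A_cl: "G \<subseteq> carrier W \<times> carrier V" and A_zero: "(\<zero>\<^bsub>W\<^esub>, \<zero>\<^bsub>V\<^esub>) \<in> G"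
    and A_add: "\<And>w v w' v'. (w, v) \<in> G \<Longrightarrow> (w', v') \<in> G \<Longrightarrow> (w \<oplus>\<^bsub>W\<^esub> w', v \<oplus>\<^bsub>V\<^esub> v') \<in> G"
    and A_smult: "\<And>c w v. c \<in> carrier K \<Longrightarrow> (w, v) \<in> G \<Longrightarrow> (c \<odot>\<^bsub>W\<^esub> w, c \<odot>\<^bsub>V\<^esub> v) \<in> G"
    and A_fun: "\<And>v. (\<zero>\<^bsub>W\<^esub>, v) \<in> G \<Longrightarrow> v = \<zero>\<^bsub>V\<^esub>"
    and A_sec: "\<And>w v. (w, v) \<in> G \<Longrightarrow> w \<in> I \<Longrightarrow> f v = w"
    if "G \<in> A" for G
    using that unfolding A_def by simp_all
  have A_I: "G \<in> A"
    if "G \<subseteq> carrier W \<times> carrier V" "(\<zero>\<^bsub>W\<^esub>, \<zero>\<^bsub>V\<^esub>) \<in> G"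
      "\<And>w v w' v'. (w, v) \<in> G \<Longrightarrow> (w', v') \<in> G \<Longrightarrow> (w \<oplus>\<^bsub>W\<^esub> w', v \<oplus>\<^bsub>V\<^esub> v') \<in> G"
      "\<And>c w v. c \<in> carrier K \<Longrightarrow> (w, v) \<in> G \<Longrightarrow> (c \<odot>\<^bsub>W\<^esub> w, c \<odot>\<^bsub>V\<^esub> v) \<in> G"
      "\<And>v. (\<zero>\<^bsub>W\<^esub>, v) \<in> G \<Longrightarrow> v = \<zero>\<^bsub>V\<^esub>"
      "\<And>w v. (w, v) \<in> G \<Longrightarrow> w \<in> I \<Longrightarrow> f v = w" for G
    unfolding A_def by (intro CollectI conjI allI impI) (rule that; assumption)+
  have "{(\<zero>\<^bsub>W\<^esub>, \<zero>\<^bsub>V\<^esub>)} \<in> A"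
    using linear_map_zero[OF V W f] by (auto simp: A_def)
  then have "A \<noteq> {}" by blast
  moreover have "\<Union>C \<in> A" if ne: "C \<noteq> {}" and ch: "subset.chain A C" for C
  proof -
    have CA: "\<And>G. G \<in> C \<Longrightarrow> G \<in> A" and tot: "\<And>G G'. G \<in> C \<Longrightarrow> G' \<in> C \<Longrightarrow> G \<subseteq> G' \<or> G' \<subseteq> G"
      using ch by (auto simp: subset.chain_def)
    show ?thesis
    proof (rule A_I)
      fix w v w' v' assume wv: "(w, v) \<in> \<Union>C" "(w', v') \<in> \<Union>C"
      obtain G G' where G: "G \<in> C" "G' \<in> C" "(w, v) \<in> G" "(w', v') \<in> G'" using wv by blast
      obtain G'' where "G'' \<in> C" "(w, v) \<in> G''" "(w', v') \<in> G''"
        using tot[OF G(1,2)] G by blast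
      then have "(w \<oplus>\<^bsub>W\<^esub> w', v \<oplus>\<^bsub>V\<^esub> v') \<in> G''" using A_add[OF CA] by simp
      then show "(w \<oplus>\<^bsub>W\<^esub> w', v \<oplus>\<^bsub>V\<^esub> v') \<in> \<Union>C" using \<open>G'' \<in> C\<close> by blast
    next
      show "\<Union>C \<subseteq> carrier W \<times> carrier V" using A_cl[OF CA] by blast
      show "(\<zero>\<^bsub>W\<^esub>, \<zero>\<^bsub>V\<^esub>) \<in> \<Union>C" using A_zero[OF CA] ne by blast
      show "(c \<odot>\<^bsub>W\<^esub> w, c \<odot>\<^bsub>V\<^esub> v) \<in> \<Union>C" if "c \<in> carrier K" "(w, v) \<in> \<Union>C" for c w v
        using A_smult[OF CA that(1)] that(2) by blast
      show "v = \<zero>\<^bsub>V\<^esub>" if "(\<zero>\<^bsub>W\<^esub>, v) \<in> \<Union>C" for v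
        using A_fun[OF CA] that by blast
      show "f v = w" if "(w, v) \<in> \<Union>C" "w \<in> I" for w v
        using A_sec[OF CA] that by blast
    qed
  qed
  ultimately obtain G where GA: "G \<in> A" and max: "\<And>X. X \<in> A \<Longrightarrow> G \<subseteq> X \<Longrightarrow> X = G"
    using subset_Zorn_nonempty[of A] by metis
  have G_cl: "w \<in> carrier W" "v \<in> carrier V" if "(w, v) \<in> G" for w v
    using A_cl[OF GA] that by blast+
  note G_zero = A_zero[OF GA] and G_add = A_add[OF GA] and G_smult = A_smult[OF GA]
    and G_fun = A_fun[OF GA] and G_sec = A_sec[OF GA]
  have dom: "\<exists>v. (w, v) \<in> G" if w: "w \<in> carrier W" for w
  proof (rule ccontr)
    assume nd: "\<nexists>v. (w, v) \<in> G"
    \<comment> \<open>Adding an element d of the domain keeps w outside of the domain, since d could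
      be subtracted again.\<close>
    have nd': "(w \<oplus>\<^bsub>W\<^esub> d, v) \<notin> G" if "(d, u) \<in> G" for d u v
    proof
      assume "(w \<oplus>\<^bsub>W\<^esub> d, v) \<in> G"
      then have "((w \<oplus>\<^bsub>W\<^esub> d) \<oplus>\<^bsub>W\<^esub> (\<ominus>\<^bsub>K\<^esub> \<one>\<^bsub>K\<^esub>) \<odot>\<^bsub>W\<^esub> d, v \<oplus>\<^bsub>V\<^esub> (\<ominus>\<^bsub>K\<^esub> \<one>\<^bsub>K\<^esub>) \<odot>\<^bsub>V\<^esub> u) \<in> G"
        using that by (intro G_add G_smult) auto
      moreover have "(w \<oplus>\<^bsub>W\<^esub> d) \<oplus>\<^bsub>W\<^esub> (\<ominus>\<^bsub>K\<^esub> \<one>\<^bsub>K\<^esub>) \<odot>\<^bsub>W\<^esub> d = w"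
        using w G_cl[OF that] by (simp add: W.smult_l_minus W.add.m_assoc W.r_neg)
      ultimately show False using nd by auto
    qed
    \<comment> \<open>The vector to adjoin and its value. If the coset of w modulo the domain meets
      I, then w1 is taken in I and v1 as a preimage under f; otherwise the section condition does
      not constrain the value and v1 = 0 will do.\<close>
    obtain w1 v1 where w1: "w1 \<in> carrier W" "v1 \<in> carrier V"
      and nd1: "\<And>v. (w1, v) \<notin> G"
      and sec1: "f v1 = w1 \<or> (\<forall>d u. (d, u) \<in> G \<longrightarrow> w1 \<oplus>\<^bsub>W\<^esub> d \<notin> I)"
    proof (cases "\<exists>d u. (d, u) \<in> G \<and> w \<oplus>\<^bsub>W\<^esub> d \<in> I")
      case True
      then obtain d u v1 where du: "(d, u) \<in> G" "f v1 = w \<oplus>\<^bsub>W\<^esub> d" "v1 \<in> carrier V"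
        unfolding I_def by force
      show ?thesis
        using du w G_cl[OF du(1)] nd'[OF du(1)] by (intro that[of "w \<oplus>\<^bsub>W\<^esub> d" v1]) auto
    next
      case False
      then show ?thesis using that[of w "\<zero>\<^bsub>V\<^esub>"] nd w by auto
    qed
    define G' where "G' = {(d \<oplus>\<^bsub>W\<^esub> c \<odot>\<^bsub>W\<^esub> w1, u \<oplus>\<^bsub>V\<^esub> c \<odot>\<^bsub>V\<^esub> v1) | d u c. (d, u) \<in> G \<and> c \<in> carrier K}"
    have G'I: "(x, y) \<in> G'"
      if "(d, u) \<in> G" "c \<in> carrier K" "x = d \<oplus>\<^bsub>W\<^esub> c \<odot>\<^bsub>W\<^esub> w1" "y = u \<oplus>\<^bsub>V\<^esub> c \<odot>\<^bsub>V\<^esub> v1" for x y d u c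
      using that by (auto simp: G'_def)
    \<comment> \<open>A vector of the new domain with coefficient c \<noteq> 0 at w1 is scaled to
      coefficient 1, which is where nonzero scalars must be invertible. This serves both to show
      that c = 0 over the zero vector and to place some w1 + d' in I.\<close>
    have key: "\<exists>d' u'. (d', u') \<in> G \<and> w1 \<oplus>\<^bsub>W\<^esub> d' = inv\<^bsub>K\<^esub> c \<odot>\<^bsub>W\<^esub> (d \<oplus>\<^bsub>W\<^esub> c \<odot>\<^bsub>W\<^esub> w1)"
      if "(d, u) \<in> G" "c \<in> carrier K" "c \<noteq> \<zero>\<^bsub>K\<^esub>" for d u c
    proof -
      have c: "inv\<^bsub>K\<^esub> c \<in> carrier K" "inv\<^bsub>K\<^esub> c \<otimes>\<^bsub>K\<^esub> c = \<one>\<^bsub>K\<^esub>"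
        using that K.field_Units by auto
      have "inv\<^bsub>K\<^esub> c \<odot>\<^bsub>W\<^esub> (c \<odot>\<^bsub>W\<^esub> w1) = w1"
        using c that w1 by (simp flip: W.smult_assoc1)
      then have "w1 \<oplus>\<^bsub>W\<^esub> inv\<^bsub>K\<^esub> c \<odot>\<^bsub>W\<^esub> d = inv\<^bsub>K\<^esub> c \<odot>\<^bsub>W\<^esub> (d \<oplus>\<^bsub>W\<^esub> c \<odot>\<^bsub>W\<^esub> w1)"
        using c that w1 G_cl[OF that(1)] by (simp add: W.smult_r_distr W.add.m_comm)
      then show ?thesis using G_smult[OF c(1) that(1)] by blast
    qed
    have c0: "c = \<zero>\<^bsub>K\<^esub>" if du: "(d, u) \<in> G" "c \<in> carrier K" "d \<oplus>\<^bsub>W\<^esub> c \<odot>\<^bsub>W\<^esub> w1 = \<zero>\<^bsub>W\<^esub>" for d u c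
    proof (rule ccontr)
      assume c: "c \<noteq> \<zero>\<^bsub>K\<^esub>"
      have ci: "inv\<^bsub>K\<^esub> c \<in> carrier K" using du c K.field_Units by auto
      obtain d' u' where d': "(d', u') \<in> G" "w1 \<oplus>\<^bsub>W\<^esub> d' = \<zero>\<^bsub>W\<^esub>"
        using key[OF du(1,2) c] ci by (auto simp: du(3))
      have "w1 = (\<ominus>\<^bsub>K\<^esub> \<one>\<^bsub>K\<^esub>) \<odot>\<^bsub>W\<^esub> d'"
        using d' w1 G_cl[OF d'(1)] by (simp add: W.smult_l_minus W.minus_equality)
      then show False using nd1 G_smult[OF _ d'(1), of "\<ominus>\<^bsub>K\<^esub> \<one>\<^bsub>K\<^esub>"] by auto
    qed
    have "G' \<in> A"
    proof (rule A_I)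
      show "G' \<subseteq> carrier W \<times> carrier V" using G_cl w1 by (auto simp: G'_def)
      show "(\<zero>\<^bsub>W\<^esub>, \<zero>\<^bsub>V\<^esub>) \<in> G'" using w1 by (intro G'I[OF G_zero K.zero_closed]) auto
    next
      fix x y x' y' assume "(x, y) \<in> G'" "(x', y') \<in> G'"
      then obtain d u c d' u' c' where *: "(d, u) \<in> G" "c \<in> carrier K" "(d', u') \<in> G" "c' \<in> carrier K"
        "x = d \<oplus>\<^bsub>W\<^esub> c \<odot>\<^bsub>W\<^esub> w1" "y = u \<oplus>\<^bsub>V\<^esub> c \<odot>\<^bsub>V\<^esub> v1"
        "x' = d' \<oplus>\<^bsub>W\<^esub> c' \<odot>\<^bsub>W\<^esub> w1" "y' = u' \<oplus>\<^bsub>V\<^esub> c' \<odot>\<^bsub>V\<^esub> v1"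
        by (auto simp: G'_def)
      show "(x \<oplus>\<^bsub>W\<^esub> x', y \<oplus>\<^bsub>V\<^esub> y') \<in> G'"
        using * w1 G_cl[OF *(1)] G_cl[OF *(3)]
        by (intro G'I[OF G_add[OF *(1,3)], of "c \<oplus>\<^bsub>K\<^esub> c'"])
          (auto simp: W.smult_l_distr V.smult_l_distr W.add.m_ac V.add.m_ac)
    next
      fix a x y assume a: "a \<in> carrier K" and "(x, y) \<in> G'"
      then obtain d u c where *: "(d, u) \<in> G" "c \<in> carrier K"
        "x = d \<oplus>\<^bsub>W\<^esub> c \<odot>\<^bsub>W\<^esub> w1" "y = u \<oplus>\<^bsub>V\<^esub> c \<odot>\<^bsub>V\<^esub> v1"
        by (auto simp: G'_def)
      show "(a \<odot>\<^bsub>W\<^esub> x, a \<odot>\<^bsub>V\<^esub> y) \<in> G'"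
        using * w1 a G_cl[OF *(1)]
        by (intro G'I[OF G_smult[OF a *(1)], of "a \<otimes>\<^bsub>K\<^esub> c"])
          (auto simp: W.smult_r_distr V.smult_r_distr W.smult_assoc1 V.smult_assoc1)
    next
      fix v assume "(\<zero>\<^bsub>W\<^esub>, v) \<in> G'"
      then obtain d u c where *: "(d, u) \<in> G" "c \<in> carrier K"
        "\<zero>\<^bsub>W\<^esub> = d \<oplus>\<^bsub>W\<^esub> c \<odot>\<^bsub>W\<^esub> w1" "v = u \<oplus>\<^bsub>V\<^esub> c \<odot>\<^bsub>V\<^esub> v1"
        by (auto simp: G'_def)
      then have "c = \<zero>\<^bsub>K\<^esub>" using c0 by metis
      then show "v = \<zero>\<^bsub>V\<^esub>" using * w1 G_cl[OF *(1)] G_fun by auto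
    next
      fix x v assume "(x, v) \<in> G'" and xI: "x \<in> I"
      then obtain d u c where *: "(d, u) \<in> G" "c \<in> carrier K"
        "x = d \<oplus>\<^bsub>W\<^esub> c \<odot>\<^bsub>W\<^esub> w1" "v = u \<oplus>\<^bsub>V\<^esub> c \<odot>\<^bsub>V\<^esub> v1"
        by (auto simp: G'_def)
      note cl = G_cl[OF *(1)] w1 *(2)
      show "f v = x"
      proof (cases "c = \<zero>\<^bsub>K\<^esub>")
        case True
        then show ?thesis using * cl G_sec[OF *(1)] xI by auto
      next
        case False
        obtain d' u' where d': "(d', u') \<in> G" "w1 \<oplus>\<^bsub>W\<^esub> d' = inv\<^bsub>K\<^esub> c \<odot>\<^bsub>W\<^esub> x"
          using key[OF *(1,2) False] *(3) by auto
        have "inv\<^bsub>K\<^esub> c \<in> carrier K" using False * K.field_Units by auto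
        \<comment> \<open>As x is in I, its multiple w1 + d' is in I, which excludes the second
          alternative for v1. Then d = x - c w1 lies in I as well, where G is already a
          section.\<close>
        then have "f v1 = w1" using sec1 d' I_smult[OF xI] by auto
        then have cw: "c \<odot>\<^bsub>W\<^esub> w1 = f (c \<odot>\<^bsub>V\<^esub> v1)" using cl f_smult by simp
        have "d = x \<oplus>\<^bsub>W\<^esub> (\<ominus>\<^bsub>K\<^esub> \<one>\<^bsub>K\<^esub>) \<odot>\<^bsub>W\<^esub> (c \<odot>\<^bsub>W\<^esub> w1)"
          using cl by (simp add: *(3) W.smult_l_minus W.add.m_assoc W.r_neg)
        moreover have "(\<ominus>\<^bsub>K\<^esub> \<one>\<^bsub>K\<^esub>) \<odot>\<^bsub>W\<^esub> (c \<odot>\<^bsub>W\<^esub> w1) \<in> I"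
          using cl unfolding cw by (intro I_smult[where x = "f _"]) (auto simp: I_def)
        ultimately have "d \<in> I" using I_add[OF xI] by simp
        then show ?thesis using G_sec[OF *(1)] * cl cw f_add by simp
      qed
    qed
    moreover have "G \<subseteq> G'"
    proof safe
      fix x y assume xy: "(x, y) \<in> G"
      show "(x, y) \<in> G'" using w1 G_cl[OF xy] by (intro G'I[OF xy K.zero_closed]) auto
    qed
    ultimately have "G' = G" by (rule max)
    moreover have "(w1, v1) \<in> G'" using w1 by (intro G'I[OF G_zero K.one_closed]) auto
    ultimately show False using nd1 by simp
  qed
  have uniq: "v = v'" if "(w, v) \<in> G" "(w, v') \<in> G" for w v v'
  proof -
    note cl = G_cl[OF that(1)] G_cl[OF that(2)]
    have "(w \<oplus>\<^bsub>W\<^esub> (\<ominus>\<^bsub>K\<^esub> \<one>\<^bsub>K\<^esub>) \<odot>\<^bsub>W\<^esub> w, v \<oplus>\<^bsub>V\<^esub> (\<ominus>\<^bsub>K\<^esub> \<one>\<^bsub>K\<^esub>) \<odot>\<^bsub>V\<^esub> v') \<in> G"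
      using that by (intro G_add G_smult) auto
    then have "v \<oplus>\<^bsub>V\<^esub> \<ominus>\<^bsub>V\<^esub> v' = \<zero>\<^bsub>V\<^esub>"
      using G_fun cl by (simp add: W.smult_l_minus V.smult_l_minus W.r_neg)
    then show ?thesis using cl V.add.inv_equality V.minus_minus by fastforce
  qed
  define g where "g w = (THE v. (w, v) \<in> G)" for w
  have gI: "g w = v" if "(w, v) \<in> G" for w v
    unfolding g_def using that uniq by blast
  have gG: "(w, g w) \<in> G" if "w \<in> carrier W" for w
    using dom[OF that] gI by auto
  have "linear_map K W V g"
    using gG G_cl(2)[OF gG] by (intro linear_mapI) (auto intro!: gI G_add G_smult)
  moreover have "f (g (f x)) = f x" if "x \<in> carrier V" for x
    using that G_sec[OF gG] f_cl by (auto simp: I_def)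
  ultimately show ?thesis by blast
qed

text \<open>In f (g (f x)) = f x, injectivity cancels the outer f.\<close>

lemma linear_left_inverse:
  assumes "field K" "module K V" "module K W" "linear_map K V W f" "inj_on f (carrier V)"
  shows "\<exists>g. linear_map K W V g \<and> (\<forall>x \<in> carrier V. g (f x) = x)"
proof -
  obtain g where g: "linear_map K W V g" "\<forall>x \<in> carrier V. f (g (f x)) = f x"
    using linear_generalized_inverse[OF assms(1-4)] by blast
  have "g (f x) = x" if "x \<in> carrier V" for x
    using inj_onD[OF assms(5)] g(2) that linear_mapD(1)[OF g(1)] linear_mapD(1)[OF assms(4)] by blast
  with g show ?thesis by blast
qed

section \<open>Sweedler sums\<close>

text \<open>In contrast to \<^const>\<open>tsum\<close>, the spaces of the summands are arguments.  They can be read off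
  by the simplifier, and the congruence rule can assume membership in them.\<close>

definition ssum ::
  "('k,'a univ,'s) module_scheme \<Rightarrow> ('k,'a univ,'t) module_scheme \<Rightarrow> ('k,'u,'q) module_scheme
     \<Rightarrow> ('a univ \<Rightarrow> 'a univ \<Rightarrow> 'u) \<Rightarrow> 'a univ \<Rightarrow> 'u"
where
  "ssum V W U F t = lsum U F (filter (\<lambda>(v, w). v \<in> carrier V \<and> w \<in> carrier W) (summands t))"

lemma ssum_cong [cong]:
  "V = V' \<Longrightarrow> W = W' \<Longrightarrow> U = U' \<Longrightarrow> t = t'
    \<Longrightarrow> (\<And>v w. v \<in> carrier V' \<Longrightarrow> w \<in> carrier W' \<Longrightarrow> F v w = G v w)
    \<Longrightarrow> ssum V W U F t = ssum V' W' U' G t'"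
  unfolding ssum_def by (auto intro!: lsum_cong)

lemma ssum_closed:
  assumes "module K U" "\<And>v w. v \<in> carrier V \<Longrightarrow> w \<in> carrier W \<Longrightarrow> F v w \<in> carrier U"
  shows "ssum V W U F t \<in> carrier U"
  unfolding ssum_def using assms by (intro lsum_closed[OF assms(1)]) auto

lemma ssum_linear:
  assumes "module K U" "module K U'" "linear_map K U U' g"
    and "\<And>v w. v \<in> carrier V \<Longrightarrow> w \<in> carrier W \<Longrightarrow> F v w \<in> carrier U"
  shows "g (ssum V W U F t) = ssum V W U' (\<lambda>v w. g (F v w)) t"
  unfolding ssum_def using assms by (intro lsum_linear[OF assms(1-3)]) auto

lemma ssum_swap:
  assumes "module K U"
    and "\<And>v w a b. v \<in> carrier V \<Longrightarrow> w \<in> carrier W \<Longrightarrow> a \<in> carrier X \<Longrightarrow> b \<in> carrier Y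
      \<Longrightarrow> F v w a b \<in> carrier U"
  shows "ssum V W U (\<lambda>v w. ssum X Y U (\<lambda>a b. F v w a b) s) t
    = ssum X Y U (\<lambda>a b. ssum V W U (\<lambda>v w. F v w a b) t) s"
  unfolding ssum_def using assms by (intro lsum_swap[OF assms(1)]) auto

lemma ssum_add:
  assumes "module K U" "\<And>v w. v \<in> carrier V \<Longrightarrow> w \<in> carrier W \<Longrightarrow> F v w \<in> carrier U"
    and "\<And>v w. v \<in> carrier V \<Longrightarrow> w \<in> carrier W \<Longrightarrow> G v w \<in> carrier U"
  shows "ssum V W U (\<lambda>v w. F v w \<oplus>\<^bsub>U\<^esub> G v w) t = ssum V W U F t \<oplus>\<^bsub>U\<^esub> ssum V W U G t"
  unfolding ssum_def using assms by (intro lsum_add[OF assms(1)]) auto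

lemma linear_map_ssum:
  assumes "module K U"
    and "\<And>v w. v \<in> carrier V \<Longrightarrow> w \<in> carrier W \<Longrightarrow> linear_map K X U (\<lambda>x. F x v w)"
  shows "linear_map K X U (\<lambda>x. ssum V W U (F x) t)"
  unfolding ssum_def using assms by (intro linear_map_lsum[OF assms(1)]) auto

context
  fixes K :: "('k,'r) ring_scheme" and V :: "('k,'a univ,'s) module_scheme"
    and W :: "('k,'a univ,'t) module_scheme"
  assumes V: "module K V" and W: "module K W"
begin

text \<open>The filter in \<open>ssum\<close> removes nothing here, because the representative of a
  tensor only contains admissible pairs.\<close>

lemma ssum_eq_lsum: "t \<in> carrier (tensor K V W) \<Longrightarrow> ssum V W U F t = lsum U F (summands t)"
  unfolding ssum_def using tensor_carrierE(1)[OF V W, of t]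
  by (subst filter_True) auto

lemma tsum_eq_ssum: "t \<in> carrier (tensor K V W) \<Longrightarrow> tsum U F t = ssum V W U F t"
  using ssum_eq_lsum[of t U F] by (simp add: tsum_def lsum_def)

text \<open>Closing rule of many computations: once all maps have been pushed into the summand and
  have cancelled, the bare sum of pure tensors gives the tensor back.\<close>

lemma ssum_tens_ident: "t \<in> carrier (tensor K V W) \<Longrightarrow> ssum V W (tensor K V W) (tens K V W) t = t"
  using tensor_carrierE[OF V W, of t] by (simp add: ssum_eq_lsum lsum_tens[OF V W])

lemma ssum_tens:
  assumes "module K U" "bilinear_map K V W U F" "v \<in> carrier V" "w \<in> carrier W"
  shows "ssum V W U F (tens K V W v w) = F v w"
proof -
  interpret U: module K U by fact
  have "ssum V W U F (tens K V W v w) = lsum U F [(v, w)]"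
    using assms
    by (simp add: ssum_eq_lsum tens_closed[OF V W])
      (simp add: tens_def lsum_summands_class[OF V W assms(1,2)])
  then show ?thesis using bilinear_map_closed[OF assms(2-4)] by simp
qed

text \<open>The other half of the universal property. Scalars act on the left entries of a formal
  sum, so homogeneity comes from linearity of F in its first argument.\<close>

lemma linear_map_ssum_bilinear:
  assumes U: "module K U" and F: "bilinear_map K V W U F"
  shows "linear_map K (tensor K V W) U (ssum V W U F)"
proof -
  interpret V: module K V by (rule V)
  interpret U: module K U by fact
  have cl: "F v w \<in> carrier U" if "v \<in> carrier V" "w \<in> carrier W" for v w
    using bilinear_map_closed[OF F that] .
  note T = module_tensor[OF V W]
  have ev: "ssum V W U F (tensor_class K V W xs) = lsum U F xs" if "set xs \<subseteq> carrier V \<times> carrier W" for xs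
    using that
    by (simp add: ssum_eq_lsum tensor_class_closed[OF V W] lsum_summands_class[OF V W U F])
  show ?thesis
  proof (rule linear_mapI)
    fix x y assume "x \<in> carrier (tensor K V W)" "y \<in> carrier (tensor K V W)"
    then obtain xs ys where s: "set xs \<subseteq> carrier V \<times> carrier W" "x = tensor_class K V W xs"
      "set ys \<subseteq> carrier V \<times> carrier W" "y = tensor_class K V W ys"
      using tensor_carrier_iff[OF V W] by metis
    show "ssum V W U F (x \<oplus>\<^bsub>tensor K V W\<^esub> y) = ssum V W U F x \<oplus>\<^bsub>U\<^esub> ssum V W U F y"
      using s cl by (simp add: tensor_add_class[OF V W] ev) (rule lsum_append[OF U]; auto)
  next
    fix c x assume c: "c \<in> carrier K" and "x \<in> carrier (tensor K V W)"
    then obtain xs where s: "set xs \<subseteq> carrier V \<times> carrier W" "x = tensor_class K V W xs"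
      using tensor_carrier_iff[OF V W] by metis
    have m: "set (map (\<lambda>(v, w). (c \<odot>\<^bsub>V\<^esub> v, w)) xs) \<subseteq> carrier V \<times> carrier W"
      using s c by auto
    have "lsum U F (map (\<lambda>(v, w). (c \<odot>\<^bsub>V\<^esub> v, w)) xs) = c \<odot>\<^bsub>U\<^esub> lsum U F xs"
      using s(1)
    proof (induction xs)
      case (Cons a xs)
      obtain v w where a: "a = (v, w)" by (cases a)
      have "lsum U F xs \<in> carrier U" using Cons.prems cl by (intro lsum_closed[OF U]) auto
      then show ?case
        using Cons c cl linear_mapD(3)[OF bilinear_mapD(2)[OF F]] by (simp add: a U.smult_r_distr)
    qed (use c in simp)
    then show "ssum V W U F (c \<odot>\<^bsub>tensor K V W\<^esub> x) = c \<odot>\<^bsub>U\<^esub> ssum V W U F x"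
      using s c ev[OF m] by (simp add: tensor_smult_class[OF V W] ev)
  next
    show "ssum V W U F x \<in> carrier U" for x
      using cl by (intro ssum_closed[OF U])
  qed
qed

end

declare linear_map_ident [simp] module_tensor [simp] tens_closed [simp]

lemma ssum_closed_tensor [simp]:
  assumes "module K X" "module K Y"
    and "\<And>v w. v \<in> carrier V \<Longrightarrow> w \<in> carrier W \<Longrightarrow> F v w \<in> carrier (tensor K X Y)"
  shows "ssum V W (tensor K X Y) F t \<in> carrier (tensor K X Y)"
  using module_tensor[OF assms(1,2)] assms(3) by (rule ssum_closed)

text \<open>A parameter can enter a Sweedler sum through the summand or through the tensor that is
  decomposed. This rule and the next one treat the two cases; together they let the simplifier prove
  linearity of nested sums.\<close>

lemma linear_map_ssum_left [simp]:
  assumes "module K U"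
    and "\<And>v w. v \<in> carrier V \<Longrightarrow> w \<in> carrier W \<Longrightarrow> linear_map K X U (\<lambda>x. F x v w)"
  shows "linear_map K X U (\<lambda>x. ssum V W U (\<lambda>v w. F x v w) t)"
  using assms by (rule linear_map_ssum)

lemma linear_map_ssum_right [simp]:
  assumes "module K V" "module K W" "module K U" "linear_map K X (tensor K V W) e"
    and "\<And>v. v \<in> carrier V \<Longrightarrow> linear_map K W U (F v)"
    and "\<And>w. w \<in> carrier W \<Longrightarrow> linear_map K V U (\<lambda>v. F v w)"
  shows "linear_map K X U (\<lambda>x. ssum V W U F (e x))"
  using linear_map_compose[OF linear_map_ssum_bilinear assms(4), of U F] assms
  by (simp add: bilinear_map_def)

lemma linear_map_tens [simp]:
  assumes "module K V" "module K W"
  shows "linear_map K X W e \<Longrightarrow> v \<in> carrier V \<Longrightarrow> linear_map K X (tensor K V W) (\<lambda>x. tens K V W v (e x))"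
    and "linear_map K X V e \<Longrightarrow> w \<in> carrier W \<Longrightarrow> linear_map K X (tensor K V W) (\<lambda>x. tens K V W (e x) w)"
    and "v \<in> carrier V \<Longrightarrow> linear_map K W (tensor K V W) (tens K V W v)"
  using bilinear_mapD[OF bilinear_map_tens[OF assms]] linear_map_compose[where V = W and U = X]
    linear_map_compose[where V = V and U = X]
  by blast+

lemma ssum_tens_eval [simp]:
  assumes "module K V" "module K W" "module K U"
    and "\<And>v. v \<in> carrier V \<Longrightarrow> linear_map K W U (F v)"
    and "\<And>w. w \<in> carrier W \<Longrightarrow> linear_map K V U (\<lambda>v. F v w)"
    and "v \<in> carrier V" "w \<in> carrier W"
  shows "ssum V W U F (tens K V W v w) = F v w"
  using assms by (intro ssum_tens bilinear_mapI)

text \<open>The linear map induced by F is applied termwise. Read as a rewrite rule, it flattens a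
  composite of Sweedler maps into one iterated sum over the original tensors.\<close>

lemma ssum_ssum [simp]:
  assumes "module K V" "module K W" "module K U"
    and "\<And>v. v \<in> carrier V \<Longrightarrow> linear_map K W U (F v)"
    and "\<And>w. w \<in> carrier W \<Longrightarrow> linear_map K V U (\<lambda>v. F v w)"
    and "\<And>a b. a \<in> carrier A \<Longrightarrow> b \<in> carrier B \<Longrightarrow> G a b \<in> carrier (tensor K V W)"
  shows "ssum V W U F (ssum A B (tensor K V W) (\<lambda>a b. G a b) t)
    = ssum A B U (\<lambda>a b. ssum V W U F (G a b)) t"
  using assms by (intro ssum_linear[where K = K and U' = U]) simp_all

lemma tens_ssum [simp]:
  assumes "module K V" "module K W"
  shows "v \<in> carrier V \<Longrightarrow> (\<And>a b. a \<in> carrier A \<Longrightarrow> b \<in> carrier B \<Longrightarrow> G a b \<in> carrier W) \<Longrightarrow>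
      tens K V W v (ssum A B W (\<lambda>a b. G a b) t)
      = ssum A B (tensor K V W) (\<lambda>a b. tens K V W v (G a b)) t"
    and "w \<in> carrier W \<Longrightarrow> (\<And>a b. a \<in> carrier A \<Longrightarrow> b \<in> carrier B \<Longrightarrow> G a b \<in> carrier V) \<Longrightarrow>
      tens K V W (ssum A B V (\<lambda>a b. G a b) t) w
      = ssum A B (tensor K V W) (\<lambda>a b. tens K V W (G a b) w) t"
  using assms by (auto intro!: ssum_linear[where U' = "tensor K V W" and g = "tens K V W v"]
      ssum_linear[where U' = "tensor K V W" and g = "\<lambda>v. tens K V W v w"])

lemma ssum_tens_collapse:
  assumes "module K X" "module K Y" "module K V" "t \<in> carrier (tensor K X Y)" "v \<in> carrier V"
  shows "ssum X Y (tensor K V (tensor K X Y)) (\<lambda>x y. tens K V (tensor K X Y) v (tens K X Y x y)) t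
      = tens K V (tensor K X Y) v t"
    and "ssum X Y (tensor K (tensor K X Y) V) (\<lambda>x y. tens K (tensor K X Y) V (tens K X Y x y) v) t
      = tens K (tensor K X Y) V t v"
  using assms tens_ssum(1)[of K V "tensor K X Y" v X Y "tens K X Y" t]
    tens_ssum(2)[of K "tensor K X Y" V v X Y "tens K X Y" t]
  by (simp_all add: ssum_tens_ident)

text \<open>\<open>tmap\<close> carries its target spaces only. The source spaces do not occur on
  the left, so they have to be supplied when the equation is used for rewriting; the same holds for
  \<open>tcomp_eq_ssum\<close>.\<close>

lemma tmap_eq_ssum:
  assumes "module K V" "module K W" "t \<in> carrier (tensor K V W)"
  shows "tmap K V' W' f g t = ssum V W (tensor K V' W') (\<lambda>v w. tens K V' W' (f v) (g w)) t"
  using assms by (simp add: tmap_def tsum_eq_ssum[of K V W])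

lemma tassoc_eq_ssum [simp]:
  assumes "module K U" "module K V" "module K W" "t \<in> carrier (tensor K (tensor K U V) W)"
  shows "tassoc K U V W t = ssum (tensor K U V) W (tensor K U (tensor K V W))
    (\<lambda>s w. ssum U V (tensor K U (tensor K V W)) (\<lambda>u v. tens K U (tensor K V W) u (tens K V W v w)) s) t"
  using assms
  by (simp add: tassoc_def tsum_eq_ssum[of K "tensor K U V" W] tsum_eq_ssum[of K U V] cong: ssum_cong)

lemma tcomp_eq_ssum:
  assumes "module K A" "module K B" "s \<in> carrier (tensor K A B)"
    and "module K C" "module K D" "t \<in> carrier (tensor K C D)"
  shows "tcomp K V W f g s t = ssum A B (tensor K V W)
    (\<lambda>a b. ssum C D (tensor K V W) (\<lambda>c d. tens K V W (f a c) (g b d)) t) s"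
  using assms by (simp add: tcomp_def tsum_eq_ssum[of K A B] tsum_eq_ssum[of K C D])

text \<open>The four fields through which tensor products, linearity and sums depend on a space.
  \<open>H\<close> and \<open>hopf_unit H\<close>, or \<open>cotensor_space\<close> and
  \<open>cotensor\<close>, are records of different types, so no equation between them can be
  stated.\<close>

definition same_space ::
  "('k,'v,'s) module_scheme \<Rightarrow> ('k,'v,'t) module_scheme \<Rightarrow> bool"
where
  "same_space V V' \<longleftrightarrow> carrier V = carrier V' \<and> zero V = zero V' \<and> add V = add V' \<and> smult V = smult V'"

lemma same_space_refl [simp]: "same_space V V"
  by (simp add: same_space_def)

lemma tensor_eq_same_space:
  assumes "tensor_eq K V W xs ys" "same_space V V'" "same_space W W'"
  shows "tensor_eq K V' W' xs ys"
  using assms(1)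
proof induction
  case (trans xs ys zs)
  then show ?case by (blast intro: tensor_eq.trans)
next
  case (balanced c v w)
  then show ?case
    using tensor_eq.balanced[of c K v V' w W'] assms(2,3) by (simp add: same_space_def)
next
  case (add_left v v' w)
  then show ?case
    using tensor_eq.add_left[of v V' v' w W'] assms(2,3) by (simp add: same_space_def)
next
  case (add_right v w w')
  then show ?case
    using tensor_eq.add_right[of v V' w W' w'] assms(2,3) by (simp add: same_space_def)
next
  case (zero w)
  then show ?case
    using tensor_eq.zero[of w W' K V'] assms(2,3) by (simp add: same_space_def)
qed (use assms(2,3) in \<open>auto simp: same_space_def intro: tensor_eq.refl tensor_eq.sym
    tensor_eq.append tensor_eq.commute\<close>)

lemma tensor_class_same_space:
  assumes "same_space V V'" "same_space W W'"
  shows "tensor_class K V W = tensor_class K V' W'"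
proof -
  have "same_space V' V" "same_space W' W"
    using assms by (simp_all add: same_space_def)
  then have "tensor_eq K V W = tensor_eq K V' W'"
    using assms by (intro ext iffI) (rule tensor_eq_same_space; assumption)+
  then show ?thesis by (simp add: tensor_class_def fun_eq_iff)
qed

lemma tensor_same_space:
  assumes "same_space V V'" "same_space W W'"
  shows "tensor K V W = tensor K V' W'"
  unfolding tensor_def tensor_class_same_space[OF assms, of K] using assms by (simp add: same_space_def)

lemma tens_same_space:
  assumes "same_space V V'" "same_space W W'"
  shows "tens K V W = tens K V' W'"
  by (simp add: tens_def fun_eq_iff tensor_class_same_space[OF assms])

lemma ssum_same_space:
  assumes "same_space V V'" "same_space W W'" "same_space U U'"
  shows "ssum V W U = ssum V' W' U'"
  using assms by (simp add: ssum_def lsum_def same_space_def fun_eq_iff)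

lemma linear_map_same_space:
  assumes "same_space V V'" "same_space W W'"
  shows "linear_map K V W = linear_map K V' W'"
  using assms by (simp add: linear_map_def same_space_def fun_eq_iff)

lemma module_same_space:
  assumes "module K V" "same_space V V'"
  shows "module K V'"
proof -
  interpret V: module K V by fact
  have *: "carrier V' = carrier V" "zero V' = zero V" "add V' = add V" "smult V' = smult V"
    using assms(2) by (simp_all add: same_space_def)
  show ?thesis
  proof (intro moduleI abelian_groupI)
    show "cring K" by (rule V.R.is_cring)
    show "\<exists>y\<in>carrier V'. y \<oplus>\<^bsub>V'\<^esub> x = \<zero>\<^bsub>V'\<^esub>" if "x \<in> carrier V'" for x
      using that V.l_neg V.a_inv_closed unfolding * by blast
  qed (simp_all add: * V.add.m_ac V.smult_l_distr V.smult_r_distr V.smult_assoc1)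
qed

subsection \<open>Flatness\<close>

text \<open>Injective linear maps over a field have linear left inverses f' and g', and f' \<otimes>
  g' is a left inverse of f \<otimes> g.\<close>

lemma tensor_map_inj:
  assumes "field K" "module K V" "module K W" "module K V'" "module K W'"
    and f: "linear_map K V V' f" "inj_on f (carrier V)"
    and g: "linear_map K W W' g" "inj_on g (carrier W)"
  shows "inj_on (ssum V W (tensor K V' W') (\<lambda>v w. tens K V' W' (f v) (g w))) (carrier (tensor K V W))"
proof -
  obtain f' where f': "linear_map K V' V f'" "\<And>x. x \<in> carrier V \<Longrightarrow> f' (f x) = x"
    using linear_left_inverse[OF assms(1,2,4) f] by blast
  obtain g' where g': "linear_map K W' W g'" "\<And>x. x \<in> carrier W \<Longrightarrow> g' (g x) = x"
    using linear_left_inverse[OF assms(1,3,5) g] by blast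
  note [simp] = assms(2-5) linear_mapD(1)[OF f(1)] linear_mapD(1)[OF g(1)] linear_mapD(1)[OF f'(1)]
    linear_mapD(1)[OF g'(1)] f' g' linear_map_compose[OF f'(1)] linear_map_compose[OF g'(1)]
  have "ssum V' W' (tensor K V W) (\<lambda>v w. tens K V W (f' v) (g' w))
      (ssum V W (tensor K V' W') (\<lambda>v w. tens K V' W' (f v) (g w)) t) = t"
    if "t \<in> carrier (tensor K V W)" for t
    using that by (simp add: ssum_tens_ident)
  then show ?thesis by (rule inj_on_inverseI)
qed

text \<open>\<open>p\<close> is a projection onto the equalizer of \<open>l\<close> and \<open>r\<close>, and \<open>q\<close> carries \<open>l x - r x\<close> to the
  complementary part of \<open>x\<close>.\<close>

lemma equalizer_projection:
  assumes "field K" and V: "module K V" and W: "module K W"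
    and l: "linear_map K V W l" and r: "linear_map K V W r"
  obtains p q where "linear_map K V V p" "linear_map K W V q"
    and "\<And>x. x \<in> carrier V \<Longrightarrow> l (p x) = r (p x)"
    and "\<And>x. x \<in> carrier V \<Longrightarrow> q (l x) \<oplus>\<^bsub>V\<^esub> p x = q (r x) \<oplus>\<^bsub>V\<^esub> x"
proof -
  interpret V: module K V by fact
  interpret W: module K W by fact
  define d where "d x = l x \<ominus>\<^bsub>W\<^esub> r x" for x
  have d: "linear_map K V W d" unfolding d_def by (rule linear_map_diff[OF W l r])
  \<comment> \<open>From d q d = d it follows that q d is idempotent and vanishes exactly on the
    equalizer, the kernel of d. Hence id - q d projects onto the equalizer.\<close>
  obtain q where q: "linear_map K W V q" "\<And>x. x \<in> carrier V \<Longrightarrow> d (q (d x)) = d x"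
    using linear_generalized_inverse[OF assms(1) V W d] by blast
  define p where "p x = x \<ominus>\<^bsub>V\<^esub> q (d x)" for x
  have p: "linear_map K V V p"
    unfolding p_def by (intro linear_map_diff[OF V] linear_map_ident linear_map_compose[OF q(1) d])
  note cl = linear_mapD(1)[OF l] linear_mapD(1)[OF r] linear_mapD(1)[OF d] linear_mapD(1)[OF q(1)]
    linear_mapD(1)[OF p]
  show ?thesis
  proof (rule that[OF p q(1)])
    fix x assume x: "x \<in> carrier V"
    have "d (p x) = d x \<ominus>\<^bsub>W\<^esub> d (q (d x))"
      unfolding p_def using x cl by (intro linear_map_minus[OF V W d]) auto
    then have "l (p x) \<ominus>\<^bsub>W\<^esub> r (p x) = \<zero>\<^bsub>W\<^esub>"
      using q(2)[OF x] cl x by (simp add: d_def[of "p x"] W.r_neg W.minus_eq)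
    then have "l (p x) \<ominus>\<^bsub>W\<^esub> r (p x) \<oplus>\<^bsub>W\<^esub> r (p x) = r (p x)"
      using cl x by simp
    then show "l (p x) = r (p x)"
      using cl x by (simp add: W.minus_eq W.add.m_assoc W.l_neg)
    have "l x = d x \<oplus>\<^bsub>W\<^esub> r x"
      using x cl by (simp add: d_def W.minus_eq W.add.m_assoc W.l_neg)
    then have "q (l x) = q (d x) \<oplus>\<^bsub>V\<^esub> q (r x)"
      using x cl linear_mapD(2)[OF q(1)] by simp
    moreover have "q (d x) \<oplus>\<^bsub>V\<^esub> p x = x"
      using x cl by (simp add: p_def V.minus_eq V.add.m_lcomm V.r_neg)
    moreover have "q (d x) \<oplus>\<^bsub>V\<^esub> q (r x) \<oplus>\<^bsub>V\<^esub> p x = q (r x) \<oplus>\<^bsub>V\<^esub> (q (d x) \<oplus>\<^bsub>V\<^esub> p x)"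
      using x cl by (simp add: V.add.m_ac)
    ultimately show "q (l x) \<oplus>\<^bsub>V\<^esub> p x = q (r x) \<oplus>\<^bsub>V\<^esub> x"
      by simp
  qed
qed

text \<open>By hypothesis id \<otimes> q l and id \<otimes> q r agree at t. They cancel in the
  identity q l + p = q r + id tensored with V, which leaves (id \<otimes> p) t = t, and p takes
  values in C.\<close>

lemma tensor_equalizer_right:
  assumes K: "field K" and V: "module K V" and W: "module K W" and W': "module K W'" and C: "module K C"
    and l: "linear_map K W W' l" and r: "linear_map K W W' r"
    and C_carrier: "carrier C = {x \<in> carrier W. l x = r x}"
    and C_ops: "add C = add W" "smult C = smult W"
    and t: "t \<in> carrier (tensor K V W)"
    and eq: "ssum V W (tensor K V W') (\<lambda>v w. tens K V W' v (l w)) t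
      = ssum V W (tensor K V W') (\<lambda>v w. tens K V W' v (r w)) t"
  shows "\<exists>s \<in> carrier (tensor K V C). ssum V C (tensor K V W) (tens K V W) s = t"
proof -
  obtain p q where p: "linear_map K W W p" and q: "linear_map K W' W q"
    and lrp: "\<And>x. x \<in> carrier W \<Longrightarrow> l (p x) = r (p x)"
    and pq: "\<And>x. x \<in> carrier W \<Longrightarrow> q (l x) \<oplus>\<^bsub>W\<^esub> p x = q (r x) \<oplus>\<^bsub>W\<^esub> x"
    using equalizer_projection[OF K W W' l r] by blast
  interpret T: module K "tensor K V W" by (rule module_tensor[OF V W])
  have inc: "linear_map K C W (\<lambda>x. x)"
    using C_carrier C_ops by (auto intro!: linear_mapI)
  have pC: "linear_map K W C p"
    using C_carrier C_ops lrp linear_mapD[OF p] by (auto intro!: linear_mapI)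
  have tens_C: "linear_map K C (tensor K V W) (tens K V W v)" if "v \<in> carrier V" for v
    using linear_map_compose[OF linear_map_tens(3)[OF V W that] inc] .
  note [simp] = V W W' C linear_mapD(1)[OF l] linear_mapD(1)[OF r] linear_mapD(1)[OF p]
    linear_mapD(1)[OF q] linear_mapD(1)[OF pC] linear_mapD(1)[OF inc] tens_C
    linear_map_compose[OF q] linear_map_compose[OF pC] linear_map_compose[OF inc] t
  let ?s = "\<lambda>f. ssum V W (tensor K V W) (\<lambda>v w. tens K V W v (f w)) t"
  have add: "?s (\<lambda>w. f w \<oplus>\<^bsub>W\<^esub> g w) = ?s f \<oplus>\<^bsub>tensor K V W\<^esub> ?s g"
    if "linear_map K W W f" "linear_map K W W g" for f g
    using linear_mapD(1)[OF that(1)] linear_mapD(1)[OF that(2)]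
    by (simp add: linear_mapD(2)[OF linear_map_tens(3)[OF V W]] ssum_add[where K = K])
  have "?s (\<lambda>w. q (l w)) = ssum V W' (tensor K V W) (\<lambda>v w. tens K V W v (q w))
      (ssum V W (tensor K V W') (\<lambda>v w. tens K V W' v (l w)) t)"
    by simp
  also have "\<dots> = ?s (\<lambda>w. q (r w))"
    unfolding eq by simp
  finally have qeq: "?s (\<lambda>w. q (l w)) = ?s (\<lambda>w. q (r w))" .
  have "?s (\<lambda>w. q (l w)) \<oplus>\<^bsub>tensor K V W\<^esub> ?s p = ?s (\<lambda>w. q (l w) \<oplus>\<^bsub>W\<^esub> p w)"
    by (rule add[symmetric]) (use l p in simp_all)
  also have "\<dots> = ?s (\<lambda>w. q (r w) \<oplus>\<^bsub>W\<^esub> w)"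
    by (simp add: pq)
  also have "\<dots> = ?s (\<lambda>w. q (r w)) \<oplus>\<^bsub>tensor K V W\<^esub> ?s (\<lambda>w. w)"
    by (rule add) (use r in simp_all)
  finally have "?s p = ?s (\<lambda>w. w)"
    using q r by (simp add: qeq)
  then have "?s p = t"
    by (simp add: ssum_tens_ident)
  then show ?thesis
    by (intro bexI[of _ "ssum V W (tensor K V C) (\<lambda>v w. tens K V C v (p w)) t"]) simp_all
qed

text \<open>Reduced to the other side by the symmetry w \<otimes> v \<mapsto> v \<otimes> w, written
  as a Sweedler sum.\<close>

lemma tensor_equalizer_left:
  assumes K: "field K" and V: "module K V" and W: "module K W" and W': "module K W'" and C: "module K C"
    and l: "linear_map K W W' l" and r: "linear_map K W W' r"
    and C_carrier: "carrier C = {x \<in> carrier W. l x = r x}"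
    and C_ops: "add C = add W" "smult C = smult W"
    and t: "t \<in> carrier (tensor K W V)"
    and eq: "ssum W V (tensor K W' V) (\<lambda>w v. tens K W' V (l w) v) t
      = ssum W V (tensor K W' V) (\<lambda>w v. tens K W' V (r w) v) t"
  shows "\<exists>s \<in> carrier (tensor K C V). ssum C V (tensor K W V) (tens K W V) s = t"
proof -
  have flip: "ssum V W (tensor K W V) (\<lambda>v w. tens K W V w v)
      (ssum W V (tensor K V W) (\<lambda>w v. tens K V W v w) t) = t"
    using t V W by (simp add: ssum_tens_ident)
  let ?t = "ssum W V (tensor K V W) (\<lambda>w v. tens K V W v w) t"
  have inc: "linear_map K C W (\<lambda>x. x)"
    using C_carrier C_ops by (auto intro!: linear_mapI)
  have tens_C: "linear_map K C (tensor K V W) (tens K V W v)" "linear_map K C (tensor K W V) (\<lambda>w. tens K W V w v)"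
    if "v \<in> carrier V" for v
    using linear_map_compose[OF linear_map_tens(3)[OF V W that] inc]
      linear_map_compose[OF linear_map_tens(2)[OF W V linear_map_ident that] inc] .
  note [simp] = V W W' C linear_mapD(1)[OF l] linear_mapD(1)[OF r] linear_mapD(1)[OF inc] tens_C
    linear_map_compose[OF l] linear_map_compose[OF r]  t l r
  have "ssum V W (tensor K V W') (\<lambda>v w. tens K V W' v (l w)) ?t
    = ssum W' V (tensor K V W') (\<lambda>w v. tens K V W' v w)
      (ssum W V (tensor K W' V) (\<lambda>w v. tens K W' V (l w) v) t)"
    by simp
  also have "\<dots> = ssum V W (tensor K V W') (\<lambda>v w. tens K V W' v (r w)) ?t"
    unfolding eq by simp
  finally obtain s where s: "s \<in> carrier (tensor K V C)" "ssum V C (tensor K V W) (tens K V W) s = ?t"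
    using tensor_equalizer_right[OF K V W W' C l r C_carrier C_ops, of ?t] by auto
  have "ssum C V (tensor K W V) (tens K W V) (ssum V C (tensor K C V) (\<lambda>v w. tens K C V w v) s)
    = ssum V W (tensor K W V) (\<lambda>v w. tens K W V w v) (ssum V C (tensor K V W) (tens K V W) s)"
    by simp
  then show ?thesis
    using s flip by (intro bexI[of _ "ssum V C (tensor K C V) (\<lambda>v w. tens K C V w v) s"]) simp_all
qed

declare bilinear_mapI [simp]

section \<open>Multilinear maps as premises of rewrite rules\<close>

definition trilinear_map ::
  "('k,'r) ring_scheme \<Rightarrow> ('k,'u,'s) module_scheme \<Rightarrow> ('k,'v,'t) module_scheme
     \<Rightarrow> ('k,'w,'q) module_scheme \<Rightarrow> ('k,'x,'p) module_scheme \<Rightarrow> ('u \<Rightarrow> 'v \<Rightarrow> 'w \<Rightarrow> 'x) \<Rightarrow> bool"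
where
  "trilinear_map K U V W X f \<longleftrightarrow>
     (\<forall>u \<in> carrier U. \<forall>v \<in> carrier V. linear_map K W X (f u v)) \<and>
     (\<forall>u \<in> carrier U. \<forall>w \<in> carrier W. linear_map K V X (\<lambda>v. f u v w)) \<and>
     (\<forall>v \<in> carrier V. \<forall>w \<in> carrier W. linear_map K U X (\<lambda>u. f u v w))"

lemma trilinear_mapI [simp]:
  assumes "\<And>u v. u \<in> carrier U \<Longrightarrow> v \<in> carrier V \<Longrightarrow> linear_map K W X (f u v)"
    and "\<And>u w. u \<in> carrier U \<Longrightarrow> w \<in> carrier W \<Longrightarrow> linear_map K V X (\<lambda>v. f u v w)"
    and "\<And>v w. v \<in> carrier V \<Longrightarrow> w \<in> carrier W \<Longrightarrow> linear_map K U X (\<lambda>u. f u v w)"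
  shows "trilinear_map K U V W X f"
  using assms by (auto simp: trilinear_map_def)

text \<open>Multilinearity of an abstract F is unpacked into the goals that the simplifier meets
  inside sums, where the varying argument is a linear expression e in a bound variable.\<close>

lemma bilinear_map_lin:
  assumes "bilinear_map K U V X f"
  shows "u \<in> carrier U \<Longrightarrow> linear_map K V X (f u)"
    and "u \<in> carrier U \<Longrightarrow> linear_map K S V e \<Longrightarrow> linear_map K S X (\<lambda>s. f u (e s))"
    and "v \<in> carrier V \<Longrightarrow> linear_map K S U e \<Longrightarrow> linear_map K S X (\<lambda>s. f (e s) v)"
    and "u \<in> carrier U \<Longrightarrow> v \<in> carrier V \<Longrightarrow> f u v \<in> carrier X"
  using assms linear_map_compose[of K V X "f u" S e] linear_map_compose[of K U X "\<lambda>u. f u v" S e]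
    bilinear_map_closed[OF assms]
  by (auto simp: bilinear_map_def)

lemma trilinear_map_lin:
  assumes "trilinear_map K U V W X f"
  shows "u \<in> carrier U \<Longrightarrow> v \<in> carrier V \<Longrightarrow> linear_map K W X (f u v)"
    and "u \<in> carrier U \<Longrightarrow> v \<in> carrier V \<Longrightarrow> linear_map K S W e \<Longrightarrow> linear_map K S X (\<lambda>s. f u v (e s))"
    and "u \<in> carrier U \<Longrightarrow> w \<in> carrier W \<Longrightarrow> linear_map K S V e \<Longrightarrow> linear_map K S X (\<lambda>s. f u (e s) w)"
    and "v \<in> carrier V \<Longrightarrow> w \<in> carrier W \<Longrightarrow> linear_map K S U e \<Longrightarrow> linear_map K S X (\<lambda>s. f (e s) v w)"
    and "u \<in> carrier U \<Longrightarrow> v \<in> carrier V \<Longrightarrow> w \<in> carrier W \<Longrightarrow> f u v w \<in> carrier X"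
  using assms linear_map_compose[of K W X "f u v" S e] linear_map_compose[of K V X "\<lambda>v. f u v w" S e]
    linear_map_compose[of K U X "\<lambda>u. f u v w" S e] linear_mapD(1)[of K W X "f u v" w]
  by (auto simp: trilinear_map_def)

lemma tmap_same_space:
  "same_space V V' \<Longrightarrow> same_space W W' \<Longrightarrow> tmap K V W = tmap K V' W'"
  by (simp add: tmap_def fun_eq_iff tensor_same_space[of V V' W W'] tens_same_space[of V V' W W'])

lemma tassoc_same_space:
  assumes "same_space U U'" "same_space V V'" "same_space W W'"
  shows "tassoc K U V W = tassoc K U' V' W'"
  unfolding tassoc_def tensor_same_space[OF assms(2,3)] tens_same_space[OF assms(2,3)]
    tensor_same_space[OF assms(1) same_space_refl] tens_same_space[OF assms(1) same_space_refl] ..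

lemma tcomp_same_space:
  "same_space V V' \<Longrightarrow> same_space W W' \<Longrightarrow> tcomp K V W = tcomp K V' W'"
  by (simp add: tcomp_def fun_eq_iff tensor_same_space[of V V' W W'] tens_same_space[of V V' W W'])

section \<open>The unit object\<close>

lemma hopf_unit_simps [simp]:
  "carrier (hopf_unit H) = carrier H" "zero (hopf_unit H) = zero H" "add (hopf_unit H) = add H"
  "smult (hopf_unit H) = smult H" "twist (hopf_unit H) = twist H" "lact (hopf_unit H) = mult H"
  "ract (hopf_unit H) = mult H" "lcoact (hopf_unit H) = comult H" "rcoact (hopf_unit H) = comult H"
  by (simp_all add: hopf_unit_def)

lemma same_space_hopf_unit: "same_space (hopf_unit H) H"
  by (simp add: same_space_def)

lemma tsum_same_space: "same_space U U' \<Longrightarrow> tsum U = tsum U'"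
  by (simp add: tsum_def fun_eq_iff same_space_def)

lemma linear_map_hopf_unit [simp]:
  "linear_map K (hopf_unit H) W = linear_map K H W" "linear_map K V (hopf_unit H) = linear_map K V H"
  by (intro linear_map_same_space same_space_hopf_unit same_space_refl)+

text \<open>Turns constructions over \<open>hopf_unit H\<close> into those over \<open>H\<close>, so
  that lemmas about arbitrary objects can be instantiated at the unit.\<close>

lemma hopf_unit_space [simp]:
  "tensor K (hopf_unit H) W = tensor K H W" "tensor K V (hopf_unit H) = tensor K V H"
  "tens K (hopf_unit H) W = tens K H W" "tens K V (hopf_unit H) = tens K V H"
  "ssum (hopf_unit H) W U = ssum H W U" "ssum V (hopf_unit H) U = ssum V H U"
  "ssum V W (hopf_unit H) = ssum V W H"
  "tmap K (hopf_unit H) W = tmap K H W" "tmap K V (hopf_unit H) = tmap K V H"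
  "tassoc K (hopf_unit H) V W = tassoc K H V W" "tassoc K V (hopf_unit H) W = tassoc K V H W"
  "tassoc K V W (hopf_unit H) = tassoc K V W H"
  "tcomp K (hopf_unit H) W = tcomp K H W" "tcomp K V (hopf_unit H) = tcomp K V H"
  "tsum (hopf_unit H) = tsum H"
  "bilinear_map K (hopf_unit H) V W = bilinear_map K H V W"
  "bilinear_map K V (hopf_unit H) W = bilinear_map K V H W"
  "bilinear_map K V W (hopf_unit H) = bilinear_map K V W H"
proof -
  note s = same_space_hopf_unit[of H] same_space_refl
  show "tensor K (hopf_unit H) W = tensor K H W" "tensor K V (hopf_unit H) = tensor K V H"
    by (intro tensor_same_space s)+
  show "tens K (hopf_unit H) W = tens K H W" "tens K V (hopf_unit H) = tens K V H"
    by (intro tens_same_space s)+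
  show "ssum (hopf_unit H) W U = ssum H W U" "ssum V (hopf_unit H) U = ssum V H U"
    "ssum V W (hopf_unit H) = ssum V W H"
    by (intro ssum_same_space s)+
  show "tmap K (hopf_unit H) W = tmap K H W" "tmap K V (hopf_unit H) = tmap K V H"
    by (intro tmap_same_space s)+
  show "tassoc K (hopf_unit H) V W = tassoc K H V W" "tassoc K V (hopf_unit H) W = tassoc K V H W"
    "tassoc K V W (hopf_unit H) = tassoc K V W H"
    by (intro tassoc_same_space s)+
  show "tcomp K (hopf_unit H) W = tcomp K H W" "tcomp K V (hopf_unit H) = tcomp K V H"
    by (intro tcomp_same_space s)+
  show "tsum (hopf_unit H) = tsum H"
    by (intro tsum_same_space s)
  show "bilinear_map K (hopf_unit H) V W = bilinear_map K H V W"
    "bilinear_map K V (hopf_unit H) W = bilinear_map K V H W"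
    "bilinear_map K V W (hopf_unit H) = bilinear_map K V W H"
    by (simp_all add: bilinear_map_def fun_eq_iff)
qed

lemma trilinear_map_hopf_unit [simp]:
  "trilinear_map K (hopf_unit H) V W X = trilinear_map K H V W X"
  "trilinear_map K U (hopf_unit H) W X = trilinear_map K U H W X"
  "trilinear_map K U V (hopf_unit H) X = trilinear_map K U V H X"
  by (simp_all add: trilinear_map_def fun_eq_iff)

section \<open>Equalizers as modules, and the fields of the cotensor product\<close>

lemma module_equalizer:
  assumes V: "module K V" and W: "module K W" and l: "linear_map K V W l" and r: "linear_map K V W r"
    and carrier: "carrier C = {x \<in> carrier V. l x = r x}"
    and ops: "zero C = zero V" "add C = add V" "smult C = smult V"
  shows "module K C"
proof -
  interpret V: module K V by fact
  note l' = linear_mapD[OF l] linear_map_zero[OF V W l] and r' = linear_mapD[OF r] linear_map_zero[OF V W r]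
  show ?thesis
  proof (intro moduleI abelian_groupI)
    show "cring K" by (rule V.R.is_cring)
    show "\<exists>y\<in>carrier C. y \<oplus>\<^bsub>C\<^esub> x = \<zero>\<^bsub>C\<^esub>" if "x \<in> carrier C" for x
    proof
      have x: "x \<in> carrier V" "l x = r x" using that by (simp_all add: carrier)
      then show "(\<ominus>\<^bsub>K\<^esub> \<one>\<^bsub>K\<^esub>) \<odot>\<^bsub>C\<^esub> x \<in> carrier C"
        by (simp add: ops carrier l' r')
      show "(\<ominus>\<^bsub>K\<^esub> \<one>\<^bsub>K\<^esub>) \<odot>\<^bsub>C\<^esub> x \<oplus>\<^bsub>C\<^esub> x = \<zero>\<^bsub>C\<^esub>"
        using x by (simp add: ops V.smult_l_minus V.l_neg)
    qed
  qed (simp_all add: carrier ops l' r' V.add.m_ac V.smult_l_distr V.smult_r_distr V.smult_assoc1)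
qed

lemma cotensor_fields:
  "carrier (cotensor K H M N) = cotensor_set K H M N"
  "zero (cotensor K H M N) = zero (tensor K M N)"
  "add (cotensor K H M N) = add (tensor K M N)"
  "smult (cotensor K H M N) = smult (tensor K M N)"
  by (simp_all add: cotensor_def Let_def cotensor_space_def)

lemma cotensor_structure:
  "twist (cotensor K H M N) = tmap K M N (twist M) (twist N)"
  "lact (cotensor K H M N) h x = tcomp K M N (\<lambda>a. lact M (inv_into (carrier H) (twist H) a))
    (\<lambda>b. lact N (inv_into (carrier H) (twist H) b)) (comult H h) x"
  "ract (cotensor K H M N) x h = tcomp K M N (\<lambda>m a. ract M m (inv_into (carrier H) (twist H) a))
    (\<lambda>n b. ract N n (inv_into (carrier H) (twist H) b)) x (comult H h)"
  by (simp_all add: cotensor_def Let_def)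

lemma same_space_cotensor: "same_space (cotensor_space K H M N) (cotensor K H M N)"
  by (simp add: same_space_def cotensor_def Let_def)

text \<open>The definition takes tensor products with the bare subspace. With the object itself as
  factor, the rules about tensor products of objects apply.\<close>

lemma cotensor_coactions:
  "lcoact (cotensor K H M N) x = (THE y. y \<in> carrier (tensor K H (cotensor K H M N)) \<and>
    tmap K H (tensor K M N) id id y
    = tassoc K H M N (tmap K (tensor K H M) N (lcoact M) (twist N) x))"
  "rcoact (cotensor K H M N) x = (THE y. y \<in> carrier (tensor K (cotensor K H M N) H) \<and>
    tassoc K M N H (tmap K (tensor K M N) H id id y)
    = tmap K M (tensor K N H) (twist M) (rcoact N) x)"
  unfolding tensor_same_space[OF same_space_refl same_space_cotensor, symmetric]
    tensor_same_space[OF same_space_cotensor same_space_refl, symmetric]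
  by (simp_all add: cotensor_def Let_def)

text \<open>A map given by a definite description is known only through its image under an inclusion
  j; an injective linear j reflects linearity.\<close>

lemma linear_map_reflect_inj:
  assumes "module K V" and j: "linear_map K W W' j" "inj_on j (carrier W)" and W: "module K W"
    and f: "\<And>x. x \<in> carrier V \<Longrightarrow> f x \<in> carrier W" and jf: "linear_map K V W' (\<lambda>x. j (f x))"
  shows "linear_map K V W f"
proof -
  interpret V: module K V by fact
  interpret W: module K W by fact
  show ?thesis
  proof (rule linear_mapI)
    show "f (x \<oplus>\<^bsub>V\<^esub> y) = f x \<oplus>\<^bsub>W\<^esub> f y" if "x \<in> carrier V" "y \<in> carrier V" for x y
      using that f linear_mapD(2)[OF j(1)] linear_mapD(2)[OF jf] by (intro inj_onD[OF j(2)]) simp_all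
    show "f (c \<odot>\<^bsub>V\<^esub> x) = c \<odot>\<^bsub>W\<^esub> f x" if "c \<in> carrier K" "x \<in> carrier V" for c x
      using that f linear_mapD(3)[OF j(1)] linear_mapD(3)[OF jf] by (intro inj_onD[OF j(2)]) simp_all
  qed (rule f)
qed

section \<open>Calculus of structure maps under the hypotheses of the theorem\<close>

locale hopf_category = hom_hopf_algebra K H
  for K :: "('k,'r) ring_scheme" and H :: "('k,'a univ) hom_hopf" +
  assumes field_K: "field K"
    and twist_bij: "bij_betw (twist H) (carrier H) (carrier H)"
begin

abbreviation tensor_infix :: "('k,'a univ,'s) module_scheme \<Rightarrow> ('k,'a univ,'t) module_scheme
    \<Rightarrow> ('k,'a univ) module" (infixr "\<boxtimes>" 75) where
  "V \<boxtimes> W \<equiv> tensor K V W"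

abbreviation cotensor_infix :: "('k,'a univ) hopf_module \<Rightarrow> ('k,'a univ) hopf_module
    \<Rightarrow> ('k,'a univ) hopf_module" (infixr "\<box>" 75) where
  "M \<box> N \<equiv> cotensor K H M N"

text \<open>The inclusion \<open>tmap K H (tensor K M N) id id\<close> on H \<otimes> (M \<box> N),
  written with its source spaces so that the rules for sums see that the right component lies in M
  \<box> N.\<close>

abbreviation left_incl :: "('k,'a univ) hopf_module \<Rightarrow> ('k,'a univ) hopf_module \<Rightarrow> 'a univ \<Rightarrow> 'a univ" where
  "left_incl M N \<equiv> ssum H (M \<box> N) (H \<boxtimes> M \<boxtimes> N) (tens K H (M \<boxtimes> N))"

abbreviation right_incl :: "('k,'a univ) hopf_module \<Rightarrow> ('k,'a univ) hopf_module \<Rightarrow> 'a univ \<Rightarrow> 'a univ" where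
  "right_incl M N \<equiv> ssum (M \<box> N) H ((M \<boxtimes> N) \<boxtimes> H) (tens K (M \<boxtimes> N) H)"

abbreviation assoc_incl :: "('k,'a univ) hopf_module \<Rightarrow> ('k,'a univ) hopf_module
    \<Rightarrow> ('k,'a univ) hopf_module \<Rightarrow> 'a univ \<Rightarrow> 'a univ" where
  "assoc_incl M N P \<equiv> ssum M (N \<box> P) (M \<boxtimes> N \<boxtimes> P) (tens K M (N \<boxtimes> P))"

abbreviation Obj :: "('k,'a univ) hopf_module set" where
  "Obj \<equiv> hopf_Obj K H"

lemma module_H [simp]: "module K H"
  by (rule module_axioms)

lemma module_unit [simp]: "module K (hopf_unit H)"
  by (rule module_same_space[OF module_H]) (simp add: same_space_def)

text \<open>The three Hom-associativities of a bimodule are \<open>hom_assoc\<close>, the three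
  coassociativities of a bicomodule are \<open>hom_coassoc\<close>, both up to orientation, and all
  four compatibilities of actions with coactions are \<open>comult_mult\<close>.\<close>

lemma unit_in_Obj [simp]: "hopf_unit H \<in> Obj"
proof -
  have "four_angle_hopf_module K H (hopf_unit H)"
    unfolding four_angle_hopf_module_def four_angle_hopf_module_axioms_def hom_bimodule_def
      hom_bimodule_axioms_def left_hom_module_def left_hom_module_axioms_def right_hom_module_def
      right_hom_module_axioms_def hom_bicomodule_def hom_bicomodule_axioms_def
      left_hom_comodule_def left_hom_comodule_axioms_def right_hom_comodule_def
      right_hom_comodule_axioms_def hopf_unit_simps hopf_unit_space linear_map_hopf_unit
    by (intro conjI allI impI)
      (rule module_unit twist_linear mult_bilinear comult_linear twist_bij hom_coassoc
        hom_coassoc[symmetric] comult_mult twist_mult hom_assoc hom_assoc[symmetric] one_mult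
        mult_one comult_twist counit_left counit_right; assumption)+
  then show ?thesis by (simp add: hopf_Obj_def)
qed

abbreviation untwist :: "('k,'a univ,'m) hom_space_scheme \<Rightarrow> 'a univ \<Rightarrow> 'a univ" where
  "untwist M \<equiv> inv_into (carrier M) (twist M)"

lemma counit_closed [simp]: "h \<in> carrier H \<Longrightarrow> counit H h \<in> carrier K"
  using counit_linear by (auto simp: linear_functional_def)

text \<open>The counit is a functional, not a \<open>linear_map\<close>; as a scalar in front of a
  vector it becomes an expression that the rules for sums can handle.\<close>

lemma linear_map_counit_smult [simp]:
  assumes U: "module K U"
  shows "u \<in> carrier U \<Longrightarrow> linear_map K X H e \<Longrightarrow> linear_map K X U (\<lambda>x. counit H (e x) \<odot>\<^bsub>U\<^esub> u)"
    and "h \<in> carrier H \<Longrightarrow> linear_map K X U f \<Longrightarrow> linear_map K X U (\<lambda>x. counit H h \<odot>\<^bsub>U\<^esub> f x)"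
    and "h \<in> carrier H \<Longrightarrow> linear_map K U U (module.smult U (counit H h))"
proof -
  interpret U: module K U by (rule U)
  show "linear_map K X U (\<lambda>x. counit H (e x) \<odot>\<^bsub>U\<^esub> u)" if "u \<in> carrier U" "linear_map K X H e"
    using that counit_linear linear_mapD[OF that(2)]
    by (intro linear_mapI) (auto simp: linear_functional_def U.smult_l_distr U.smult_assoc1)
  show *: "linear_map K X U (\<lambda>x. counit H h \<odot>\<^bsub>U\<^esub> f x)" if "h \<in> carrier H" "linear_map K X U f"
    for f X
    using that by (intro linear_map_smult[OF U]) simp_all
  show "linear_map K U U (module.smult U (counit H h))" if "h \<in> carrier H"
    using *[OF that linear_map_ident] .
qed

lemma smult_counit_closed [simp]:
  assumes "module K U" "h \<in> carrier H" "u \<in> carrier U"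
  shows "counit H h \<odot>\<^bsub>U\<^esub> u \<in> carrier U"
  using module.smult_closed[OF assms(1)] assms by simp

lemma ssum_closed_K [simp]: "module K U
  \<Longrightarrow> (\<And>v w. v \<in> carrier V \<Longrightarrow> w \<in> carrier W \<Longrightarrow> F v w \<in> carrier U) \<Longrightarrow> ssum V W U F t \<in> carrier U"
  by (rule ssum_closed)

context
  fixes M :: "('k,'a univ) hopf_module"
  assumes M: "M \<in> Obj"
begin

interpretation M: four_angle_hopf_module K H M
  using M by (simp add: hopf_Obj_def)

lemma module_Obj [simp]: "module K M"
  by (rule M.module_axioms)

lemma twist_closed [simp]: "m \<in> carrier M \<Longrightarrow> twist M m \<in> carrier M"
  using linear_mapD(1)[OF M.twist_linear] .

lemma untwist_closed [simp]: "m \<in> carrier M \<Longrightarrow> untwist M m \<in> carrier M"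
  using bij_betwE[OF bij_betw_inv_into[OF M.twist_bij]] by blast

lemma untwist_twist [simp]: "m \<in> carrier M \<Longrightarrow> untwist M (twist M m) = m"
  using bij_betw_inv_into_left[OF M.twist_bij] .

lemma twist_untwist [simp]: "m \<in> carrier M \<Longrightarrow> twist M (untwist M m) = m"
  using bij_betw_inv_into_right[OF M.twist_bij] .

lemma linear_map_twist' [simp]: "linear_map K M M (twist M)"
  by (rule M.twist_linear)

lemma linear_map_untwist' [simp]: "linear_map K M M (untwist M)"
proof -
  note tw = linear_mapD[OF M.twist_linear]
  have inj: "x = y" if "twist M x = twist M y" "x \<in> carrier M" "y \<in> carrier M" for x y
    using that M.twist_bij by (auto simp: bij_betw_def inj_on_def)
  show ?thesis
    by (intro linear_mapI) (simp, (rule inj; simp add: tw)+)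
qed

lemma linear_map_twist [simp]: "linear_map K X M e \<Longrightarrow> linear_map K X M (\<lambda>x. twist M (e x))"
  by (rule linear_map_compose[OF linear_map_twist'])

lemma linear_map_untwist [simp]: "linear_map K X M e \<Longrightarrow> linear_map K X M (\<lambda>x. untwist M (e x))"
  by (rule linear_map_compose[OF linear_map_untwist'])

lemma twist_ssum [simp]:
  assumes "\<And>a b. a \<in> carrier A \<Longrightarrow> b \<in> carrier B \<Longrightarrow> G a b \<in> carrier M"
  shows "twist M (ssum A B M (\<lambda>a b. G a b) t) = ssum A B M (\<lambda>a b. twist M (G a b)) t"
  using assms by (intro ssum_linear[where K = K]) simp_all

lemmas lact_lin [simp] = bilinear_map_lin[OF M.lact_bilinear]
lemmas ract_lin [simp] = bilinear_map_lin[OF M.ract_bilinear]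

lemma lact_ssum [simp]:
  "m \<in> carrier M \<Longrightarrow> (\<And>a b. a \<in> carrier A \<Longrightarrow> b \<in> carrier B \<Longrightarrow> G a b \<in> carrier H) \<Longrightarrow>
    lact M (ssum A B H (\<lambda>a b. G a b) t) m = ssum A B M (\<lambda>a b. lact M (G a b) m) t"
  "h \<in> carrier H \<Longrightarrow> (\<And>a b. a \<in> carrier A \<Longrightarrow> b \<in> carrier B \<Longrightarrow> G' a b \<in> carrier M) \<Longrightarrow>
    lact M h (ssum A B M (\<lambda>a b. G' a b) t) = ssum A B M (\<lambda>a b. lact M h (G' a b)) t"
  by (auto intro!: ssum_linear[where K = K and U' = M and g = "\<lambda>h. lact M h m"]
      ssum_linear[where K = K and U' = M and g = "lact M h"])

lemma ract_ssum [simp]: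
  "m \<in> carrier M \<Longrightarrow> (\<And>a b. a \<in> carrier A \<Longrightarrow> b \<in> carrier B \<Longrightarrow> G a b \<in> carrier H) \<Longrightarrow>
    ract M m (ssum A B H (\<lambda>a b. G a b) t) = ssum A B M (\<lambda>a b. ract M m (G a b)) t"
  "h \<in> carrier H \<Longrightarrow> (\<And>a b. a \<in> carrier A \<Longrightarrow> b \<in> carrier B \<Longrightarrow> G' a b \<in> carrier M) \<Longrightarrow>
    ract M (ssum A B M (\<lambda>a b. G' a b) t) h = ssum A B M (\<lambda>a b. ract M (G' a b) h) t"
  by (auto intro!: ssum_linear[where K = K and U' = M and g = "\<lambda>m. ract M m h"]
      ssum_linear[where K = K and U' = M and g = "ract M m"])

lemmas twist_lact [simp] = M.twist_lact
lemmas twist_ract [simp] = M.twist_ract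
lemmas lact_one [simp] = M.lact_one
lemmas ract_one [simp] = M.ract_one
lemmas lact_assoc = M.lact_assoc
lemmas ract_assoc = M.ract_assoc
lemmas lact_ract = M.lact_ract

lemma lcoact_closed [simp]: "m \<in> carrier M \<Longrightarrow> lcoact M m \<in> carrier (H \<boxtimes> M)"
  using linear_mapD(1)[OF M.lcoact_linear] .

lemma rcoact_closed [simp]: "m \<in> carrier M \<Longrightarrow> rcoact M m \<in> carrier (M \<boxtimes> H)"
  using linear_mapD(1)[OF M.rcoact_linear] .

lemma linear_map_lcoact [simp]:
  "linear_map K X M e \<Longrightarrow> linear_map K X (H \<boxtimes> M) (\<lambda>x. lcoact M (e x))"
  "linear_map K M (H \<boxtimes> M) (lcoact M)"
  using linear_map_compose[OF M.lcoact_linear] M.lcoact_linear by blast+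

lemma linear_map_rcoact [simp]:
  "linear_map K X M e \<Longrightarrow> linear_map K X (M \<boxtimes> H) (\<lambda>x. rcoact M (e x))"
  "linear_map K M (M \<boxtimes> H) (rcoact M)"
  using linear_map_compose[OF M.rcoact_linear] M.rcoact_linear by blast+

lemma tmap_lcoact [simp]:
  "m \<in> carrier M \<Longrightarrow> tmap K V' W' f g (lcoact M m)
    = ssum H M (V' \<boxtimes> W') (\<lambda>v w. tens K V' W' (f v) (g w)) (lcoact M m)"
  by (rule tmap_eq_ssum) simp_all

lemma tmap_rcoact [simp]:
  "m \<in> carrier M \<Longrightarrow> tmap K V' W' f g (rcoact M m)
    = ssum M H (V' \<boxtimes> W') (\<lambda>v w. tens K V' W' (f v) (g w)) (rcoact M m)"
  by (rule tmap_eq_ssum) simp_all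

end

text \<open>Rules for objects match on their own operations, those of \<open>hopf_unit H\<close>.
  They are instantiated at the unit and rewritten to speak of the operations of
  \<open>H\<close>.\<close>

lemmas unit_rules = twist_closed[OF unit_in_Obj] untwist_closed[OF unit_in_Obj]
  untwist_twist[OF unit_in_Obj] twist_untwist[OF unit_in_Obj] linear_map_twist'[OF unit_in_Obj]
  linear_map_untwist'[OF unit_in_Obj] linear_map_twist[OF unit_in_Obj]
  linear_map_untwist[OF unit_in_Obj] twist_ssum[OF unit_in_Obj]
  lact_lin[OF unit_in_Obj] lact_ssum[OF unit_in_Obj] ract_lin[OF unit_in_Obj] ract_ssum[OF unit_in_Obj]
  lcoact_closed[OF unit_in_Obj] linear_map_lcoact[OF unit_in_Obj] tmap_lcoact[OF unit_in_Obj]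

declare unit_rules [unfolded hopf_unit_simps hopf_unit_space linear_map_hopf_unit, simp]

context
  fixes M :: "('k,'a univ) hopf_module"
  assumes M: "M \<in> Obj"
begin

interpretation M: four_angle_hopf_module K H M
  using M by (simp add: hopf_Obj_def)

lemmas Obj_simps [simp] = module_Obj[OF M] twist_closed[OF M] untwist_closed[OF M] untwist_twist[OF M]
  twist_untwist[OF M] linear_map_twist'[OF M] linear_map_untwist'[OF M] linear_map_twist[OF M]
  linear_map_untwist[OF M] twist_ssum[OF M] lact_lin[OF M] ract_lin[OF M] lact_ssum[OF M] ract_ssum[OF M]
  twist_lact[OF M] twist_ract[OF M] lact_one[OF M] ract_one[OF M] lcoact_closed[OF M]
  rcoact_closed[OF M] linear_map_lcoact[OF M] linear_map_rcoact[OF M] tmap_lcoact[OF M] tmap_rcoact[OF M]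

text \<open>A coaction standing as a whole inside a pure tensor is decomposed, so that it is summed
  over and the rules for \<open>ssum\<close> apply to it.\<close>

lemma tens_lcoact [simp]:
  assumes "module K V" "m \<in> carrier M" "v \<in> carrier V"
  shows "tens K V (H \<boxtimes> M) v (lcoact M m) = ssum H M (V \<boxtimes> H \<boxtimes> M)
      (\<lambda>a n. tens K V (H \<boxtimes> M) v (tens K H M a n)) (lcoact M m)"
    and "tens K (H \<boxtimes> M) V (lcoact M m) v = ssum H M ((H \<boxtimes> M) \<boxtimes> V)
      (\<lambda>a n. tens K (H \<boxtimes> M) V (tens K H M a n) v) (lcoact M m)"
  using assms by (simp_all add: ssum_tens_collapse)

lemma tens_rcoact [simp]:
  assumes "module K V" "m \<in> carrier M" "v \<in> carrier V"
  shows "tens K V (M \<boxtimes> H) v (rcoact M m) = ssum M H (V \<boxtimes> M \<boxtimes> H)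
      (\<lambda>n a. tens K V (M \<boxtimes> H) v (tens K M H n a)) (rcoact M m)"
    and "tens K (M \<boxtimes> H) V (rcoact M m) v = ssum M H ((M \<boxtimes> H) \<boxtimes> V)
      (\<lambda>n a. tens K (M \<boxtimes> H) V (tens K M H n a) v) (rcoact M m)"
  using assms by (simp_all add: ssum_tens_collapse)

lemma untwist_eqI:
  assumes "twist M x = y" "x \<in> carrier M"
  shows "untwist M y = x"
  using assms by auto

lemma untwist_lact [simp]:
  "h \<in> carrier H \<Longrightarrow> m \<in> carrier M \<Longrightarrow> untwist M (lact M h m) = lact M (untwist H h) (untwist M m)"
  by (rule untwist_eqI) simp_all

text \<open>Hom-associativity solved for an iterated action whose outer element carries no twist.
  This and the two rules below bring mixed actions into the form of one left action inside one right
  action.\<close>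

lemma lact_lact:
  assumes "a \<in> carrier H" "b \<in> carrier H" "m \<in> carrier M"
  shows "lact M a (lact M b m) = lact M (untwist H a \<otimes>\<^bsub>H\<^esub> b) (twist M m)"
  using lact_assoc[OF M, of "untwist H a" b m] assms by simp

lemma ract_ract:
  assumes "a \<in> carrier H" "b \<in> carrier H" "m \<in> carrier M"
  shows "ract M (ract M m a) b = ract M (twist M m) (a \<otimes>\<^bsub>H\<^esub> untwist H b)"
  using ract_assoc[OF M, of a "untwist H b" m] assms by simp

lemma lact_ract_commute:
  assumes "a \<in> carrier H" "b \<in> carrier H" "m \<in> carrier M"
  shows "lact M a (ract M m b) = ract M (lact M (untwist H a) m) (twist H b)"
  using lact_ract[OF M, of "untwist H a" b m] assms by simp

text \<open>The axiom for \<rho>(\<zeta>(m)) evaluated by an arbitrary bilinear F, the form in which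
  it rewrites below other sums. The remaining axioms are treated in the same way.\<close>

lemma ssum_lcoact_twist [simp]:
  assumes "module K U" "bilinear_map K H M U F" "m \<in> carrier M"
  shows "ssum H M U (\<lambda>a n. F a n) (lcoact M (twist M m))
    = ssum H M U (\<lambda>a n. F (twist H a) (twist M n)) (lcoact M m)"
  supply [simp] = assms bilinear_map_lin[OF assms(2)]
  by (simp add: M.lcoact_twist)

lemma ssum_rcoact_twist [simp]:
  assumes "module K U" "bilinear_map K M H U F" "m \<in> carrier M"
  shows "ssum M H U (\<lambda>n a. F n a) (rcoact M (twist M m))
    = ssum M H U (\<lambda>n a. F (twist M n) (twist H a)) (rcoact M m)"
  supply [simp] = assms bilinear_map_lin[OF assms(2)]
  by (simp add: M.rcoact_twist)

lemma ssum_lcoact_untwist [simp]: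
  assumes "module K U" "bilinear_map K H M U F" "m \<in> carrier M"
  shows "ssum H M U (\<lambda>a n. F a n) (lcoact M (untwist M m))
    = ssum H M U (\<lambda>a n. F (untwist H a) (untwist M n)) (lcoact M m)"
  supply [simp] = assms bilinear_map_lin[OF assms(2)]
  using ssum_lcoact_twist[of U "\<lambda>a n. F (untwist H a) (untwist M n)" "untwist M m"]
  by simp

lemma ssum_rcoact_untwist [simp]:
  assumes "module K U" "bilinear_map K M H U F" "m \<in> carrier M"
  shows "ssum M H U (\<lambda>n a. F n a) (rcoact M (untwist M m))
    = ssum M H U (\<lambda>n a. F (untwist M n) (untwist H a)) (rcoact M m)"
  supply [simp] = assms bilinear_map_lin[OF assms(2)]
  using ssum_rcoact_twist[of U "\<lambda>n a. F (untwist M n) (untwist H a)" "untwist M m"]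
  by simp

text \<open>The axiom only speaks of the sum of \<epsilon>(a) n; composing it with a linear g covers
  sums in which n stands under further operations.\<close>

lemma ssum_lcoact_counit [simp]:
  assumes "module K U" "linear_map K M U g" "m \<in> carrier M"
  shows "ssum H M U (\<lambda>a n. counit H a \<odot>\<^bsub>U\<^esub> g n) (lcoact M m) = g (twist M m)"
proof -
  have "g (twist M m) = g (ssum H M M (\<lambda>a n. counit H a \<odot>\<^bsub>M\<^esub> n) (lcoact M m))"
    using M.lcoact_counit[OF assms(3)] assms(3) by (simp add: tsum_eq_ssum[of K H M])
  also have "\<dots> = ssum H M U (\<lambda>a n. g (counit H a \<odot>\<^bsub>M\<^esub> n)) (lcoact M m)"
    by (rule ssum_linear[where K = K]) (use assms in simp_all)
  finally show ?thesis
    by (simp add: linear_mapD(3)[OF assms(2)])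
qed

lemma ssum_rcoact_counit [simp]:
  assumes "module K U" "linear_map K M U g" "m \<in> carrier M"
  shows "ssum M H U (\<lambda>n a. counit H a \<odot>\<^bsub>U\<^esub> g n) (rcoact M m) = g (twist M m)"
proof -
  have "g (twist M m) = g (ssum M H M (\<lambda>n a. counit H a \<odot>\<^bsub>M\<^esub> n) (rcoact M m))"
    using M.rcoact_counit[OF assms(3)] assms(3) by (simp add: tsum_eq_ssum[of K M H])
  also have "\<dots> = ssum M H U (\<lambda>n a. g (counit H a \<odot>\<^bsub>M\<^esub> n)) (rcoact M m)"
    by (rule ssum_linear[where K = K]) (use assms in simp_all)
  finally show ?thesis
    by (simp add: linear_mapD(3)[OF assms(2)])
qed

lemma ssum_lcoact_lact [simp]:
  assumes "module K U" "bilinear_map K H M U F" "h \<in> carrier H" "m \<in> carrier M"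
  shows "ssum H M U (\<lambda>a n. F a n) (lcoact M (lact M h m))
    = ssum H H U (\<lambda>h\<^sub>1 h\<^sub>2. ssum H M U (\<lambda>a n. F (h\<^sub>1 \<otimes>\<^bsub>H\<^esub> a) (lact M h\<^sub>2 n)) (lcoact M m)) (comult H h)"
  supply [simp] = assms bilinear_map_lin[OF assms(2)]
  by (simp add: M.lcoact_lact tcomp_eq_ssum[of K H H _ H M])

lemma ssum_rcoact_lact [simp]:
  assumes "module K U" "bilinear_map K M H U F" "h \<in> carrier H" "m \<in> carrier M"
  shows "ssum M H U (\<lambda>n a. F n a) (rcoact M (lact M h m))
    = ssum H H U (\<lambda>h\<^sub>1 h\<^sub>2. ssum M H U (\<lambda>n a. F (lact M h\<^sub>1 n) (h\<^sub>2 \<otimes>\<^bsub>H\<^esub> a)) (rcoact M m)) (comult H h)"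
  supply [simp] = assms bilinear_map_lin[OF assms(2)]
  by (simp add: M.rcoact_lact tcomp_eq_ssum[of K H H _ M H])

lemma ssum_lcoact_ract [simp]:
  assumes "module K U" "bilinear_map K H M U F" "h \<in> carrier H" "m \<in> carrier M"
  shows "ssum H M U (\<lambda>a n. F a n) (lcoact M (ract M m h))
    = ssum H M U (\<lambda>a n. ssum H H U (\<lambda>h\<^sub>1 h\<^sub>2. F (a \<otimes>\<^bsub>H\<^esub> h\<^sub>1) (ract M n h\<^sub>2)) (comult H h)) (lcoact M m)"
  supply [simp] = assms bilinear_map_lin[OF assms(2)]
  by (simp add: M.lcoact_ract tcomp_eq_ssum[of K H M _ H H])

lemma ssum_rcoact_ract [simp]:
  assumes "module K U" "bilinear_map K M H U F" "h \<in> carrier H" "m \<in> carrier M"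
  shows "ssum M H U (\<lambda>n a. F n a) (rcoact M (ract M m h))
    = ssum M H U (\<lambda>n a. ssum H H U (\<lambda>h\<^sub>1 h\<^sub>2. F (ract M n h\<^sub>1) (a \<otimes>\<^bsub>H\<^esub> h\<^sub>2)) (comult H h)) (rcoact M m)"
  supply [simp] = assms bilinear_map_lin[OF assms(2)]
  by (simp add: M.rcoact_ract tcomp_eq_ssum[of K M H _ H H])

text \<open>Hom-coassociativity has \<beta> on the outer leg of the iterated coaction. Feeding
  \<beta>^-1 of that leg to F yields a rule for the untwisted iteration, which trades the second
  coaction for a comultiplication.\<close>

lemma ssum_lcoact_coassoc:
  assumes "module K U" "trilinear_map K H H M U F" "m \<in> carrier M"
  shows "ssum H M U (\<lambda>a n. ssum H M U (\<lambda>b n'. F a b n') (lcoact M n)) (lcoact M m)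
    = ssum H M U (\<lambda>a n. ssum H H U (\<lambda>a\<^sub>1 a\<^sub>2. F (untwist H a\<^sub>1) a\<^sub>2 (twist M n)) (comult H a)) (lcoact M m)"
proof -
  note [simp] = trilinear_map_lin[OF assms(2)] assms(1,3)
  let ?G = "ssum H (H \<boxtimes> M) U (\<lambda>a s. ssum H M U (\<lambda>b n. F (untwist H a) b n) s)"
  have "?G (tmap K H (H \<boxtimes> M) (twist H) (lcoact M) (lcoact M m))
      = ?G (tassoc K H H M (tmap K (H \<boxtimes> H) M (comult H) (twist M) (lcoact M m)))"
    using M.lcoact_coassoc by simp
  then show ?thesis by simp
qed

lemma ssum_rcoact_coassoc:
  assumes "module K U" "trilinear_map K M H H U F" "m \<in> carrier M"
  shows "ssum M H U (\<lambda>n a. ssum M H U (\<lambda>n' b. F n' b a) (rcoact M n)) (rcoact M m)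
    = ssum M H U (\<lambda>n a. ssum H H U (\<lambda>a\<^sub>1 a\<^sub>2. F (twist M n) a\<^sub>1 (untwist H a\<^sub>2)) (comult H a)) (rcoact M m)"
proof -
  note [simp] = trilinear_map_lin[OF assms(2)] assms(1,3)
  let ?G = "ssum M (H \<boxtimes> H) U (\<lambda>n s. ssum H H U (\<lambda>b a. F n b (untwist H a)) s)"
  have "?G (tassoc K M H H (tmap K (M \<boxtimes> H) H (rcoact M) (twist H) (rcoact M m)))
      = ?G (tmap K M (H \<boxtimes> H) (twist M) (comult H) (rcoact M m))"
    using M.rcoact_coassoc by simp
  then show ?thesis by simp
qed

text \<open>The bicomodule axiom, likewise freed of \<beta> on the left leg and oriented so that the
  right coaction becomes the outer sum.\<close>

lemma ssum_lcoact_rcoact: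
  assumes "module K U" "trilinear_map K H M H U F" "m \<in> carrier M"
  shows "ssum H M U (\<lambda>a n. ssum M H U (\<lambda>n' b. F a n' b) (rcoact M n)) (lcoact M m)
    = ssum M H U (\<lambda>n b. ssum H M U (\<lambda>a n'. F (untwist H a) n' (twist H b)) (lcoact M n)) (rcoact M m)"
proof -
  note [simp] = trilinear_map_lin[OF assms(2)] assms(1,3)
  let ?G = "ssum H (M \<boxtimes> H) U (\<lambda>a s. ssum M H U (\<lambda>n b. F (untwist H a) n b) s)"
  have "?G (tmap K H (M \<boxtimes> H) (twist H) (rcoact M) (lcoact M m))
      = ?G (tassoc K H M H (tmap K (H \<boxtimes> M) H (lcoact M) (twist H) (rcoact M m)))"
    using M.lcoact_rcoact by simp
  then show ?thesis by simp
qed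

end

lemmas unit_ssum_rules = untwist_lact[OF unit_in_Obj] twist_lact[OF unit_in_Obj]
  ssum_lcoact_twist[OF unit_in_Obj] ssum_lcoact_untwist[OF unit_in_Obj]
  ssum_lcoact_counit[OF unit_in_Obj] ssum_rcoact_counit[OF unit_in_Obj]
  ssum_lcoact_lact[OF unit_in_Obj] tens_lcoact[OF unit_in_Obj]

declare unit_ssum_rules [unfolded hopf_unit_simps hopf_unit_space linear_map_hopf_unit, simp]

text \<open>Comes from the unit object, whose coaction is the comultiplication. The rule moves
  iterated comultiplications to the left leg, a normal form for sums over the components of
  h.\<close>

lemma ssum_comult_coassoc:
  assumes "module K U" "trilinear_map K H H H U F" "h \<in> carrier H"
  shows "ssum H H U (\<lambda>a b. ssum H H U (\<lambda>b\<^sub>1 b\<^sub>2. F a b\<^sub>1 b\<^sub>2) (comult H b)) (comult H h)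
    = ssum H H U (\<lambda>a b. ssum H H U (\<lambda>a\<^sub>1 a\<^sub>2. F (untwist H a\<^sub>1) a\<^sub>2 (twist H b)) (comult H a)) (comult H h)"
  using ssum_lcoact_coassoc[OF unit_in_Obj, of U F h] assms
  by (simp add: trilinear_map_def bilinear_map_def)

declare comult_one [simp] one_closed [simp] twist_one [simp] one_mult [simp] mult_one [simp] counit_twist [simp]
  counit_mult [simp] counit_one [simp]

lemma untwist_one [simp]: "untwist H \<one>\<^bsub>H\<^esub> = \<one>\<^bsub>H\<^esub>"
  using untwist_eqI[OF unit_in_Obj, of "\<one>\<^bsub>H\<^esub>" "\<one>\<^bsub>H\<^esub>"] by simp

lemma counit_untwist [simp]: "h \<in> carrier H \<Longrightarrow> counit H (untwist H h) = counit H h"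
  using counit_twist[of "untwist H h"] by simp

section \<open>The Hom-cotensor product as an object\<close>

context
  fixes M N :: "('k,'a univ) hopf_module"
  assumes M [simp]: "M \<in> Obj" and N [simp]: "N \<in> Obj"
begin

lemmas [simp] = Obj_simps[OF M] Obj_simps[OF N]

text \<open>The two sides of the cotensor condition, already reassociated into M \<otimes> H
  \<otimes> N, so that M \<box> N is the equalizer of two linear maps with a common target.\<close>

definition cotensor_lhs :: "'a univ \<Rightarrow> 'a univ" where
  "cotensor_lhs = ssum M N (M \<boxtimes> H \<boxtimes> N) (\<lambda>m n. ssum M H (M \<boxtimes> H \<boxtimes> N)
    (\<lambda>m' a. tens K M (H \<boxtimes> N) m' (tens K H N a (twist N n))) (rcoact M m))"

definition cotensor_rhs :: "'a univ \<Rightarrow> 'a univ" where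
  "cotensor_rhs = ssum M N (M \<boxtimes> H \<boxtimes> N) (\<lambda>m n. ssum H N (M \<boxtimes> H \<boxtimes> N)
    (\<lambda>a n'. tens K M (H \<boxtimes> N) (twist M m) (tens K H N a n')) (lcoact N n))"

lemma linear_cotensor_lhs: "linear_map K (M \<boxtimes> N) (M \<boxtimes> H \<boxtimes> N) cotensor_lhs"
  unfolding cotensor_lhs_def by simp

lemma linear_cotensor_rhs: "linear_map K (M \<boxtimes> N) (M \<boxtimes> H \<boxtimes> N) cotensor_rhs"
  unfolding cotensor_rhs_def by simp

lemma cotensor_carrier: "carrier (M \<box> N) = {x \<in> carrier (M \<boxtimes> N). cotensor_lhs x = cotensor_rhs x}"
  by (auto simp: cotensor_fields cotensor_set_def cotensor_lhs_def cotensor_rhs_def tmap_eq_ssum[of K M N])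

lemma cotensor_ops [simp]: "zero (M \<box> N) = zero (M \<boxtimes> N)" "add (M \<box> N) = add (M \<boxtimes> N)" "smult (M \<box> N) = smult (M \<boxtimes> N)"
  by (simp_all add: cotensor_fields)

lemma module_cotensor [simp]: "module K (M \<box> N)"
  by (rule module_equalizer[OF _ _ linear_cotensor_lhs linear_cotensor_rhs cotensor_carrier]) simp_all

lemma cotensor_in_tensor [simp]: "x \<in> carrier (M \<box> N) \<Longrightarrow> x \<in> carrier (M \<boxtimes> N)"
  by (simp add: cotensor_carrier)

lemma linear_map_from_cotensor [simp]: "linear_map K (M \<boxtimes> N) U f \<Longrightarrow> linear_map K (M \<box> N) U f"
  by (auto simp: linear_map_def)

lemma linear_map_to_cotensor:
  "linear_map K X (M \<boxtimes> N) f \<Longrightarrow> (\<And>x. x \<in> carrier X \<Longrightarrow> f x \<in> carrier (M \<box> N)) \<Longrightarrow> linear_map K X (M \<box> N) f"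
  by (auto simp: linear_map_def)

lemma cotensorI:
  assumes "x \<in> carrier (M \<boxtimes> N)" "cotensor_lhs x = cotensor_rhs x"
  shows "x \<in> carrier (M \<box> N)"
  using assms unfolding cotensor_carrier by blast

text \<open>The defining relation m_(0) \<otimes> m_(1) \<otimes> \<zeta>(n) = \<zeta>(m) \<otimes>
  n_[-1] \<otimes> n_[0], evaluated by a trilinear F.\<close>

lemma cotensor_eq:
  assumes "x \<in> carrier (M \<box> N)" "module K U" "trilinear_map K M H N U F"
  shows "ssum M N U (\<lambda>m n. ssum M H U (\<lambda>m' a. F m' a (twist N n)) (rcoact M m)) x
    = ssum M N U (\<lambda>m n. ssum H N U (\<lambda>a n'. F (twist M m) a n') (lcoact N n)) x"
proof -
  note [simp] = trilinear_map_lin[OF assms(3)] assms(2)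
  let ?G = "ssum M (H \<boxtimes> N) U (\<lambda>m s. ssum H N U (\<lambda>a n. F m a n) s)"
  have "cotensor_lhs x = cotensor_rhs x"
    using assms(1) unfolding cotensor_carrier by blast
  then have "?G (cotensor_lhs x) = ?G (cotensor_rhs x)"
    by (rule arg_cong)
  then show ?thesis by (simp add: cotensor_lhs_def cotensor_rhs_def)
qed

text \<open>The defining relation solved for an untwisted side: inverting the twist of M eliminates
  the left coaction of N, and in the next lemma inverting the twist of N eliminates the right
  coaction of M.\<close>

lemma cotensor_lcoact_to_rcoact:
  assumes "x \<in> carrier (M \<box> N)" "module K U" "trilinear_map K M H N U F"
  shows "ssum M N U (\<lambda>m n. ssum H N U (\<lambda>a n'. F m a n') (lcoact N n)) x
    = ssum M N U (\<lambda>m n. ssum M H U (\<lambda>m' a. F (untwist M m') a (twist N n)) (rcoact M m)) x"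
  using cotensor_eq[of x U "\<lambda>m a n. F (untwist M m) a n"] assms
  by (simp add: trilinear_map_lin[OF assms(3)])

lemma cotensor_rcoact_to_lcoact:
  assumes "x \<in> carrier (M \<box> N)" "module K U" "trilinear_map K M H N U F"
  shows "ssum M N U (\<lambda>m n. ssum M H U (\<lambda>m' a. F m' a n) (rcoact M m)) x
    = ssum M N U (\<lambda>m n. ssum H N U (\<lambda>a n'. F (twist M m) a (untwist N n')) (lcoact N n)) x"
  using cotensor_eq[of x U "\<lambda>m a n. F m a (untwist N n)"] assms
  by (simp add: trilinear_map_lin[OF assms(3)])

lemma twist_cotensor:
  "x \<in> carrier (M \<boxtimes> N) \<Longrightarrow> twist (M \<box> N) x = ssum M N (M \<boxtimes> N) (\<lambda>m n. tens K M N (twist M m) (twist N n)) x"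
  by (simp add: cotensor_structure tmap_eq_ssum[of K M N])

lemma lact_cotensor:
  "h \<in> carrier H \<Longrightarrow> x \<in> carrier (M \<boxtimes> N) \<Longrightarrow> lact (M \<box> N) h x = ssum H H (M \<boxtimes> N) (\<lambda>h\<^sub>1 h\<^sub>2. ssum M N (M \<boxtimes> N)
    (\<lambda>m n. tens K M N (lact M (untwist H h\<^sub>1) m) (lact N (untwist H h\<^sub>2) n)) x) (comult H h)"
  by (simp add: cotensor_structure tcomp_eq_ssum[of K H H _ M N])

lemma ract_cotensor:
  "h \<in> carrier H \<Longrightarrow> x \<in> carrier (M \<boxtimes> N) \<Longrightarrow> ract (M \<box> N) x h = ssum M N (M \<boxtimes> N) (\<lambda>m n. ssum H H (M \<boxtimes> N)
    (\<lambda>h\<^sub>1 h\<^sub>2. tens K M N (ract M m (untwist H h\<^sub>1)) (ract N n (untwist H h\<^sub>2))) (comult H h)) x"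
  by (simp add: cotensor_structure tcomp_eq_ssum[of K M N _ H H])

end

context
  fixes M N :: "('k,'a univ) hopf_module"
  assumes M [simp]: "M \<in> Obj" and N [simp]: "N \<in> Obj"
begin

lemmas [simp] = Obj_simps[OF M] Obj_simps[OF N] untwist_lact[OF M] untwist_lact[OF N]

text \<open>For fixed spaces these instances of ssum_swap are directed rewrite rules, which move sums over a
  comultiplication outwards; the rule itself is only permutative.\<close>

lemmas comult_out =
  ssum_swap[where K = K and V = M and W = N and X = H and Y = H]
  ssum_swap[where K = K and V = M and W = H and X = H and Y = H]
  ssum_swap[where K = K and V = H and W = N and X = H and Y = H]
  ssum_swap[where K = K and V = H and W = M and X = H and Y = H]
  ssum_swap[where K = K and V = N and W = H and X = H and Y = H]

lemma twist_cotensor_closed [simp]: "x \<in> carrier (M \<box> N) \<Longrightarrow> twist (M \<box> N) x \<in> carrier (M \<box> N)"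
proof (rule cotensorI[OF M N])
  assume x [simp]: "x \<in> carrier (M \<box> N)"
  show "twist (M \<box> N) x \<in> carrier (M \<boxtimes> N)" by (simp add: twist_cotensor)
  show "cotensor_lhs M N (twist (M \<box> N) x) = cotensor_rhs M N (twist (M \<box> N) x)"
    using cotensor_eq[OF M N x, of "M \<boxtimes> H \<boxtimes> N" "\<lambda>m a n. tens K M (H \<boxtimes> N) (twist M m) (tens K H N (twist H a) (twist N n))"]
    by (simp add: cotensor_lhs_def cotensor_rhs_def twist_cotensor)
qed

text \<open>The right coaction on the first factor produces h_11, h_12, h_2 and the left coaction on
  the second one h_1, h_21, h_22. Hom-coassociativity of \<Delta> identifies these, twists included,
  and what remains is the relation for x.\<close>

lemma lact_cotensor_closed [simp]:
  assumes h [simp]: "h \<in> carrier H" and x [simp]: "x \<in> carrier (M \<box> N)"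
  shows "lact (M \<box> N) h x \<in> carrier (M \<box> N)"
proof (rule cotensorI[OF M N])
  show "lact (M \<box> N) h x \<in> carrier (M \<boxtimes> N)" by (simp add: lact_cotensor)
  show "cotensor_lhs M N (lact (M \<box> N) h x) = cotensor_rhs M N (lact (M \<box> N) h x)"
    by (simp add: cotensor_lhs_def cotensor_rhs_def lact_cotensor comult_out ssum_comult_coassoc cotensor_lcoact_to_rcoact[OF M N x])
qed

lemma ract_cotensor_closed [simp]:
  assumes h [simp]: "h \<in> carrier H" and x [simp]: "x \<in> carrier (M \<box> N)"
  shows "ract (M \<box> N) x h \<in> carrier (M \<box> N)"
proof (rule cotensorI[OF M N])
  show "ract (M \<box> N) x h \<in> carrier (M \<boxtimes> N)" by (simp add: ract_cotensor)
  show "cotensor_lhs M N (ract (M \<box> N) x h) = cotensor_rhs M N (ract (M \<box> N) x h)"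
    by (simp add: cotensor_lhs_def cotensor_rhs_def ract_cotensor comult_out ssum_comult_coassoc cotensor_lcoact_to_rcoact[OF M N x])
qed

lemma tens_cotensor_inj:
  "inj_on (left_incl M N) (carrier (H \<boxtimes> (M \<box> N)))"
  "inj_on (right_incl M N) (carrier ((M \<box> N) \<boxtimes> H))"
  by (rule tensor_map_inj[OF field_K]; simp)+

text \<open>By flatness it suffices that m_[-1] \<otimes> m_[0] \<otimes> \<zeta>(n) satisfies the
  cotensor condition in its last two factors. The bicomodule axiom moves the right coaction of m_[0]
  out to m, where the relation for x applies.\<close>

lemma lcoact_cotensor_exists:
  assumes x [simp]: "x \<in> carrier (M \<box> N)"
  shows "\<exists>s \<in> carrier (H \<boxtimes> (M \<box> N)). left_incl M N s
    = ssum M N (H \<boxtimes> M \<boxtimes> N) (\<lambda>m n. ssum H M (H \<boxtimes> M \<boxtimes> N)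
      (\<lambda>a m'. tens K H (M \<boxtimes> N) a (tens K M N m' (twist N n))) (lcoact M m)) x"
proof (rule tensor_equalizer_right[OF field_K module_H _ _ module_cotensor
      linear_cotensor_lhs linear_cotensor_rhs cotensor_carrier])
  show "ssum H (M \<boxtimes> N) (H \<boxtimes> M \<boxtimes> H \<boxtimes> N) (\<lambda>a z. tens K H (M \<boxtimes> H \<boxtimes> N) a (cotensor_lhs M N z)) (ssum M N (H \<boxtimes> M \<boxtimes> N)
      (\<lambda>m n. ssum H M (H \<boxtimes> M \<boxtimes> N) (\<lambda>a m'. tens K H (M \<boxtimes> N) a (tens K M N m' (twist N n))) (lcoact M m)) x)
    = ssum H (M \<boxtimes> N) (H \<boxtimes> M \<boxtimes> H \<boxtimes> N) (\<lambda>a z. tens K H (M \<boxtimes> H \<boxtimes> N) a (cotensor_rhs M N z)) (ssum M N (H \<boxtimes> M \<boxtimes> N)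
      (\<lambda>m n. ssum H M (H \<boxtimes> M \<boxtimes> N) (\<lambda>a m'. tens K H (M \<boxtimes> N) a (tens K M N m' (twist N n))) (lcoact M m)) x)"
    by (simp add: cotensor_lhs_def cotensor_rhs_def ssum_lcoact_rcoact[OF M]
        cotensor_rcoact_to_lcoact[OF M N x] ssum_swap[where K = K and V = H and W = M and X = H and Y = N])
qed (simp_all)

lemma rcoact_cotensor_exists:
  assumes x [simp]: "x \<in> carrier (M \<box> N)"
  shows "\<exists>s \<in> carrier ((M \<box> N) \<boxtimes> H). right_incl M N s
    = ssum M N ((M \<boxtimes> N) \<boxtimes> H) (\<lambda>m n. ssum N H ((M \<boxtimes> N) \<boxtimes> H)
      (\<lambda>n' a. tens K (M \<boxtimes> N) H (tens K M N (twist M m) n') a) (rcoact N n)) x"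
proof (rule tensor_equalizer_left[OF field_K module_H _ _ module_cotensor
      linear_cotensor_lhs linear_cotensor_rhs cotensor_carrier])
  show "ssum (M \<boxtimes> N) H ((M \<boxtimes> H \<boxtimes> N) \<boxtimes> H) (\<lambda>z a. tens K (M \<boxtimes> H \<boxtimes> N) H (cotensor_lhs M N z) a) (ssum M N ((M \<boxtimes> N) \<boxtimes> H)
      (\<lambda>m n. ssum N H ((M \<boxtimes> N) \<boxtimes> H) (\<lambda>n' a. tens K (M \<boxtimes> N) H (tens K M N (twist M m) n') a) (rcoact N n)) x)
    = ssum (M \<boxtimes> N) H ((M \<boxtimes> H \<boxtimes> N) \<boxtimes> H) (\<lambda>z a. tens K (M \<boxtimes> H \<boxtimes> N) H (cotensor_rhs M N z) a) (ssum M N ((M \<boxtimes> N) \<boxtimes> H)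
      (\<lambda>m n. ssum N H ((M \<boxtimes> N) \<boxtimes> H) (\<lambda>n' a. tens K (M \<boxtimes> N) H (tens K M N (twist M m) n') a) (rcoact N n)) x)"
    by (simp add: cotensor_lhs_def cotensor_rhs_def ssum_lcoact_rcoact[OF N]
        cotensor_rcoact_to_lcoact[OF M N x] ssum_swap[where K = K and V = N and W = H and X = M and Y = H])
qed (simp_all)

end

context
  fixes M N :: "('k,'a univ) hopf_module"
  assumes M [simp]: "M \<in> Obj" and N [simp]: "N \<in> Obj"
begin

lemmas [simp] = Obj_simps[OF M] Obj_simps[OF N] untwist_lact[OF M] untwist_lact[OF N]

text \<open>Existence is flatness and uniqueness is injectivity of \<open>left_incl\<close>, so the
  definite description denotes. The third part is its defining property in Sweedler form, for use in
  computations.\<close>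

lemma lcoact_cotensor:
  assumes x [simp]: "x \<in> carrier (M \<box> N)"
  shows "lcoact (M \<box> N) x \<in> carrier (H \<boxtimes> (M \<box> N))"
    and "tmap K H (M \<boxtimes> N) id id (lcoact (M \<box> N) x)
      = tassoc K H M N (tmap K (H \<boxtimes> M) N (lcoact M) (twist N) x)"
    and "left_incl M N (lcoact (M \<box> N) x)
      = ssum M N (H \<boxtimes> M \<boxtimes> N) (\<lambda>m n. ssum H M (H \<boxtimes> M \<boxtimes> N)
        (\<lambda>a m'. tens K H (M \<boxtimes> N) a (tens K M N m' (twist N n))) (lcoact M m)) x"
proof -
  let ?r = "tassoc K H M N (tmap K (H \<boxtimes> M) N (lcoact M) (twist N) x)"
  let ?P = "\<lambda>y. y \<in> carrier (H \<boxtimes> (M \<box> N)) \<and> tmap K H (M \<boxtimes> N) id id y = ?r"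
  have r: "?r = ssum M N (H \<boxtimes> M \<boxtimes> N) (\<lambda>m n. ssum H M (H \<boxtimes> M \<boxtimes> N)
      (\<lambda>a m'. tens K H (M \<boxtimes> N) a (tens K M N m' (twist N n))) (lcoact M m)) x"
    by (simp add: tmap_eq_ssum[of K M N])
  have j: "tmap K H (M \<boxtimes> N) id id y = left_incl M N y" if "y \<in> carrier (H \<boxtimes> (M \<box> N))" for y
    using that by (simp add: tmap_eq_ssum[of K H "M \<box> N"])
  have "\<exists>y. ?P y"
    using lcoact_cotensor_exists[OF M N x] j r by auto
  moreover have "y = z" if "?P y" "?P z" for y z
    using that j inj_onD[OF tens_cotensor_inj(1)[OF M N], of y z] by auto
  ultimately have "\<exists>!y. ?P y" by blast
  then have "?P (lcoact (M \<box> N) x)"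
    unfolding cotensor_coactions by (rule theI')
  then show "lcoact (M \<box> N) x \<in> carrier (H \<boxtimes> (M \<box> N))" "tmap K H (M \<boxtimes> N) id id (lcoact (M \<box> N) x) = ?r"
    "left_incl M N (lcoact (M \<box> N) x)
      = ssum M N (H \<boxtimes> M \<boxtimes> N) (\<lambda>m n. ssum H M (H \<boxtimes> M \<boxtimes> N)
        (\<lambda>a m'. tens K H (M \<boxtimes> N) a (tens K M N m' (twist N n))) (lcoact M m)) x"
    using j r by auto
qed

lemma rcoact_cotensor:
  assumes x [simp]: "x \<in> carrier (M \<box> N)"
  shows "rcoact (M \<box> N) x \<in> carrier ((M \<box> N) \<boxtimes> H)"
    and "tassoc K M N H (tmap K (M \<boxtimes> N) H id id (rcoact (M \<box> N) x))
      = tmap K M (N \<boxtimes> H) (twist M) (rcoact N) x"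
    and "right_incl M N (rcoact (M \<box> N) x)
      = ssum M N ((M \<boxtimes> N) \<boxtimes> H) (\<lambda>m n. ssum N H ((M \<boxtimes> N) \<boxtimes> H)
        (\<lambda>n' a. tens K (M \<boxtimes> N) H (tens K M N (twist M m) n') a) (rcoact N n)) x"
proof -
  let ?r = "tmap K M (N \<boxtimes> H) (twist M) (rcoact N) x"
  let ?P = "\<lambda>y. y \<in> carrier ((M \<box> N) \<boxtimes> H) \<and> tassoc K M N H (tmap K (M \<boxtimes> N) H id id y) = ?r"
  let ?s = "ssum M N ((M \<boxtimes> N) \<boxtimes> H) (\<lambda>m n. ssum N H ((M \<boxtimes> N) \<boxtimes> H)
      (\<lambda>n' a. tens K (M \<boxtimes> N) H (tens K M N (twist M m) n') a) (rcoact N n)) x"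
  \<comment> \<open>The defining property compares images after \<open>tassoc\<close>.
    \<open>?b\<close> undoes the reassociation, which reduces uniqueness to injectivity of
    \<open>right_incl\<close>.\<close>
  let ?b = "ssum M (N \<boxtimes> H) ((M \<boxtimes> N) \<boxtimes> H) (\<lambda>m. ssum N H ((M \<boxtimes> N) \<boxtimes> H)
      (\<lambda>n a. tens K (M \<boxtimes> N) H (tens K M N m n) a))"
  have r: "?r = tassoc K M N H ?s"
    by (simp add: tmap_eq_ssum[of K M N])
  have b: "?b (tassoc K M N H y) = y" if "y \<in> carrier ((M \<boxtimes> N) \<boxtimes> H)" for y
    using that by (simp add: ssum_tens_collapse ssum_tens_ident)
  have j: "tmap K (M \<boxtimes> N) H id id y = right_incl M N y" if "y \<in> carrier ((M \<box> N) \<boxtimes> H)" for y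
    using that by (simp add: tmap_eq_ssum[of K "M \<box> N" H])
  have eq: "right_incl M N y = ?s" if "?P y" for y
  proof -
    have "tassoc K M N H (right_incl M N y) = tassoc K M N H ?s"
      using that j[of y] unfolding r by metis
    then have "?b (tassoc K M N H (right_incl M N y))
      = ?b (tassoc K M N H ?s)"
      by (rule arg_cong)
    then show ?thesis
      by (subst (asm) (1 2) b) simp_all
  qed
  have "\<exists>y. ?P y"
    using rcoact_cotensor_exists[OF M N x] j r by auto
  moreover have "y = z" if "?P y" "?P z" for y z
    using that eq inj_onD[OF tens_cotensor_inj(2)[OF M N], of y z] by auto
  ultimately have "\<exists>!y. ?P y" by blast
  then have "?P (rcoact (M \<box> N) x)"
    unfolding cotensor_coactions by (rule theI')
  then show "rcoact (M \<box> N) x \<in> carrier ((M \<box> N) \<boxtimes> H)" "tassoc K M N H (tmap K (M \<boxtimes> N) H id id (rcoact (M \<box> N) x)) = ?r"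
    "right_incl M N (rcoact (M \<box> N) x) = ?s"
    using eq by auto
qed

declare lcoact_cotensor(1) [simp] rcoact_cotensor(1) [simp]

text \<open>If a bilinear G is defined on all of M \<otimes> N, then inserting
  \<open>left_incl\<close> does not change the sum, and the image of the coaction under
  \<open>left_incl\<close> is known.\<close>

lemma ssum_lcoact_cotensor [simp]:
  assumes "x \<in> carrier (M \<box> N)" "module K U" "bilinear_map K H (M \<boxtimes> N) U G"
  shows "ssum H (M \<box> N) U (\<lambda>a z. G a z) (lcoact (M \<box> N) x)
    = ssum M N U (\<lambda>m n. ssum H M U (\<lambda>a m'. G a (tens K M N m' (twist N n))) (lcoact M m)) x"
proof -
  note [simp] = assms(1,2) bilinear_map_lin[OF assms(3)]
  have "ssum H (M \<box> N) U (\<lambda>a z. G a z) (lcoact (M \<box> N) x)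
    = ssum H (M \<boxtimes> N) U G (left_incl M N (lcoact (M \<box> N) x))"
    by simp
  then show ?thesis by (simp add: lcoact_cotensor(3))
qed

lemma ssum_rcoact_cotensor [simp]:
  assumes "x \<in> carrier (M \<box> N)" "module K U" "bilinear_map K (M \<boxtimes> N) H U G"
  shows "ssum (M \<box> N) H U (\<lambda>z a. G z a) (rcoact (M \<box> N) x)
    = ssum M N U (\<lambda>m n. ssum N H U (\<lambda>n' a. G (tens K M N (twist M m) n') a) (rcoact N n)) x"
proof -
  note [simp] = assms(1,2) bilinear_map_lin[OF assms(3)]
  have "ssum (M \<box> N) H U (\<lambda>z a. G z a) (rcoact (M \<box> N) x)
    = ssum (M \<boxtimes> N) H U G (right_incl M N (rcoact (M \<box> N) x))"
    by simp
  then show ?thesis by (simp add: rcoact_cotensor(3))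
qed

lemma tmap_lcoact_cotensor [simp]:
  "x \<in> carrier (M \<box> N) \<Longrightarrow> tmap K V' W' f g (lcoact (M \<box> N) x)
    = ssum H (M \<box> N) (V' \<boxtimes> W') (\<lambda>v w. tens K V' W' (f v) (g w)) (lcoact (M \<box> N) x)"
  by (rule tmap_eq_ssum) simp_all

lemma tmap_rcoact_cotensor [simp]:
  "x \<in> carrier (M \<box> N) \<Longrightarrow> tmap K V' W' f g (rcoact (M \<box> N) x)
    = ssum (M \<box> N) H (V' \<boxtimes> W') (\<lambda>v w. tens K V' W' (f v) (g w)) (rcoact (M \<box> N) x)"
  by (rule tmap_eq_ssum) simp_all

lemma H_cotensor_eqI:
  assumes "left_incl M N s = left_incl M N t"
    "s \<in> carrier (H \<boxtimes> (M \<box> N))" "t \<in> carrier (H \<boxtimes> (M \<box> N))"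
  shows "s = t"
  using assms by (rule inj_onD[OF tens_cotensor_inj(1)[OF M N]])

lemma cotensor_H_eqI:
  assumes "right_incl M N s = right_incl M N t"
    "s \<in> carrier ((M \<box> N) \<boxtimes> H)" "t \<in> carrier ((M \<box> N) \<boxtimes> H)"
  shows "s = t"
  using assms by (rule inj_onD[OF tens_cotensor_inj(2)[OF M N]])

text \<open>Coassociativity is an equation in H \<otimes> H \<otimes> (M \<box> N). Applying
  \<open>tensor_map_inj\<close> once more, to \<open>left_incl\<close>, allows testing it in H
  \<otimes> H \<otimes> M \<otimes> N.\<close>

lemma H_H_cotensor_eqI:
  assumes "ssum H (H \<boxtimes> (M \<box> N)) (H \<boxtimes> H \<boxtimes> M \<boxtimes> N)
      (\<lambda>a z. tens K H (H \<boxtimes> M \<boxtimes> N) a (left_incl M N z)) s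
    = ssum H (H \<boxtimes> (M \<box> N)) (H \<boxtimes> H \<boxtimes> M \<boxtimes> N)
      (\<lambda>a z. tens K H (H \<boxtimes> M \<boxtimes> N) a (left_incl M N z)) t"
    "s \<in> carrier (H \<boxtimes> H \<boxtimes> (M \<box> N))" "t \<in> carrier (H \<boxtimes> H \<boxtimes> (M \<box> N))"
  shows "s = t"
  using assms
  by (rule inj_onD[OF tensor_map_inj[OF field_K _ _ _ _ _ _ _ tens_cotensor_inj(1)[OF M N]], rotated 7])
    simp_all

lemma cotensor_H_H_eqI:
  assumes "ssum (M \<box> N) (H \<boxtimes> H) ((M \<boxtimes> N) \<boxtimes> H \<boxtimes> H) (tens K (M \<boxtimes> N) (H \<boxtimes> H)) s
    = ssum (M \<box> N) (H \<boxtimes> H) ((M \<boxtimes> N) \<boxtimes> H \<boxtimes> H) (tens K (M \<boxtimes> N) (H \<boxtimes> H)) t"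
    "s \<in> carrier ((M \<box> N) \<boxtimes> H \<boxtimes> H)" "t \<in> carrier ((M \<box> N) \<boxtimes> H \<boxtimes> H)"
  shows "s = t"
  using assms
  by (rule inj_onD[OF tensor_map_inj[OF field_K], rotated 8]) simp_all

lemma H_cotensor_H_eqI:
  assumes "ssum H ((M \<box> N) \<boxtimes> H) (H \<boxtimes> ((M \<boxtimes> N) \<boxtimes> H))
      (\<lambda>a z. tens K H ((M \<boxtimes> N) \<boxtimes> H) a (right_incl M N z)) s
    = ssum H ((M \<box> N) \<boxtimes> H) (H \<boxtimes> ((M \<boxtimes> N) \<boxtimes> H))
      (\<lambda>a z. tens K H ((M \<boxtimes> N) \<boxtimes> H) a (right_incl M N z)) t"
    "s \<in> carrier (H \<boxtimes> ((M \<box> N) \<boxtimes> H))" "t \<in> carrier (H \<boxtimes> ((M \<box> N) \<boxtimes> H))"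
  shows "s = t"
  using assms
  by (rule inj_onD[OF tensor_map_inj[OF field_K _ _ _ _ _ _ _ tens_cotensor_inj(2)[OF M N]], rotated 7])
    simp_all

lemma linear_map_lcoact_cotensor [simp]: "linear_map K (M \<box> N) (H \<boxtimes> (M \<box> N)) (lcoact (M \<box> N))"
proof (rule linear_map_reflect_inj[OF _ _ tens_cotensor_inj(1)[OF M N]])
  show "linear_map K (M \<box> N) (H \<boxtimes> M \<boxtimes> N) (\<lambda>x. left_incl M N (lcoact (M \<box> N) x))"
    by (subst linear_map_cong[OF module_cotensor[OF M N] lcoact_cotensor(3)]) simp_all
qed simp_all

lemma linear_map_rcoact_cotensor [simp]: "linear_map K (M \<box> N) ((M \<box> N) \<boxtimes> H) (rcoact (M \<box> N))"
proof (rule linear_map_reflect_inj[OF _ _ tens_cotensor_inj(2)[OF M N]])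
  show "linear_map K (M \<box> N) ((M \<boxtimes> N) \<boxtimes> H) (\<lambda>x. right_incl M N (rcoact (M \<box> N) x))"
    by (subst linear_map_cong[OF module_cotensor[OF M N] rcoact_cotensor(3)]) simp_all
qed simp_all

end

section \<open>The axioms of a four-angle Hopf module for the cotensor product\<close>

context
  fixes M N :: "('k,'a univ) hopf_module"
  assumes M [simp]: "M \<in> Obj" and N [simp]: "N \<in> Obj"
begin

lemmas comult_pull =
  ssum_swap[where K = K and V = M and W = N and X = H and Y = H]
  ssum_swap[where K = K and V = M and W = H and X = H and Y = H]
  ssum_swap[where K = K and V = H and W = N and X = H and Y = H]
  ssum_swap[where K = K and V = H and W = M and X = H and Y = H]
  ssum_swap[where K = K and V = N and W = H and X = H and Y = H]

lemmas [simp] = Obj_simps[OF M] Obj_simps[OF N] untwist_lact[OF M] untwist_lact[OF N]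

lemma linear_map_twist_cotensor: "linear_map K (M \<box> N) (M \<box> N) (twist (M \<box> N))"
proof (rule linear_map_to_cotensor[OF M N])
  show "linear_map K (M \<box> N) (M \<boxtimes> N) (twist (M \<box> N))"
    by (subst linear_map_cong[OF module_cotensor[OF M N] twist_cotensor[OF M N cotensor_in_tensor[OF M N]]]) simp_all
qed simp

text \<open>The inverse is \<zeta>^-1 \<otimes> \<zeta>^-1; what needs proof is that it preserves
  the cotensor condition.\<close>

lemma cotensor_twist_bij: "bij_betw (twist (M \<box> N)) (carrier (M \<box> N)) (carrier (M \<box> N))"
proof (rule bij_betwI)
  let ?g = "ssum M N (M \<boxtimes> N) (\<lambda>m n. tens K M N (untwist M m) (untwist N n))"
  show "twist (M \<box> N) \<in> carrier (M \<box> N) \<rightarrow> carrier (M \<box> N)" by simp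
  show "?g \<in> carrier (M \<box> N) \<rightarrow> carrier (M \<box> N)"
  proof
    fix x assume x [simp]: "x \<in> carrier (M \<box> N)"
    show "?g x \<in> carrier (M \<box> N)"
    proof (rule cotensorI[OF M N])
      show "cotensor_lhs M N (?g x) = cotensor_rhs M N (?g x)"
        by (simp add: cotensor_lhs_def cotensor_rhs_def cotensor_lcoact_to_rcoact[OF M N x])
    qed simp
  qed
  show "?g (twist (M \<box> N) x) = x" "twist (M \<box> N) (?g x) = x" if "x \<in> carrier (M \<box> N)" for x
    using that by (simp_all add: twist_cotensor ssum_tens_ident)
qed

lemma cotensor_bilinear:
  "bilinear_map K H (M \<box> N) (M \<box> N) (lact (M \<box> N))" "bilinear_map K (M \<box> N) H (M \<box> N) (ract (M \<box> N))"
proof -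
  note c = linear_map_cong[OF module_cotensor[OF M N] lact_cotensor[OF M N _ cotensor_in_tensor[OF M N]]]
    linear_map_cong[OF module_H lact_cotensor[OF M N _ cotensor_in_tensor[OF M N]]]
    linear_map_cong[OF module_cotensor[OF M N] ract_cotensor[OF M N _ cotensor_in_tensor[OF M N]]]
    linear_map_cong[OF module_H ract_cotensor[OF M N _ cotensor_in_tensor[OF M N]]]
  show "bilinear_map K H (M \<box> N) (M \<box> N) (lact (M \<box> N))" "bilinear_map K (M \<box> N) H (M \<box> N) (ract (M \<box> N))"
    by (rule bilinear_mapI; rule linear_map_to_cotensor[OF M N]; simp add: c)+
qed

lemma cotensor_act_assoc:
  assumes [simp]: "a \<in> carrier H" "b \<in> carrier H" "x \<in> carrier (M \<box> N)"
  shows "lact (M \<box> N) (twist H a) (lact (M \<box> N) b x) = lact (M \<box> N) (a \<otimes>\<^bsub>H\<^esub> b) (twist (M \<box> N) x)"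
    and "ract (M \<box> N) (ract (M \<box> N) x a) (twist H b) = ract (M \<box> N) (twist (M \<box> N) x) (a \<otimes>\<^bsub>H\<^esub> b)"
    and "lact (M \<box> N) (twist H a) (ract (M \<box> N) x b) = ract (M \<box> N) (lact (M \<box> N) a x) (twist H b)"
  \<comment> \<open>The second instance of \<open>ssum_swap\<close> interchanges the sums over the
    components of a and of b. Fixing \<open>s\<close> and \<open>t\<close> keeps the permutative
    rule from being applied backwards.\<close>
  by (simp_all add: lact_cotensor ract_cotensor twist_cotensor comult_pull
      ssum_swap[where K = K and V = H and W = H and X = H and Y = H and t = "comult H b" and s = "comult H a"]
      lact_lact ract_ract lact_ract_commute)

lemma cotensor_twist_act:
  assumes [simp]: "a \<in> carrier H" "x \<in> carrier (M \<box> N)"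
  shows "twist (M \<box> N) (lact (M \<box> N) a x) = lact (M \<box> N) (twist H a) (twist (M \<box> N) x)"
    and "twist (M \<box> N) (ract (M \<box> N) x a) = ract (M \<box> N) (twist (M \<box> N) x) (twist H a)"
  by (simp_all add: lact_cotensor ract_cotensor twist_cotensor)

lemma cotensor_act_one:
  assumes [simp]: "x \<in> carrier (M \<box> N)"
  shows "lact (M \<box> N) \<one>\<^bsub>H\<^esub> x = twist (M \<box> N) x" "ract (M \<box> N) x \<one>\<^bsub>H\<^esub> = twist (M \<box> N) x"
  by (simp_all add: lact_cotensor ract_cotensor twist_cotensor)

text \<open>In the following proofs, the first simplification pushes the embedding of \<open>M \<box> N\<close> through
  while the structure maps of \<open>M \<box> N\<close> are still folded, so that their values are known to lie in
  \<open>M \<box> N\<close>; only then they are replaced by formulas with values in \<open>M \<otimes> N\<close>.\<close>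

lemma lcoact_cotensor_twist:
  assumes [simp]: "x \<in> carrier (M \<box> N)"
  shows "lcoact (M \<box> N) (twist (M \<box> N) x) = tmap K H (M \<box> N) (twist H) (twist (M \<box> N)) (lcoact (M \<box> N) x)"
proof (rule H_cotensor_eqI[OF M N])
  show "left_incl M N (lcoact (M \<box> N) (twist (M \<box> N) x))
    = left_incl M N (tmap K H (M \<box> N) (twist H) (twist (M \<box> N)) (lcoact (M \<box> N) x))"
    by simp (simp add: twist_cotensor)
qed simp_all

lemma rcoact_cotensor_twist:
  assumes [simp]: "x \<in> carrier (M \<box> N)"
  shows "rcoact (M \<box> N) (twist (M \<box> N) x) = tmap K (M \<box> N) H (twist (M \<box> N)) (twist H) (rcoact (M \<box> N) x)"
proof (rule cotensor_H_eqI[OF M N])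
  show "right_incl M N (rcoact (M \<box> N) (twist (M \<box> N) x))
    = right_incl M N (tmap K (M \<box> N) H (twist (M \<box> N)) (twist H) (rcoact (M \<box> N) x))"
    by simp (simp add: twist_cotensor)
qed simp_all

lemma coact_cotensor_counit:
  assumes [simp]: "x \<in> carrier (M \<box> N)"
  shows "tsum (M \<box> N) (\<lambda>a n. counit H a \<odot>\<^bsub>(M \<box> N)\<^esub> n) (lcoact (M \<box> N) x) = twist (M \<box> N) x"
    and "tsum (M \<box> N) (\<lambda>n a. counit H a \<odot>\<^bsub>(M \<box> N)\<^esub> n) (rcoact (M \<box> N) x) = twist (M \<box> N) x"
proof -
  \<comment> \<open>\<open>tsum\<close> uses only addition and zero of its target, which M \<box> N
    shares with M \<otimes> N; in the larger space, pure tensors may occur as values of the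
    sum.\<close>
  have "tsum (M \<box> N) F = tsum (M \<boxtimes> N) F" for F :: "'a univ \<Rightarrow> 'a univ \<Rightarrow> 'a univ"
    by (rule ext) (simp add: tsum_def)
  then show "tsum (M \<box> N) (\<lambda>a n. counit H a \<odot>\<^bsub>(M \<box> N)\<^esub> n) (lcoact (M \<box> N) x) = twist (M \<box> N) x"
    and "tsum (M \<box> N) (\<lambda>n a. counit H a \<odot>\<^bsub>(M \<box> N)\<^esub> n) (rcoact (M \<box> N) x) = twist (M \<box> N) x"
    by (simp_all add: tsum_eq_ssum[of K H "M \<box> N"] tsum_eq_ssum[of K "M \<box> N" H] twist_cotensor)
qed

lemma lcoact_cotensor_coassoc:
  assumes [simp]: "x \<in> carrier (M \<box> N)"
  shows "tmap K H (H \<boxtimes> (M \<box> N)) (twist H) (lcoact (M \<box> N)) (lcoact (M \<box> N) x)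
    = tassoc K H H (M \<box> N) (tmap K (H \<boxtimes> H) (M \<box> N) (comult H) (twist (M \<box> N)) (lcoact (M \<box> N) x))"
proof (rule H_H_cotensor_eqI[OF M N])
  show "ssum H (H \<boxtimes> (M \<box> N)) (H \<boxtimes> H \<boxtimes> M \<boxtimes> N)
      (\<lambda>a z. tens K H (H \<boxtimes> M \<boxtimes> N) a (left_incl M N z))
      (tmap K H (H \<boxtimes> (M \<box> N)) (twist H) (lcoact (M \<box> N)) (lcoact (M \<box> N) x))
    = ssum H (H \<boxtimes> (M \<box> N)) (H \<boxtimes> H \<boxtimes> M \<boxtimes> N)
      (\<lambda>a z. tens K H (H \<boxtimes> M \<boxtimes> N) a (left_incl M N z))
      (tassoc K H H (M \<box> N) (tmap K (H \<boxtimes> H) (M \<box> N) (comult H) (twist (M \<box> N)) (lcoact (M \<box> N) x)))"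
    by simp (simp add: twist_cotensor ssum_lcoact_coassoc[OF M])
qed simp_all

lemma rcoact_cotensor_coassoc:
  assumes [simp]: "x \<in> carrier (M \<box> N)"
  shows "tassoc K (M \<box> N) H H (tmap K ((M \<box> N) \<boxtimes> H) H (rcoact (M \<box> N)) (twist H) (rcoact (M \<box> N) x))
    = tmap K (M \<box> N) (H \<boxtimes> H) (twist (M \<box> N)) (comult H) (rcoact (M \<box> N) x)"
proof (rule cotensor_H_H_eqI[OF M N])
  show "ssum (M \<box> N) (H \<boxtimes> H) ((M \<boxtimes> N) \<boxtimes> H \<boxtimes> H) (tens K (M \<boxtimes> N) (H \<boxtimes> H))
      (tassoc K (M \<box> N) H H (tmap K ((M \<box> N) \<boxtimes> H) H (rcoact (M \<box> N)) (twist H) (rcoact (M \<box> N) x)))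
    = ssum (M \<box> N) (H \<boxtimes> H) ((M \<boxtimes> N) \<boxtimes> H \<boxtimes> H) (tens K (M \<boxtimes> N) (H \<boxtimes> H))
      (tmap K (M \<box> N) (H \<boxtimes> H) (twist (M \<box> N)) (comult H) (rcoact (M \<box> N) x))"
    by simp (simp add: twist_cotensor ssum_rcoact_coassoc[OF N])
qed simp_all

text \<open>The two coactions of the product decompose different factors and merely twist the other
  one, so after evaluation the law is an interchange of sums.\<close>

lemma lcoact_rcoact_cotensor:
  assumes [simp]: "x \<in> carrier (M \<box> N)"
  shows "tmap K H ((M \<box> N) \<boxtimes> H) (twist H) (rcoact (M \<box> N)) (lcoact (M \<box> N) x)
    = tassoc K H (M \<box> N) H (tmap K (H \<boxtimes> (M \<box> N)) H (lcoact (M \<box> N)) (twist H) (rcoact (M \<box> N) x))"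
proof (rule H_cotensor_H_eqI[OF M N])
  show "ssum H ((M \<box> N) \<boxtimes> H) (H \<boxtimes> ((M \<boxtimes> N) \<boxtimes> H))
      (\<lambda>a z. tens K H ((M \<boxtimes> N) \<boxtimes> H) a (right_incl M N z))
      (tmap K H ((M \<box> N) \<boxtimes> H) (twist H) (rcoact (M \<box> N)) (lcoact (M \<box> N) x))
    = ssum H ((M \<box> N) \<boxtimes> H) (H \<boxtimes> ((M \<boxtimes> N) \<boxtimes> H))
      (\<lambda>a z. tens K H ((M \<boxtimes> N) \<boxtimes> H) a (right_incl M N z))
      (tassoc K H (M \<box> N) H (tmap K (H \<boxtimes> (M \<box> N)) H (lcoact (M \<box> N)) (twist H) (rcoact (M \<box> N) x)))"
    by simp (simp add: ssum_swap[where K = K and V = H and W = M and X = N and Y = H])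
qed simp_all

text \<open>Both sides are sums over three components of h, with h_1 split on one side and h_2 on
  the other; Hom-coassociativity of \<Delta> brings them to the same bracketing. The other three
  compatibilities go the same way.\<close>

lemma lcoact_lact_cotensor:
  assumes [simp]: "h \<in> carrier H" "x \<in> carrier (M \<box> N)"
  shows "lcoact (M \<box> N) (lact (M \<box> N) h x) = tcomp K H (M \<box> N) (mult H) (lact (M \<box> N)) (comult H h) (lcoact (M \<box> N) x)"
proof (rule H_cotensor_eqI[OF M N])
  note [simp] = tcomp_eq_ssum[of K H H _ H "M \<box> N"]
  show "left_incl M N (lcoact (M \<box> N) (lact (M \<box> N) h x))
    = left_incl M N (tcomp K H (M \<box> N) (mult H) (lact (M \<box> N)) (comult H h) (lcoact (M \<box> N) x))"
    by simp (simp add: lact_cotensor comult_pull ssum_comult_coassoc)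
qed (simp_all add: tcomp_eq_ssum[of K H H _ H "M \<box> N"])

lemma rcoact_lact_cotensor:
  assumes [simp]: "h \<in> carrier H" "x \<in> carrier (M \<box> N)"
  shows "rcoact (M \<box> N) (lact (M \<box> N) h x) = tcomp K (M \<box> N) H (lact (M \<box> N)) (mult H) (comult H h) (rcoact (M \<box> N) x)"
proof (rule cotensor_H_eqI[OF M N])
  note [simp] = tcomp_eq_ssum[of K H H _ "M \<box> N" H]
  show "right_incl M N (rcoact (M \<box> N) (lact (M \<box> N) h x))
    = right_incl M N (tcomp K (M \<box> N) H (lact (M \<box> N)) (mult H) (comult H h) (rcoact (M \<box> N) x))"
    by simp (simp add: lact_cotensor comult_pull ssum_comult_coassoc)
qed (simp_all add: tcomp_eq_ssum[of K H H _ "M \<box> N" H])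

lemma lcoact_ract_cotensor:
  assumes [simp]: "h \<in> carrier H" "x \<in> carrier (M \<box> N)"
  shows "lcoact (M \<box> N) (ract (M \<box> N) x h) = tcomp K H (M \<box> N) (mult H) (ract (M \<box> N)) (lcoact (M \<box> N) x) (comult H h)"
proof (rule H_cotensor_eqI[OF M N])
  note [simp] = tcomp_eq_ssum[of K H "M \<box> N" _ H H]
  show "left_incl M N (lcoact (M \<box> N) (ract (M \<box> N) x h))
    = left_incl M N (tcomp K H (M \<box> N) (mult H) (ract (M \<box> N)) (lcoact (M \<box> N) x) (comult H h))"
    by simp (simp add: ract_cotensor comult_pull ssum_comult_coassoc)
qed (simp_all add: tcomp_eq_ssum[of K H "M \<box> N" _ H H])

lemma rcoact_ract_cotensor:
  assumes [simp]: "h \<in> carrier H" "x \<in> carrier (M \<box> N)"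
  shows "rcoact (M \<box> N) (ract (M \<box> N) x h) = tcomp K (M \<box> N) H (ract (M \<box> N)) (mult H) (rcoact (M \<box> N) x) (comult H h)"
proof (rule cotensor_H_eqI[OF M N])
  note [simp] = tcomp_eq_ssum[of K "M \<box> N" H _ H H]
  show "right_incl M N (rcoact (M \<box> N) (ract (M \<box> N) x h))
    = right_incl M N (tcomp K (M \<box> N) H (ract (M \<box> N)) (mult H) (rcoact (M \<box> N) x) (comult H h))"
    by simp (simp add: ract_cotensor comult_pull ssum_comult_coassoc)
qed (simp_all add: tcomp_eq_ssum[of K "M \<box> N" H _ H H])

lemma cotensor_in_Obj [simp]: "(M \<box> N) \<in> Obj"
proof -
  have "four_angle_hopf_module K H (M \<box> N)"
    unfolding four_angle_hopf_module_def four_angle_hopf_module_axioms_def hom_bimodule_def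
      hom_bimodule_axioms_def left_hom_module_def left_hom_module_axioms_def right_hom_module_def
      right_hom_module_axioms_def hom_bicomodule_def hom_bicomodule_axioms_def
      left_hom_comodule_def left_hom_comodule_axioms_def right_hom_comodule_def
      right_hom_comodule_axioms_def
    by (intro conjI allI impI)
      (rule module_cotensor[OF M N] linear_map_twist_cotensor cotensor_bilinear
        cotensor_act_assoc cotensor_twist_act cotensor_act_one linear_map_lcoact_cotensor[OF M N] linear_map_rcoact_cotensor[OF M N]
        lcoact_cotensor_twist rcoact_cotensor_twist coact_cotensor_counit
        lcoact_cotensor_coassoc rcoact_cotensor_coassoc lcoact_rcoact_cotensor cotensor_twist_bij
        lcoact_lact_cotensor rcoact_lact_cotensor lcoact_ract_cotensor rcoact_ract_cotensor; assumption)+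
  then show ?thesis by (simp add: hopf_Obj_def)
qed

end

section \<open>Morphisms\<close>

context
  fixes M N :: "('k,'a univ) hopf_module" and f :: "'a univ \<Rightarrow> 'a univ"
  assumes M [simp]: "M \<in> Obj" and N [simp]: "N \<in> Obj" and f: "f \<in> hopf_Hom K H M N"
begin

lemmas [simp] = Obj_simps[OF M] Obj_simps[OF N]

lemma Hom_extensional: "f \<in> extensional (carrier M)"
  and linear_map_Hom [simp]: "linear_map K M N f"
  and Hom_twist [simp]: "m \<in> carrier M \<Longrightarrow> f (twist M m) = twist N (f m)"
  and Hom_lact [simp]: "h \<in> carrier H \<Longrightarrow> m \<in> carrier M \<Longrightarrow> f (lact M h m) = lact N h (f m)"
  and Hom_ract [simp]: "h \<in> carrier H \<Longrightarrow> m \<in> carrier M \<Longrightarrow> f (ract M m h) = ract N (f m) h"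
  using f by (simp_all add: hopf_Hom_def)

lemma Hom_closed [simp]: "m \<in> carrier M \<Longrightarrow> f m \<in> carrier N"
  using linear_mapD(1)[OF linear_map_Hom] .

lemma Hom_untwist [simp]:
  assumes "m \<in> carrier M"
  shows "f (untwist M m) = untwist N (f m)"
  using assms Hom_twist[of "untwist M m"] untwist_twist[OF N, of "f (untwist M m)"] by simp

lemma linear_map_Hom_compose [simp]: "linear_map K X M e \<Longrightarrow> linear_map K X N (\<lambda>x. f (e x))"
  by (rule linear_map_compose[OF linear_map_Hom])

lemma Hom_ssum [simp]:
  assumes "\<And>a b. a \<in> carrier A \<Longrightarrow> b \<in> carrier B \<Longrightarrow> G a b \<in> carrier M"
  shows "f (ssum A B M (\<lambda>a b. G a b) t) = ssum A B N (\<lambda>a b. f (G a b)) t"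
  using assms by (intro ssum_linear[where K = K]) simp_all

lemma lcoact_Hom:
  "m \<in> carrier M \<Longrightarrow> lcoact N (f m) = ssum H M (H \<boxtimes> N) (\<lambda>a n. tens K H N a (f n)) (lcoact M m)"
  using f by (simp add: hopf_Hom_def)

lemma rcoact_Hom:
  "m \<in> carrier M \<Longrightarrow> rcoact N (f m) = ssum M H (N \<boxtimes> H) (\<lambda>n a. tens K N H (f n) a) (rcoact M m)"
  using f by (simp add: hopf_Hom_def)

lemma ssum_lcoact_Hom [simp]:
  assumes "module K U" "bilinear_map K H N U F" "m \<in> carrier M"
  shows "ssum H N U (\<lambda>a n. F a n) (lcoact N (f m)) = ssum H M U (\<lambda>a n. F a (f n)) (lcoact M m)"
  supply [simp] = assms bilinear_map_lin[OF assms(2)]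
  by (simp add: lcoact_Hom)

lemma ssum_rcoact_Hom [simp]:
  assumes "module K U" "bilinear_map K N H U F" "m \<in> carrier M"
  shows "ssum N H U (\<lambda>n a. F n a) (rcoact N (f m)) = ssum M H U (\<lambda>n a. F (f n) a) (rcoact M m)"
  supply [simp] = assms bilinear_map_lin[OF assms(2)]
  by (simp add: rcoact_Hom)

lemmas Hom_simps = linear_map_Hom Hom_twist Hom_untwist Hom_lact Hom_ract Hom_closed linear_map_Hom_compose
  Hom_ssum ssum_lcoact_Hom ssum_rcoact_Hom

end

text \<open>States colinearity in Sweedler form, so that it can be proved by the rules for
  \<open>ssum\<close>; the definition expresses it through \<open>tmap\<close>.\<close>

lemma hopf_HomI:
  assumes [simp]: "M \<in> Obj"
    and "f \<in> extensional (carrier M)" "linear_map K M N f"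
    and "\<And>m. m \<in> carrier M \<Longrightarrow> f (twist M m) = twist N (f m)"
    and "\<And>h m. h \<in> carrier H \<Longrightarrow> m \<in> carrier M \<Longrightarrow> f (lact M h m) = lact N h (f m)"
    and "\<And>h m. h \<in> carrier H \<Longrightarrow> m \<in> carrier M \<Longrightarrow> f (ract M m h) = ract N (f m) h"
    and "\<And>m. m \<in> carrier M
      \<Longrightarrow> lcoact N (f m) = ssum H M (H \<boxtimes> N) (\<lambda>a n. tens K H N a (f n)) (lcoact M m)"
    and "\<And>m. m \<in> carrier M
      \<Longrightarrow> rcoact N (f m) = ssum M H (N \<boxtimes> H) (\<lambda>n a. tens K N H (f n) a) (rcoact M m)"
  shows "f \<in> hopf_Hom K H M N"
  using assms by (simp add: hopf_Hom_def Obj_simps[OF assms(1)])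

lemma hopf_Id_apply [simp]: "m \<in> carrier M \<Longrightarrow> hopf_Id M m = m"
  by (simp add: hopf_Id_def)

lemma hopf_Comp_apply [simp]: "m \<in> carrier L \<Longrightarrow> hopf_Comp L M N g f m = g (f m)"
  by (simp add: hopf_Comp_def compose_def)

lemma hopf_Comp_extensional [simp]: "hopf_Comp L M N g f \<in> extensional (carrier L)"
  by (simp add: hopf_Comp_def compose_def)

lemma hopf_Id_in_Hom [simp]:
  assumes M [simp]: "M \<in> Obj"
  shows "hopf_Id M \<in> hopf_Hom K H M M"
proof -
  note [simp] = Obj_simps[OF M]
  have "linear_map K M M (hopf_Id M)"
    by (subst linear_map_cong[OF module_Obj[OF M] hopf_Id_apply]) simp_all
  then show ?thesis
    by (intro hopf_HomI) (simp_all add: ssum_tens_ident, simp_all add: hopf_Id_def)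
qed

lemma hopf_Comp_in_Hom [simp]:
  assumes L [simp]: "L \<in> Obj" and M [simp]: "M \<in> Obj" and N [simp]: "N \<in> Obj"
    and f: "f \<in> hopf_Hom K H L M" and g: "g \<in> hopf_Hom K H M N"
  shows "hopf_Comp L M N g f \<in> hopf_Hom K H L N"
proof -
  note [simp] = Obj_simps[OF L] Obj_simps[OF M] Obj_simps[OF N] Hom_simps[OF L M f] Hom_simps[OF M N g]
  have "linear_map K L N (hopf_Comp L M N g f)"
    by (subst linear_map_cong[OF module_Obj[OF L] hopf_Comp_apply]) simp_all
  then show ?thesis
    by (intro hopf_HomI) (simp_all add: rcoact_Hom[OF M N g] lcoact_Hom[OF M N g])
qed

lemma category_hopf: "category (hopf_Obj K H) (hopf_Hom K H) hopf_Id hopf_Comp"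
proof
  fix A B C D f g h
  assume o [simp]: "A \<in> Obj" "B \<in> Obj" and f: "f \<in> hopf_Hom K H A B"
  note [simp] = Hom_simps[OF o f]
  show "hopf_Comp A A B f (hopf_Id A) = f" "hopf_Comp A B B (hopf_Id B) f = f"
    by (rule extensionalityI[OF _ Hom_extensional[OF o f]]; simp)+
  assume p [simp]: "C \<in> Obj" "D \<in> Obj" and g: "g \<in> hopf_Hom K H B C" and h: "h \<in> hopf_Hom K H C D"
  note [simp] = Hom_simps[OF o(2) p(1) g]
  show "hopf_Comp A C D h (hopf_Comp A B C g f) = hopf_Comp A B D (hopf_Comp B C D h g) f"
    by (rule extensionalityI[where A = "carrier A"]) simp_all
qed simp_all

text \<open>The inverse of a bijective morphism is again a morphism, so a constraint only has to be
  shown bijective and a morphism in one direction.\<close>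

lemma hopf_isoI:
  assumes M [simp]: "M \<in> Obj" and N [simp]: "N \<in> Obj" and f: "f \<in> hopf_Hom K H M N"
    and bij: "bij_betw f (carrier M) (carrier N)"
  shows "f \<in> category.iso (hopf_Hom K H) hopf_Id hopf_Comp M N"
proof -
  note [simp] = Obj_simps[OF M] Obj_simps[OF N] Hom_simps[OF M N f]
  define g where "g = restrict (inv_into (carrier M) f) (carrier N)"
  have g_cl [simp]: "g n \<in> carrier M" if "n \<in> carrier N" for n
    using that bij_betwE[OF bij_betw_inv_into[OF bij]] by (simp add: g_def)
  have gf [simp]: "g (f m) = m" if "m \<in> carrier M" for m
    using that bij_betw_inv_into_left[OF bij] by (simp add: g_def)
  have fg [simp]: "f (g n) = n" if "n \<in> carrier N" for n
    using that bij_betw_inv_into_right[OF bij] by (simp add: g_def)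
  have g_eqI: "g n = m" if "f m = n" "m \<in> carrier M" for n m
    using that gf by blast
  interpret M: module K M by simp
  interpret N: module K N by simp
  have lin [simp]: "linear_map K N M g"
    using linear_mapD[OF linear_map_Hom[OF M N f]] by (intro linear_mapI g_eqI) simp_all
  note [simp] = linear_map_compose[OF lin]
  have ext: "g \<in> extensional (carrier N)"
    by (simp add: g_def)
  have "g \<in> hopf_Hom K H N M"
  proof (rule hopf_HomI)
    fix n assume n [simp]: "n \<in> carrier N"
    \<comment> \<open>Insert g f = id in the right leg; colinearity of f then turns the coaction of
      g n into that of f (g n) = n.\<close>
    have "lcoact M (g n) = ssum H M (H \<boxtimes> M) (\<lambda>a m. tens K H M a (g (f m))) (lcoact M (g n))"
      by (simp add: ssum_tens_ident)
    also have "\<dots> = ssum H N (H \<boxtimes> M) (\<lambda>a n. tens K H M a (g n)) (lcoact N (f (g n)))"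
      by (subst ssum_lcoact_Hom[OF M N f]) simp_all
    finally show "lcoact M (g n) = ssum H N (H \<boxtimes> M) (\<lambda>a n. tens K H M a (g n)) (lcoact N n)"
      by simp
    have "rcoact M (g n) = ssum M H (M \<boxtimes> H) (\<lambda>m a. tens K M H (g (f m)) a) (rcoact M (g n))"
      by (simp add: ssum_tens_ident)
    also have "\<dots> = ssum N H (M \<boxtimes> H) (\<lambda>n a. tens K M H (g n) a) (rcoact N (f (g n)))"
      by (subst ssum_rcoact_Hom[OF M N f]) simp_all
    finally show "rcoact M (g n) = ssum N H (M \<boxtimes> H) (\<lambda>n a. tens K M H (g n) a) (rcoact N n)"
      by simp
  qed (simp_all add: ext, (rule g_eqI; simp)+)
  moreover have "hopf_Comp M N M g f = hopf_Id M"
    by (rule extensionalityI[where A = "carrier M"]) (simp_all, simp add: hopf_Id_def)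
  moreover have "hopf_Comp N M N f g = hopf_Id N"
    by (rule extensionalityI[where A = "carrier N"]) (simp_all, simp add: hopf_Id_def)
  ultimately show ?thesis
    unfolding category.iso_def[OF category_hopf] using f by blast
qed

section \<open>The Hom-cotensor product of morphisms\<close>

lemma cotensor_map_apply:
  assumes M: "M \<in> Obj" and N: "N \<in> Obj" and x: "x \<in> carrier (M \<box> N)"
  shows "cotensor_map K H M M' N N' f g x
    = ssum M N (M' \<boxtimes> N') (\<lambda>m n. tens K M' N' (f m) (g n)) x"
  using x cotensor_in_tensor[OF M N x] M N
  by (simp add: cotensor_map_def cotensor_fields(1)[symmetric] tmap_eq_ssum[of K M N])

lemma cotensor_map_extensional [simp]:
  "cotensor_map K H M M' N N' f g \<in> extensional (carrier (M \<box> N))"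
  by (simp add: cotensor_map_def cotensor_fields(1))

context
  fixes M M' N N' :: "('k,'a univ) hopf_module" and f g :: "'a univ \<Rightarrow> 'a univ"
  assumes M [simp]: "M \<in> Obj" and M' [simp]: "M' \<in> Obj"
    and N [simp]: "N \<in> Obj" and N' [simp]: "N' \<in> Obj"
    and f: "f \<in> hopf_Hom K H M M'" and g: "g \<in> hopf_Hom K H N N'"
begin

lemmas [simp] = Obj_simps[OF M] Obj_simps[OF N] Obj_simps[OF M'] Obj_simps[OF N']
  Hom_simps[OF M M' f] Hom_simps[OF N N' g]

text \<open>Colinearity of f and g carries the coactions in the cotensor condition back to M and N,
  where the condition for x applies.\<close>

lemma cotensor_map_closed [simp]:
  assumes x [simp]: "x \<in> carrier (M \<box> N)"
  shows "cotensor_map K H M M' N N' f g x \<in> carrier (M' \<box> N')"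
proof (rule cotensorI[OF M' N'])
  show "cotensor_map K H M M' N N' f g x \<in> carrier (M' \<boxtimes> N')"
    by (simp add: cotensor_map_apply)
  show "cotensor_lhs M' N' (cotensor_map K H M M' N N' f g x) = cotensor_rhs M' N' (cotensor_map K H M M' N N' f g x)"
    by (simp add: cotensor_lhs_def cotensor_rhs_def cotensor_map_apply cotensor_lcoact_to_rcoact[OF M N x])
qed

lemma ssum_cotensor_map [simp]:
  assumes "x \<in> carrier (M \<box> N)" "module K U" "bilinear_map K M' N' U G"
  shows "ssum M' N' U (\<lambda>m n. G m n) (cotensor_map K H M M' N N' f g x)
    = ssum M N U (\<lambda>m n. G (f m) (g n)) x"
  supply [simp] = assms(1,2) bilinear_map_lin[OF assms(3)]
  by (simp add: cotensor_map_apply)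

lemma linear_cotensor_map [simp]: "linear_map K (M \<box> N) (M' \<box> N') (cotensor_map K H M M' N N' f g)"
proof (rule linear_map_to_cotensor[OF M' N'])
  show "linear_map K (M \<box> N) (M' \<boxtimes> N') (cotensor_map K H M M' N N' f g)"
    by (subst linear_map_cong[OF module_cotensor[OF M N] cotensor_map_apply[OF M N]]) simp_all
qed simp

lemma cotensor_map_in_Hom: "cotensor_map K H M M' N N' f g \<in> hopf_Hom K H (M \<box> N) (M' \<box> N')"
proof (rule hopf_HomI)
  fix x assume [simp]: "x \<in> carrier (M \<box> N)"
  note [simp] = linear_map_compose[OF linear_cotensor_map]
  show "lcoact (M' \<box> N') (cotensor_map K H M M' N N' f g x)
    = ssum H (M \<box> N) (H \<boxtimes> (M' \<box> N')) (\<lambda>a z. tens K H (M' \<box> N') a (cotensor_map K H M M' N N' f g z))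
      (lcoact (M \<box> N) x)"
    by (rule H_cotensor_eqI[OF M' N'])
      ((simp, simp add: cotensor_map_apply)[1], simp_all)
  show "rcoact (M' \<box> N') (cotensor_map K H M M' N N' f g x)
    = ssum (M \<box> N) H ((M' \<box> N') \<boxtimes> H) (\<lambda>z a. tens K (M' \<box> N') H (cotensor_map K H M M' N N' f g z) a)
      (rcoact (M \<box> N) x)"
    by (rule cotensor_H_eqI[OF M' N'])
      ((simp, simp add: cotensor_map_apply)[1], simp_all)
  show "cotensor_map K H M M' N N' f g (twist (M \<box> N) x) = twist (M' \<box> N') (cotensor_map K H M M' N N' f g x)"
    by (simp add: cotensor_map_apply) (simp add: twist_cotensor)
  show "cotensor_map K H M M' N N' f g (lact (M \<box> N) h x) = lact (M' \<box> N') h (cotensor_map K H M M' N N' f g x)"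
    "cotensor_map K H M M' N N' f g (ract (M \<box> N) x h) = ract (M' \<box> N') (cotensor_map K H M M' N N' f g x) h"
    if [simp]: "h \<in> carrier H" for h
    by (simp_all add: cotensor_map_apply) (simp_all add: lact_cotensor ract_cotensor)
qed simp_all

end

section \<open>The associativity constraint\<close>

context
  fixes M N P :: "('k,'a univ) hopf_module"
  assumes M [simp]: "M \<in> Obj" and N [simp]: "N \<in> Obj" and P [simp]: "P \<in> Obj"
begin

lemmas [simp] = Obj_simps[OF M] Obj_simps[OF N] Obj_simps[OF P]

lemma tens_cotensor_right_inj:
  "inj_on (assoc_incl M N P) (carrier (M \<boxtimes> (N \<box> P)))"
  by (rule tensor_map_inj[OF field_K]) simp_all

lemma tens_cotensor_left_inj:
  "inj_on (ssum (M \<box> N) P ((M \<boxtimes> N) \<boxtimes> P) (tens K (M \<boxtimes> N) P)) (carrier ((M \<box> N) \<boxtimes> P))"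
  by (rule tensor_map_inj[OF field_K]) simp_all

text \<open>The relation between the last two factors, which x satisfies through the coaction of M
  \<box> N, puts the reassociated tensor into M \<otimes> (N \<box> P). The relation between the
  first two, which the components z in M \<box> N satisfy, puts it into M \<box> (N \<box>
  P).\<close>

lemma assoc_exists:
  assumes x [simp]: "x \<in> carrier ((M \<box> N) \<box> P)"
  shows "\<exists>s \<in> carrier (M \<box> (N \<box> P)). assoc_incl M N P s
    = ssum (M \<box> N) P (M \<boxtimes> N \<boxtimes> P) (\<lambda>z p. ssum M N (M \<boxtimes> N \<boxtimes> P)
      (\<lambda>m n. tens K M (N \<boxtimes> P) m (tens K N P n p)) z) x"
proof -
  let ?y = "ssum (M \<box> N) P (M \<boxtimes> N \<boxtimes> P) (\<lambda>z p. ssum M N (M \<boxtimes> N \<boxtimes> P)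
      (\<lambda>m n. tens K M (N \<boxtimes> P) m (tens K N P n p)) z) x"
  let ?U = "M \<boxtimes> N \<boxtimes> H \<boxtimes> P"
  have "\<exists>s \<in> carrier (M \<boxtimes> (N \<box> P)). assoc_incl M N P s = ?y"
  proof (rule tensor_equalizer_right[OF field_K _ _ _ module_cotensor[OF N P]
        linear_cotensor_lhs[OF N P] linear_cotensor_rhs[OF N P] cotensor_carrier[OF N P]])
    show "ssum M (N \<boxtimes> P) ?U (\<lambda>m z. tens K M (N \<boxtimes> H \<boxtimes> P) m (cotensor_lhs N P z)) ?y
      = ssum M (N \<boxtimes> P) ?U (\<lambda>m z. tens K M (N \<boxtimes> H \<boxtimes> P) m (cotensor_rhs N P z)) ?y"
      \<comment> \<open>Both sides of the relation for x carry the twist of M on m, one of them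
        through the right coaction of M \<box> N; \<open>untwist M m\<close> removes it.\<close>
      using cotensor_eq[OF cotensor_in_Obj[OF M N] P x, of ?U "\<lambda>z a p. ssum M N ?U (\<lambda>m n. tens K M (N \<boxtimes> H \<boxtimes> P)
        (untwist M m) (tens K N (H \<boxtimes> P) n (tens K H P a p))) z"]
      by (simp add: cotensor_lhs_def cotensor_rhs_def twist_cotensor
          ssum_swap[where K = K and V = M and W = N and X = H and Y = P])
  qed simp_all
  then obtain s where s [simp]: "s \<in> carrier (M \<boxtimes> (N \<box> P))"
    and sy: "assoc_incl M N P s = ?y"
    by blast
  \<comment> \<open>Only the image of s in M \<otimes> N \<otimes> P is known; it determines the sum
    of every G that is bilinear on M and N \<otimes> P.\<close>
  have sG: "ssum M (N \<box> P) U (\<lambda>m e. G m e) s = ssum (M \<box> N) P U (\<lambda>z p. ssum M N U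
      (\<lambda>m n. G m (tens K N P n p)) z) x"
    if U: "module K U" and G: "bilinear_map K M (N \<boxtimes> P) U G" for U :: "('k,'a univ) module" and G
  proof -
    note [simp] = U bilinear_map_lin[OF G]
    have "ssum M (N \<box> P) U (\<lambda>m e. G m e) s = ssum M (N \<boxtimes> P) U G
        (assoc_incl M N P s)"
      by simp
    then show ?thesis by (simp add: sy)
  qed
  have inj: "inj_on (ssum M (H \<boxtimes> (N \<box> P)) (M \<boxtimes> H \<boxtimes> N \<boxtimes> P) (\<lambda>m z. tens K M (H \<boxtimes> N \<boxtimes> P) m
      (left_incl N P z))) (carrier (M \<boxtimes> H \<boxtimes> (N \<box> P)))"
    by (rule tensor_map_inj[OF field_K _ _ _ _ _ _ _ tens_cotensor_inj(1)[OF N P]]) simp_all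
  have "s \<in> carrier (M \<box> (N \<box> P))"
  \<comment> \<open>The cotensor condition is an equation in M \<otimes> H \<otimes> (N \<box> P).
    It is tested in M \<otimes> H \<otimes> N \<otimes> P, where s can be replaced by its known
    image.\<close>
  proof (rule cotensorI[OF M cotensor_in_Obj[OF N P] s],
      unfold cotensor_lhs_def[OF M cotensor_in_Obj[OF N P]] cotensor_rhs_def[OF M cotensor_in_Obj[OF N P]],
      rule inj_onD[OF inj])
    show "ssum M (H \<boxtimes> (N \<box> P)) (M \<boxtimes> H \<boxtimes> N \<boxtimes> P) (\<lambda>m z. tens K M (H \<boxtimes> N \<boxtimes> P) m
        (left_incl N P z))
        (ssum M (N \<box> P) (M \<boxtimes> H \<boxtimes> (N \<box> P)) (\<lambda>m e. ssum M H (M \<boxtimes> H \<boxtimes> (N \<box> P))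
          (\<lambda>m' a. tens K M (H \<boxtimes> (N \<box> P)) m' (tens K H (N \<box> P) a (twist (N \<box> P) e))) (rcoact M m)) s)
      = ssum M (H \<boxtimes> (N \<box> P)) (M \<boxtimes> H \<boxtimes> N \<boxtimes> P) (\<lambda>m z. tens K M (H \<boxtimes> N \<boxtimes> P) m
        (left_incl N P z))
        (ssum M (N \<box> P) (M \<boxtimes> H \<boxtimes> (N \<box> P)) (\<lambda>m e. ssum H (N \<box> P) (M \<boxtimes> H \<boxtimes> (N \<box> P))
          (\<lambda>a e'. tens K M (H \<boxtimes> (N \<box> P)) (twist M m) (tens K H (N \<box> P) a e')) (lcoact (N \<box> P) e)) s)"
      by simp (simp add: twist_cotensor sG cotensor_lcoact_to_rcoact[OF M N])
  qed simp_all
  with sy show ?thesis by blast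
qed

end

lemma hopf_assoc_extensional [simp]:
  "hopf_assoc K H M N P \<in> extensional (carrier ((M \<box> N) \<box> P))"
  by (simp add: hopf_assoc_def)

context
  fixes M N P :: "('k,'a univ) hopf_module"
  assumes M [simp]: "M \<in> Obj" and N [simp]: "N \<in> Obj" and P [simp]: "P \<in> Obj"
begin

lemmas [simp] = Obj_simps[OF M] Obj_simps[OF N] Obj_simps[OF P]

lemma hopf_assoc:
  assumes x [simp]: "x \<in> carrier ((M \<box> N) \<box> P)"
  shows "hopf_assoc K H M N P x \<in> carrier (M \<box> (N \<box> P))"
    and "tmap K M (N \<boxtimes> P) id id (hopf_assoc K H M N P x)
      = tassoc K M N P (tmap K (M \<boxtimes> N) P id id x)"
    and "assoc_incl M N P (hopf_assoc K H M N P x)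
      = ssum (M \<box> N) P (M \<boxtimes> N \<boxtimes> P) (\<lambda>z p. ssum M N (M \<boxtimes> N \<boxtimes> P)
        (\<lambda>m n. tens K M (N \<boxtimes> P) m (tens K N P n p)) z) x"
proof -
  let ?r = "tassoc K M N P (tmap K (M \<boxtimes> N) P id id x)"
  let ?P = "\<lambda>y. y \<in> carrier (M \<box> (N \<box> P)) \<and> tmap K M (N \<boxtimes> P) id id y = ?r"
  have r: "?r = ssum (M \<box> N) P (M \<boxtimes> N \<boxtimes> P) (\<lambda>z p. ssum M N (M \<boxtimes> N \<boxtimes> P)
      (\<lambda>m n. tens K M (N \<boxtimes> P) m (tens K N P n p)) z) x"
    by (simp add: tmap_eq_ssum[of K "M \<box> N" P])
  have j: "tmap K M (N \<boxtimes> P) id id y = assoc_incl M N P y"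
    if "y \<in> carrier (M \<box> (N \<box> P))" for y
    using that by (simp add: tmap_eq_ssum[of K M "N \<box> P"])
  have "\<exists>y. ?P y"
    using assoc_exists[OF M N P x] j unfolding r by metis
  moreover have "y = z" if "?P y" "?P z" for y z
  proof (rule inj_onD[OF tens_cotensor_right_inj[OF M N P]])
    show "assoc_incl M N P y
      = assoc_incl M N P z"
      using that j[of y] j[of z] by metis
  qed (use that in simp_all)
  ultimately have "\<exists>!y. ?P y" by blast
  then have "?P (hopf_assoc K H M N P x)"
    unfolding hopf_assoc_def restrict_apply using x by (simp only: if_True) (rule theI')
  then show "hopf_assoc K H M N P x \<in> carrier (M \<box> (N \<box> P))"
    "tmap K M (N \<boxtimes> P) id id (hopf_assoc K H M N P x) = ?r"
    "assoc_incl M N P (hopf_assoc K H M N P x)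
      = ssum (M \<box> N) P (M \<boxtimes> N \<boxtimes> P) (\<lambda>z p. ssum M N (M \<boxtimes> N \<boxtimes> P)
        (\<lambda>m n. tens K M (N \<boxtimes> P) m (tens K N P n p)) z) x"
    using j[of "hopf_assoc K H M N P x"] r by simp_all
qed

declare hopf_assoc(1) [simp]

lemma ssum_hopf_assoc [simp]:
  assumes "x \<in> carrier ((M \<box> N) \<box> P)" "module K U" "bilinear_map K M (N \<boxtimes> P) U G"
  shows "ssum M (N \<box> P) U (\<lambda>m e. G m e) (hopf_assoc K H M N P x)
    = ssum (M \<box> N) P U (\<lambda>z p. ssum M N U (\<lambda>m n. G m (tens K N P n p)) z) x"
proof -
  note [simp] = assms(1,2) bilinear_map_lin[OF assms(3)]
  have "ssum M (N \<box> P) U (\<lambda>m e. G m e) (hopf_assoc K H M N P x)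
    = ssum M (N \<boxtimes> P) U G
        (assoc_incl M N P (hopf_assoc K H M N P x))"
    by simp
  then show ?thesis by (simp add: hopf_assoc(3))
qed

lemma hopf_assoc_eqI:
  assumes "assoc_incl M N P y
      = assoc_incl M N P z"
    and "y \<in> carrier (M \<box> (N \<box> P))" "z \<in> carrier (M \<box> (N \<box> P))"
  shows "y = z"
  by (rule inj_onD[OF tens_cotensor_right_inj[OF M N P]]) (use assms in simp_all)

lemma linear_hopf_assoc [simp]:
  "linear_map K ((M \<box> N) \<box> P) (M \<box> (N \<box> P)) (hopf_assoc K H M N P)"
proof (rule linear_map_to_cotensor[OF M cotensor_in_Obj[OF N P]])
  show "linear_map K ((M \<box> N) \<box> P) (M \<boxtimes> (N \<box> P)) (hopf_assoc K H M N P)"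
  proof (rule linear_map_reflect_inj[OF _ _ tens_cotensor_right_inj[OF M N P]])
    show "linear_map K ((M \<box> N) \<box> P) (M \<boxtimes> N \<boxtimes> P) (\<lambda>x. assoc_incl M N P (hopf_assoc K H M N P x))"
      by (subst linear_map_cong[OF module_cotensor[OF cotensor_in_Obj[OF M N] P] hopf_assoc(3)]) simp_all
  qed simp_all
qed simp

text \<open>Mirror image of the existence argument for the associator: the relation for y involves
  the left coaction of N \<box> P, which twists P, hence \<open>untwist P p\<close> in the test
  map.\<close>

lemma assoc_preimage:
  assumes y [simp]: "y \<in> carrier (M \<box> (N \<box> P))"
  shows "\<exists>x \<in> carrier ((M \<box> N) \<box> P). hopf_assoc K H M N P x = y"
proof -
  let ?U = "(M \<boxtimes> H \<boxtimes> N) \<boxtimes> P" and ?V = "(M \<boxtimes> N) \<boxtimes> P"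
  let ?x = "ssum M (N \<box> P) ?V (\<lambda>m e. ssum N P ?V (\<lambda>n p. tens K (M \<boxtimes> N) P (tens K M N m n) p) e) y"
  have "\<exists>s \<in> carrier ((M \<box> N) \<boxtimes> P). ssum (M \<box> N) P ?V (tens K (M \<boxtimes> N) P) s = ?x"
  proof (rule tensor_equalizer_left[OF field_K _ _ _ module_cotensor[OF M N]
        linear_cotensor_lhs[OF M N] linear_cotensor_rhs[OF M N] cotensor_carrier[OF M N]])
    show "ssum (M \<boxtimes> N) P ?U (\<lambda>z p. tens K (M \<boxtimes> H \<boxtimes> N) P (cotensor_lhs M N z) p) ?x
      = ssum (M \<boxtimes> N) P ?U (\<lambda>z p. tens K (M \<boxtimes> H \<boxtimes> N) P (cotensor_rhs M N z) p) ?x"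
      using cotensor_eq[OF M cotensor_in_Obj[OF N P] y, of ?U "\<lambda>m a e. ssum N P ?U (\<lambda>n p. tens K (M \<boxtimes> H \<boxtimes> N) P
        (tens K M (H \<boxtimes> N) m (tens K H N a n)) (untwist P p)) e"]
      by (simp add: cotensor_lhs_def cotensor_rhs_def twist_cotensor
          ssum_swap[where K = K and V = N and W = P and X = M and Y = H])
  qed simp_all
  then obtain s where s [simp]: "s \<in> carrier ((M \<box> N) \<boxtimes> P)"
    and sx: "ssum (M \<box> N) P ?V (tens K (M \<boxtimes> N) P) s = ?x"
    by blast
  have sG: "ssum (M \<box> N) P U (\<lambda>z p. G z p) s = ssum M (N \<box> P) U (\<lambda>m e. ssum N P U
      (\<lambda>n p. G (tens K M N m n) p) e) y"
    if U: "module K U" and G: "bilinear_map K (M \<boxtimes> N) P U G" for U :: "('k,'a univ) module" and G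
  proof -
    note [simp] = U bilinear_map_lin[OF G]
    have "ssum (M \<box> N) P U (\<lambda>z p. G z p) s = ssum (M \<boxtimes> N) P U G
        (ssum (M \<box> N) P ?V (tens K (M \<boxtimes> N) P) s)"
      by simp
    then show ?thesis by (simp add: sx)
  qed
  let ?W = "(M \<boxtimes> N) \<boxtimes> H \<boxtimes> P"
  have inj: "inj_on (ssum (M \<box> N) (H \<boxtimes> P) ?W (tens K (M \<boxtimes> N) (H \<boxtimes> P))) (carrier ((M \<box> N) \<boxtimes> H \<boxtimes> P))"
    by (rule tensor_map_inj[OF field_K]) simp_all
  have sL [simp]: "s \<in> carrier ((M \<box> N) \<box> P)"
  proof (rule cotensorI[OF cotensor_in_Obj[OF M N] P s],
      unfold cotensor_lhs_def[OF cotensor_in_Obj[OF M N] P] cotensor_rhs_def[OF cotensor_in_Obj[OF M N] P],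
      rule inj_onD[OF inj])
    show "ssum (M \<box> N) (H \<boxtimes> P) ?W (tens K (M \<boxtimes> N) (H \<boxtimes> P))
        (ssum (M \<box> N) P ((M \<box> N) \<boxtimes> H \<boxtimes> P) (\<lambda>z p. ssum (M \<box> N) H ((M \<box> N) \<boxtimes> H \<boxtimes> P)
          (\<lambda>z' a. tens K (M \<box> N) (H \<boxtimes> P) z' (tens K H P a (twist P p))) (rcoact (M \<box> N) z)) s)
      = ssum (M \<box> N) (H \<boxtimes> P) ?W (tens K (M \<boxtimes> N) (H \<boxtimes> P))
        (ssum (M \<box> N) P ((M \<box> N) \<boxtimes> H \<boxtimes> P) (\<lambda>z p. ssum H P ((M \<box> N) \<boxtimes> H \<boxtimes> P)
          (\<lambda>a p'. tens K (M \<box> N) (H \<boxtimes> P) (twist (M \<box> N) z) (tens K H P a p')) (lcoact P p)) s)"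
      by simp (simp add: twist_cotensor sG cotensor_lcoact_to_rcoact[OF N P]
          ssum_swap[where K = K and V = H and W = P and X = M and Y = N])
  qed simp_all
  have "hopf_assoc K H M N P s = y"
    by (rule hopf_assoc_eqI) (simp_all add: sG ssum_tens_ident ssum_tens_collapse)
  then show ?thesis using sL by blast
qed

lemma hopf_assoc_bij:
  "bij_betw (hopf_assoc K H M N P) (carrier ((M \<box> N) \<box> P)) (carrier (M \<box> (N \<box> P)))"
  unfolding bij_betw_def
proof
  let ?V = "(M \<boxtimes> N) \<boxtimes> P"
  show "inj_on (hopf_assoc K H M N P) (carrier ((M \<box> N) \<box> P))"
  proof (rule inj_onI)
    fix x x' assume x [simp]: "x \<in> carrier ((M \<box> N) \<box> P)" "x' \<in> carrier ((M \<box> N) \<box> P)"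
      and eq: "hopf_assoc K H M N P x = hopf_assoc K H M N P x'"
    \<comment> \<open>Reassociating the image of x back gives x included into (M \<otimes> N)
      \<otimes> P, and this inclusion is injective.\<close>
    have *: "ssum M (N \<box> P) ?V (\<lambda>m e. ssum N P ?V (\<lambda>n p. tens K (M \<boxtimes> N) P (tens K M N m n) p) e)
        (hopf_assoc K H M N P x) = ssum (M \<box> N) P ?V (tens K (M \<boxtimes> N) P) x"
      if [simp]: "x \<in> carrier ((M \<box> N) \<box> P)" for x
      by (simp add: ssum_tens_collapse)
    have "ssum (M \<box> N) P ?V (tens K (M \<boxtimes> N) P) x = ssum (M \<box> N) P ?V (tens K (M \<boxtimes> N) P) x'"
      using *[OF x(1)] *[OF x(2)] eq by simp
    then show "x = x'"
      by (rule inj_onD[OF tens_cotensor_left_inj[OF M N P]]) simp_all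
  qed
  show "hopf_assoc K H M N P ` carrier ((M \<box> N) \<box> P) = carrier (M \<box> (N \<box> P))"
    using assoc_preimage by (auto simp: image_iff)
qed

lemma hopf_assoc_in_Hom:
  "hopf_assoc K H M N P \<in> hopf_Hom K H ((M \<box> N) \<box> P) (M \<box> (N \<box> P))"
proof (rule hopf_HomI)
  note [simp] = linear_map_compose[OF linear_hopf_assoc]
  fix x assume x [simp]: "x \<in> carrier ((M \<box> N) \<box> P)"
  let ?a = "hopf_assoc K H M N P"
  note comult_out =
    ssum_swap[where K = K and V = "M \<box> N" and W = P and X = H and Y = H]
    ssum_swap[where K = K and V = M and W = N and X = H and Y = H]
  show "?a (twist ((M \<box> N) \<box> P) x) = twist (M \<box> (N \<box> P)) (?a x)"
    \<comment> \<open>Rounds of simplification from the outside in: the inclusion passes through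
      folded structure maps, the outer products are unfolded next and the inner ones last, so that
      membership in the inner products is visible while it is needed.\<close>
    by (rule hopf_assoc_eqI)
      (simp, simp add: twist_cotensor[OF cotensor_in_Obj[OF M N] P] twist_cotensor[OF M cotensor_in_Obj[OF N P]], simp add: twist_cotensor, simp_all)
  show "?a (lact ((M \<box> N) \<box> P) h x) = lact (M \<box> (N \<box> P)) h (?a x)" if [simp]: "h \<in> carrier H" for h
    by (rule hopf_assoc_eqI)
      (simp, simp add: lact_cotensor[OF cotensor_in_Obj[OF M N] P] lact_cotensor[OF M cotensor_in_Obj[OF N P]],
       simp add: lact_cotensor comult_out ssum_comult_coassoc, simp_all)
  show "?a (ract ((M \<box> N) \<box> P) x h) = ract (M \<box> (N \<box> P)) (?a x) h" if [simp]: "h \<in> carrier H" for h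
    by (rule hopf_assoc_eqI)
      (simp, simp add: ract_cotensor[OF cotensor_in_Obj[OF M N] P] ract_cotensor[OF M cotensor_in_Obj[OF N P]],
       simp add: ract_cotensor comult_out ssum_comult_coassoc, simp_all)
  have "inj_on (assoc_incl M N P) (carrier (M \<box> (N \<box> P)))"
    by (rule inj_onI) (rule hopf_assoc_eqI)
  \<comment> \<open>The coactions take values in H \<otimes> (M \<box> (N \<box> P)) and in its
    mirror image; these inclusions allow comparing them with all cotensor products replaced by
    tensor products.\<close>
  note inj = tensor_map_inj[OF field_K _ _ _ _ _ _ _ this, where V = H and V' = H and W' = "M \<boxtimes> N \<boxtimes> P" and f = "\<lambda>a. a"]
    tensor_map_inj[OF field_K _ _ _ _ _ this, where W = H and W' = H and V' = "M \<boxtimes> N \<boxtimes> P" and g = "\<lambda>a. a"]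
  show "lcoact (M \<box> (N \<box> P)) (?a x) = ssum H ((M \<box> N) \<box> P) (H \<boxtimes> (M \<box> (N \<box> P)))
      (\<lambda>a z. tens K H (M \<box> (N \<box> P)) a (?a z)) (lcoact ((M \<box> N) \<box> P) x)"
    by (rule inj_onD[OF inj(1)], simp_all) (simp add: twist_cotensor)
  show "rcoact (M \<box> (N \<box> P)) (?a x) = ssum ((M \<box> N) \<box> P) H ((M \<box> (N \<box> P)) \<boxtimes> H)
      (\<lambda>z a. tens K (M \<box> (N \<box> P)) H (?a z) a) (rcoact ((M \<box> N) \<box> P) x)"
    by (rule inj_onD[OF inj(2)], simp_all)
      (simp add: twist_cotensor ssum_swap[where K = K and V = M and W = N and X = P and Y = H])
qed (rule cotensor_in_Obj[OF cotensor_in_Obj[OF M N] P] hopf_assoc_extensional linear_hopf_assoc)+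

end

lemma hopf_assoc_iso:
  assumes "M \<in> Obj" "N \<in> Obj" "P \<in> Obj"
  shows "hopf_assoc K H M N P \<in> category.iso (hopf_Hom K H) hopf_Id hopf_Comp
    ((M \<box> N) \<box> P) (M \<box> (N \<box> P))"
  using assms by (intro hopf_isoI hopf_assoc_in_Hom hopf_assoc_bij cotensor_in_Obj)

lemma cotensor_map_Id:
  assumes M [simp]: "M \<in> Obj" and N [simp]: "N \<in> Obj"
  shows "cotensor_map K H M M N N (hopf_Id M) (hopf_Id N) = hopf_Id (M \<box> N)"
proof (rule extensionalityI[where A = "carrier (M \<box> N)"])
  show "cotensor_map K H M M N N (hopf_Id M) (hopf_Id N) x = hopf_Id (M \<box> N) x"
    if "x \<in> carrier (M \<box> N)" for x
    using that by (simp add: cotensor_map_apply ssum_tens_ident)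
qed (simp_all add: hopf_Id_def)

lemma cotensor_map_Comp:
  assumes o [simp]: "A \<in> Obj" "A' \<in> Obj" "A'' \<in> Obj"
      "B \<in> Obj" "B' \<in> Obj" "B'' \<in> Obj"
    and f: "f \<in> hopf_Hom K H A A'" and f': "f' \<in> hopf_Hom K H A' A''"
    and g: "g \<in> hopf_Hom K H B B'" and g': "g' \<in> hopf_Hom K H B' B''"
  shows "cotensor_map K H A A'' B B'' (hopf_Comp A A' A'' f' f) (hopf_Comp B B' B'' g' g)
    = hopf_Comp (A \<box> B) (A' \<box> B') (A'' \<box> B'')
        (cotensor_map K H A' A'' B' B'' f' g') (cotensor_map K H A A' B B' f g)"
    (is "?lhs = ?rhs")
proof (rule extensionalityI[where A = "carrier (A \<box> B)"])
  note [simp] = Hom_simps[OF o(1,2) f] Hom_simps[OF o(2,3) f'] Hom_simps[OF o(4,5) g] Hom_simps[OF o(5,6) g']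
    cotensor_map_closed[OF o(1,2,4,5) f g]
  fix x assume [simp]: "x \<in> carrier (A \<box> B)"
  have "cotensor_map K H A' A'' B' B'' f' g' (cotensor_map K H A A' B B' f g x)
    = ssum A' B' (A'' \<boxtimes> B'') (\<lambda>m n. tens K A'' B'' (f' m) (g' n)) (cotensor_map K H A A' B B' f g x)"
    by (rule cotensor_map_apply) simp_all
  then show "?lhs x = ?rhs x"
    by (simp add: cotensor_map_apply)
qed simp_all

lemma hopf_assoc_natural:
  assumes o [simp]: "A \<in> Obj" "A' \<in> Obj" "B \<in> Obj" "B' \<in> Obj"
      "C \<in> Obj" "C' \<in> Obj"
    and f: "f \<in> hopf_Hom K H A A'" and g: "g \<in> hopf_Hom K H B B'" and h: "h \<in> hopf_Hom K H C C'"
  shows "hopf_Comp ((A \<box> B) \<box> C) ((A' \<box> B') \<box> C') (A' \<box> (B' \<box> C')) (hopf_assoc K H A' B' C')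
      (cotensor_map K H (A \<box> B) (A' \<box> B') C C' (cotensor_map K H A A' B B' f g) h)
    = hopf_Comp ((A \<box> B) \<box> C) (A \<box> (B \<box> C)) (A' \<box> (B' \<box> C'))
      (cotensor_map K H A A' (B \<box> C) (B' \<box> C') f (cotensor_map K H B B' C C' g h))
      (hopf_assoc K H A B C)"
    (is "?lhs = ?rhs")
proof (rule extensionalityI[where A = "carrier ((A \<box> B) \<box> C)"])
  note fg = cotensor_map_in_Hom[OF o(1-4) f g] and gh = cotensor_map_in_Hom[OF o(3-6) g h]
  note AB = cotensor_in_Obj[OF o(1,3)] cotensor_in_Obj[OF o(2,4)]
    and BC = cotensor_in_Obj[OF o(3,5)] cotensor_in_Obj[OF o(4,6)]
  note [simp] = Hom_simps[OF o(1,2) f] Hom_simps[OF o(3,4) g] Hom_simps[OF o(5,6) h]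
    Hom_simps[OF AB fg] Hom_simps[OF BC gh]
    cotensor_map_closed[OF AB o(5,6) fg h] cotensor_map_closed[OF o(1,2) BC f gh]
    ssum_cotensor_map[OF AB o(5,6) fg h] ssum_cotensor_map[OF o(1,2) BC f gh]
    ssum_cotensor_map[OF o(1-4) f g] ssum_cotensor_map[OF o(3-6) g h]
  fix x assume [simp]: "x \<in> carrier ((A \<box> B) \<box> C)"
  let ?l = "cotensor_map K H (A \<box> B) (A' \<box> B') C C' (cotensor_map K H A A' B B' f g) h"
    and ?r = "cotensor_map K H A A' (B \<box> C) (B' \<box> C') f (cotensor_map K H B B' C C' g h)"
  have "hopf_assoc K H A' B' C' (?l x) = ?r (hopf_assoc K H A B C x)"
  proof (rule hopf_assoc_eqI[OF o(2,4,6)])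
    show "assoc_incl A' B' C' (hopf_assoc K H A' B' C' (?l x))
      = assoc_incl A' B' C' (?r (hopf_assoc K H A B C x))"
      by simp (simp add: cotensor_map_apply)
  qed simp_all
  then show "?lhs x = ?rhs x"
    by simp
qed simp_all

text \<open>After inclusion into A \<otimes> B \<otimes> C \<otimes> D both composites send ((a
  \<otimes> b) \<otimes> c) \<otimes> d to a \<otimes> (b \<otimes> (c \<otimes> d)). That inclusion
  is A tensored with the one for B, C, D, hence injective.\<close>

lemma hopf_pentagon:
  assumes o [simp]: "A \<in> Obj" "B \<in> Obj" "C \<in> Obj" "D \<in> Obj"
  shows "hopf_Comp (((A \<box> B) \<box> C) \<box> D) (A \<box> ((B \<box> C) \<box> D)) (A \<box> (B \<box> (C \<box> D)))
      (cotensor_map K H A A ((B \<box> C) \<box> D) (B \<box> (C \<box> D)) (hopf_Id A) (hopf_assoc K H B C D))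
      (hopf_Comp (((A \<box> B) \<box> C) \<box> D) ((A \<box> (B \<box> C)) \<box> D) (A \<box> ((B \<box> C) \<box> D))
        (hopf_assoc K H A (B \<box> C) D)
        (cotensor_map K H ((A \<box> B) \<box> C) (A \<box> (B \<box> C)) D D (hopf_assoc K H A B C) (hopf_Id D)))
    = hopf_Comp (((A \<box> B) \<box> C) \<box> D) ((A \<box> B) \<box> (C \<box> D)) (A \<box> (B \<box> (C \<box> D)))
      (hopf_assoc K H A B (C \<box> D)) (hopf_assoc K H (A \<box> B) C D)"
    (is "?lhs = ?rhs")
proof (rule extensionalityI[where A = "carrier (((A \<box> B) \<box> C) \<box> D)"])
  note os = cotensor_in_Obj[OF o(1,2)] cotensor_in_Obj[OF o(2,3)] cotensor_in_Obj[OF o(3,4)]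
  note ABC = cotensor_in_Obj[OF os(1) o(3)] cotensor_in_Obj[OF o(1) os(2)]
    and BCD = cotensor_in_Obj[OF os(2) o(4)] cotensor_in_Obj[OF o(2) os(3)]
  note abc = hopf_assoc_in_Hom[OF o(1-3)] and bcd = hopf_assoc_in_Hom[OF o(2-4)]
  note [simp] = Hom_simps[OF ABC abc] Hom_simps[OF BCD bcd] Obj_simps[OF o(1)] Obj_simps[OF o(2)]
    Obj_simps[OF o(3)] Obj_simps[OF o(4)]
    Hom_simps[OF o(1) o(1) hopf_Id_in_Hom[OF o(1)]] Hom_simps[OF o(4) o(4) hopf_Id_in_Hom[OF o(4)]]
    cotensor_map_closed[OF ABC o(4,4) abc hopf_Id_in_Hom[OF o(4)]]
    cotensor_map_closed[OF o(1,1) BCD hopf_Id_in_Hom[OF o(1)] bcd]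
    ssum_cotensor_map[OF ABC o(4,4) abc hopf_Id_in_Hom[OF o(4)]]
    ssum_cotensor_map[OF o(1,1) BCD hopf_Id_in_Hom[OF o(1)] bcd]
  fix x assume [simp]: "x \<in> carrier (((A \<box> B) \<box> C) \<box> D)"
  let ?l = "cotensor_map K H ((A \<box> B) \<box> C) (A \<box> (B \<box> C)) D D (hopf_assoc K H A B C) (hopf_Id D)"
    and ?r = "cotensor_map K H A A ((B \<box> C) \<box> D) (B \<box> (C \<box> D)) (hopf_Id A) (hopf_assoc K H B C D)"
  let ?y = "?r (hopf_assoc K H A (B \<box> C) D (?l x))"
    and ?z = "hopf_assoc K H A B (C \<box> D) (hopf_assoc K H (A \<box> B) C D x)"
  have inj: "inj_on (assoc_incl B C D) (carrier (B \<box> (C \<box> D)))"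
    by (rule inj_onI) (rule hopf_assoc_eqI[OF o(2-4)])
  have "?y = ?z"
  proof (rule inj_onD[OF tensor_map_inj[OF field_K _ _ _ _ _ _ _ inj, where V = A and V' = A and f = "\<lambda>a. a"
        and W' = "B \<boxtimes> C \<boxtimes> D"]])
    show "ssum A (B \<box> (C \<box> D)) (A \<boxtimes> B \<boxtimes> C \<boxtimes> D) (\<lambda>a y. tens K A (B \<boxtimes> C \<boxtimes> D) a
        (assoc_incl B C D y)) ?y
      = ssum A (B \<box> (C \<box> D)) (A \<boxtimes> B \<boxtimes> C \<boxtimes> D) (\<lambda>a y. tens K A (B \<boxtimes> C \<boxtimes> D) a
        (assoc_incl B C D y)) ?z"
      by simp
  qed simp_all
  then show "?lhs x = ?rhs x"
    by simp
qed simp_all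

section \<open>The unit constraints\<close>

lemma counit_smult_smult [simp]:
  assumes "module K U" "a \<in> carrier H" "b \<in> carrier H" "u \<in> carrier U"
  shows "(counit H a \<otimes>\<^bsub>K\<^esub> counit H b) \<odot>\<^bsub>U\<^esub> u = counit H a \<odot>\<^bsub>U\<^esub> (counit H b \<odot>\<^bsub>U\<^esub> u)"
  using module.smult_assoc1[OF assms(1)] assms by simp

text \<open>Scalars \<epsilon>(h) with h from an outer sum are pulled out of inner sums; those whose
  argument is bound by the sum stay for the counit axiom.\<close>

lemma ssum_counit_smult [simp]:
  assumes "module K U" "h \<in> carrier H"
    and "\<And>v w. v \<in> carrier V \<Longrightarrow> w \<in> carrier W \<Longrightarrow> F v w \<in> carrier U"
  shows "ssum V W U (\<lambda>v w. counit H h \<odot>\<^bsub>U\<^esub> F v w) t = counit H h \<odot>\<^bsub>U\<^esub> ssum V W U F t"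
  using assms by (intro ssum_linear[where K = K and g = "module.smult U (counit H h)", symmetric]) simp_all

lemma linear_map_counit:
  assumes "linear_map K V W f" "h \<in> carrier H" "v \<in> carrier V"
  shows "f (counit H h \<odot>\<^bsub>V\<^esub> v) = counit H h \<odot>\<^bsub>W\<^esub> f v"
  using linear_mapD(3)[OF assms(1)] assms by simp

lemma tens_counit_smult [simp]:
  assumes "module K V" "module K W" "h \<in> carrier H" "v \<in> carrier V" "w \<in> carrier W"
  shows "tens K V W v (counit H h \<odot>\<^bsub>W\<^esub> w) = counit H h \<odot>\<^bsub>V \<boxtimes> W\<^esub> tens K V W v w"
    and "tens K V W (counit H h \<odot>\<^bsub>V\<^esub> v) w = counit H h \<odot>\<^bsub>V \<boxtimes> W\<^esub> tens K V W v w"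
  by (rule linear_map_counit[where f = "tens K V W v"] linear_map_counit[where f = "\<lambda>v. tens K V W v w"];
      simp add: assms)+

lemma act_counit_smult [simp]:
  assumes M [simp]: "M \<in> Obj" and "h \<in> carrier H" "m \<in> carrier M"
  shows "twist M (counit H h \<odot>\<^bsub>M\<^esub> m) = counit H h \<odot>\<^bsub>M\<^esub> twist M m"
    and "a \<in> carrier H \<Longrightarrow> lact M a (counit H h \<odot>\<^bsub>M\<^esub> m) = counit H h \<odot>\<^bsub>M\<^esub> lact M a m"
    and "a \<in> carrier H \<Longrightarrow> ract M (counit H h \<odot>\<^bsub>M\<^esub> m) a = counit H h \<odot>\<^bsub>M\<^esub> ract M m a"
  using assms(2,3)
  by (auto intro!: linear_map_counit[where f = "twist M"] linear_map_counit[where f = "lact M a"]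
      linear_map_counit[where f = "\<lambda>m. ract M m a"] simp: Obj_simps[OF M])

context
  fixes M :: "('k,'a univ) hopf_module"
  assumes M [simp]: "M \<in> Obj"
begin

lemmas [simp] = Obj_simps[OF M]

lemma cotensor_left_unit_in_tensor [simp]:
  "x \<in> carrier (hopf_unit H \<box> M) \<Longrightarrow> x \<in> carrier (H \<boxtimes> M)"
  using cotensor_in_tensor[OF unit_in_Obj M] by simp

lemma hopf_lunit_apply:
  assumes "x \<in> carrier (hopf_unit H \<box> M)"
  shows "hopf_lunit K H M x = ssum H M M (\<lambda>g m. counit H g \<odot>\<^bsub>M\<^esub> m) x"
  using assms by (simp add: hopf_lunit_def tsum_eq_ssum[of K H M])

lemma hopf_lunit_closed [simp]: "x \<in> carrier (hopf_unit H \<box> M) \<Longrightarrow> hopf_lunit K H M x \<in> carrier M"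
  by (simp add: hopf_lunit_apply)

lemma linear_map_hopf_lunit [simp]: "linear_map K (hopf_unit H \<box> M) M (hopf_lunit K H M)"
  by (subst linear_map_cong[OF module_cotensor[OF unit_in_Obj M] hopf_lunit_apply]) simp_all

lemma linear_hopf_lunit:
  assumes "linear_map K M U f" "module K U" "x \<in> carrier (hopf_unit H \<box> M)"
  shows "f (hopf_lunit K H M x) = ssum H M U (\<lambda>g m. counit H g \<odot>\<^bsub>U\<^esub> f m) x"
proof -
  have "f (hopf_lunit K H M x) = ssum H M U (\<lambda>g m. f (counit H g \<odot>\<^bsub>M\<^esub> m)) x"
    using assms by (simp add: hopf_lunit_apply ssum_linear[where K = K and g = f])
  then show ?thesis by (simp add: linear_map_counit[OF assms(1)])
qed

text \<open>As \<epsilon> \<beta> = \<epsilon>, the scalar may be read as \<epsilon>(\<beta>(g)).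
  The relation for x replaces \<beta>(g) \<otimes> m_[-1] \<otimes> m_[0] by g_1 \<otimes> g_2
  \<otimes> \<zeta>(m), and the counit axiom contracts the first two components to
  \<beta>(g).\<close>

lemma lcoact_hopf_lunit:
  assumes x [simp]: "x \<in> carrier (hopf_unit H \<box> M)"
  shows "lcoact M (hopf_lunit K H M x) = ssum H M (H \<boxtimes> M) (\<lambda>g m. tens K H M (twist H g) (twist M m)) x"
proof -
  have "lcoact M (hopf_lunit K H M x)
    = ssum H M (H \<boxtimes> M) (\<lambda>g m. counit H g \<odot>\<^bsub>H \<boxtimes> M\<^esub> lcoact M m) x"
    by (rule linear_hopf_lunit) simp_all
  also have "\<dots> = ssum H M (H \<boxtimes> M) (\<lambda>g m. ssum H M (H \<boxtimes> M)
      (\<lambda>a n. counit H (twist H g) \<odot>\<^bsub>H \<boxtimes> M\<^esub> tens K H M a n) (lcoact M m)) x"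
    by (simp add: ssum_tens_ident)
  also have "\<dots> = ssum H M (H \<boxtimes> M) (\<lambda>g m. ssum H H (H \<boxtimes> M)
      (\<lambda>g\<^sub>1 g\<^sub>2. counit H g\<^sub>1 \<odot>\<^bsub>H \<boxtimes> M\<^esub> tens K H M g\<^sub>2 (twist M m)) (comult H g)) x"
    using cotensor_eq[OF unit_in_Obj M x, of "H \<boxtimes> M" "\<lambda>g a n. counit H g \<odot>\<^bsub>H \<boxtimes> M\<^esub> tens K H M a n"]
    by simp
  finally show ?thesis by simp
qed

text \<open>The cotensor condition for the untwisted coaction of m is Hom-coassociativity of
  M.\<close>

lemma lunit_inverse_closed:
  assumes [simp]: "m \<in> carrier M"
  shows "ssum H M (H \<boxtimes> M) (\<lambda>a n. tens K H M (untwist H a) (untwist M n)) (lcoact M m) \<in> carrier (hopf_unit H \<box> M)"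
  by (rule cotensorI[OF unit_in_Obj M]) (simp_all add: cotensor_lhs_def cotensor_rhs_def ssum_lcoact_coassoc[OF M])

lemma hopf_lunit_bij: "bij_betw (hopf_lunit K H M) (carrier (hopf_unit H \<box> M)) (carrier M)"
proof (rule bij_betwI)
  let ?g = "\<lambda>m. ssum H M (H \<boxtimes> M) (\<lambda>a n. tens K H M (untwist H a) (untwist M n)) (lcoact M m)"
  show "?g (hopf_lunit K H M x) = x" if "x \<in> carrier (hopf_unit H \<box> M)" for x
    using that by (simp add: lcoact_hopf_lunit ssum_tens_ident)
  show "hopf_lunit K H M (?g m) = m" if "m \<in> carrier M" for m
    using that by (simp add: hopf_lunit_apply[OF lunit_inverse_closed])
qed (simp_all add: lunit_inverse_closed)

lemma hopf_lunit_in_Hom: "hopf_lunit K H M \<in> hopf_Hom K H (hopf_unit H \<box> M) M"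
proof (rule hopf_HomI)
  fix x assume x [simp]: "x \<in> carrier (hopf_unit H \<box> M)"
  show "hopf_lunit K H M (twist (hopf_unit H \<box> M) x) = twist M (hopf_lunit K H M x)"
    by (simp add: hopf_lunit_apply) (simp add: twist_cotensor)
  show "hopf_lunit K H M (lact (hopf_unit H \<box> M) h x) = lact M h (hopf_lunit K H M x)"
    "hopf_lunit K H M (ract (hopf_unit H \<box> M) x h) = ract M (hopf_lunit K H M x) h"
    if [simp]: "h \<in> carrier H" for h
    by (simp_all add: hopf_lunit_apply) (simp_all add: lact_cotensor ract_cotensor)
  \<comment> \<open>The coaction of the product gives g_1 \<otimes> g_2 \<otimes> \<zeta>(m). The
    unit constraint contracts g_2, and g_1 \<epsilon>(g_2) = \<beta>(g) leads to the formula of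
    \<open>lcoact_hopf_lunit\<close>.\<close>
  show "lcoact M (hopf_lunit K H M x) = ssum H (hopf_unit H \<box> M) (H \<boxtimes> M)
      (\<lambda>a z. tens K H M a (hopf_lunit K H M z)) (lcoact (hopf_unit H \<box> M) x)"
    by (simp add: lcoact_hopf_lunit) (simp add: hopf_lunit_apply, simp)
  \<comment> \<open>The right coaction of the product is that of M together with \<beta> on H, and
    \<epsilon> is invariant under \<beta>; so right colinearity reduces to linearity of the coaction
    of M.\<close>
  have "rcoact M (hopf_lunit K H M x) = ssum H M (M \<boxtimes> H) (\<lambda>g m. counit H g \<odot>\<^bsub>M \<boxtimes> H\<^esub> rcoact M m) x"
    by (rule linear_hopf_lunit) simp_all
  then show "rcoact M (hopf_lunit K H M x) = ssum (hopf_unit H \<box> M) H (M \<boxtimes> H)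
      (\<lambda>z a. tens K M H (hopf_lunit K H M z) a) (rcoact (hopf_unit H \<box> M) x)"
    by (simp only:) (simp add: hopf_lunit_apply, simp add: ssum_tens_ident)
qed (simp_all, simp add: hopf_lunit_def)

lemma cotensor_right_unit_in_tensor [simp]:
  "x \<in> carrier (M \<box> hopf_unit H) \<Longrightarrow> x \<in> carrier (M \<boxtimes> H)"
  using cotensor_in_tensor[OF M unit_in_Obj] by simp

lemma hopf_runit_apply:
  assumes "x \<in> carrier (M \<box> hopf_unit H)"
  shows "hopf_runit K H M x = ssum M H M (\<lambda>m g. counit H g \<odot>\<^bsub>M\<^esub> m) x"
  using assms by (simp add: hopf_runit_def tsum_eq_ssum[of K M H])

lemma hopf_runit_closed [simp]: "x \<in> carrier (M \<box> hopf_unit H) \<Longrightarrow> hopf_runit K H M x \<in> carrier M"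
  by (simp add: hopf_runit_apply)

lemma linear_map_hopf_runit [simp]: "linear_map K (M \<box> hopf_unit H) M (hopf_runit K H M)"
  by (subst linear_map_cong[OF module_cotensor[OF M unit_in_Obj] hopf_runit_apply]) simp_all

lemma linear_hopf_runit:
  assumes "linear_map K M U f" "module K U" "x \<in> carrier (M \<box> hopf_unit H)"
  shows "f (hopf_runit K H M x) = ssum M H U (\<lambda>m g. counit H g \<odot>\<^bsub>U\<^esub> f m) x"
proof -
  have "f (hopf_runit K H M x) = ssum M H U (\<lambda>m g. f (counit H g \<odot>\<^bsub>M\<^esub> m)) x"
    using assms by (simp add: hopf_runit_apply ssum_linear[where K = K and g = f])
  then show ?thesis by (simp add: linear_map_counit[OF assms(1)])
qed

text \<open>Here the relation for x replaces m_(0) \<otimes> m_(1) \<otimes> \<beta>(g) by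
  \<zeta>(m) \<otimes> g_1 \<otimes> g_2, and the counit axiom contracts the last two
  components.\<close>

lemma rcoact_hopf_runit:
  assumes x [simp]: "x \<in> carrier (M \<box> hopf_unit H)"
  shows "rcoact M (hopf_runit K H M x) = ssum M H (M \<boxtimes> H) (\<lambda>m g. tens K M H (twist M m) (twist H g)) x"
proof -
  have "rcoact M (hopf_runit K H M x)
    = ssum M H (M \<boxtimes> H) (\<lambda>m g. counit H g \<odot>\<^bsub>M \<boxtimes> H\<^esub> rcoact M m) x"
    by (rule linear_hopf_runit) simp_all
  also have "\<dots> = ssum M H (M \<boxtimes> H) (\<lambda>m g. ssum M H (M \<boxtimes> H)
      (\<lambda>n a. counit H (twist H g) \<odot>\<^bsub>M \<boxtimes> H\<^esub> tens K M H n a) (rcoact M m)) x"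
    by (simp add: ssum_tens_ident)
  also have "\<dots> = ssum M H (M \<boxtimes> H) (\<lambda>m g. ssum H H (M \<boxtimes> H)
      (\<lambda>g\<^sub>1 g\<^sub>2. counit H g\<^sub>2 \<odot>\<^bsub>M \<boxtimes> H\<^esub> tens K M H (twist M m) g\<^sub>1) (comult H g)) x"
    using cotensor_eq[OF M unit_in_Obj x, of "M \<boxtimes> H" "\<lambda>n a g. counit H g \<odot>\<^bsub>M \<boxtimes> H\<^esub> tens K M H n a"]
    by simp
  finally show ?thesis by simp
qed

lemma runit_inverse_closed:
  assumes [simp]: "m \<in> carrier M"
  shows "ssum M H (M \<boxtimes> H) (\<lambda>n a. tens K M H (untwist M n) (untwist H a)) (rcoact M m) \<in> carrier (M \<box> hopf_unit H)"
  by (rule cotensorI[OF M unit_in_Obj]) (simp_all add: cotensor_lhs_def cotensor_rhs_def ssum_rcoact_coassoc[OF M])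

lemma hopf_runit_bij: "bij_betw (hopf_runit K H M) (carrier (M \<box> hopf_unit H)) (carrier M)"
proof (rule bij_betwI)
  let ?g = "\<lambda>m. ssum M H (M \<boxtimes> H) (\<lambda>n a. tens K M H (untwist M n) (untwist H a)) (rcoact M m)"
  show "?g (hopf_runit K H M x) = x" if "x \<in> carrier (M \<box> hopf_unit H)" for x
    using that by (simp add: rcoact_hopf_runit ssum_tens_ident)
  show "hopf_runit K H M (?g m) = m" if "m \<in> carrier M" for m
    using that by (simp add: hopf_runit_apply[OF runit_inverse_closed])
qed (simp_all add: runit_inverse_closed)

lemma hopf_runit_in_Hom: "hopf_runit K H M \<in> hopf_Hom K H (M \<box> hopf_unit H) M"
proof (rule hopf_HomI)
  fix x assume x [simp]: "x \<in> carrier (M \<box> hopf_unit H)"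
  show "hopf_runit K H M (twist (M \<box> hopf_unit H) x) = twist M (hopf_runit K H M x)"
    by (simp add: hopf_runit_apply) (simp add: twist_cotensor)
  show "hopf_runit K H M (lact (M \<box> hopf_unit H) h x) = lact M h (hopf_runit K H M x)"
    "hopf_runit K H M (ract (M \<box> hopf_unit H) x h) = ract M (hopf_runit K H M x) h"
    if [simp]: "h \<in> carrier H" for h
    by (simp_all add: hopf_runit_apply) (simp_all add: lact_cotensor ract_cotensor)
  show "rcoact M (hopf_runit K H M x) = ssum (M \<box> hopf_unit H) H (M \<boxtimes> H)
      (\<lambda>z a. tens K M H (hopf_runit K H M z) a) (rcoact (M \<box> hopf_unit H) x)"
    by (simp add: rcoact_hopf_runit) (simp add: hopf_runit_apply, simp)
  have "lcoact M (hopf_runit K H M x) = ssum M H (H \<boxtimes> M) (\<lambda>m g. counit H g \<odot>\<^bsub>H \<boxtimes> M\<^esub> lcoact M m) x"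
    by (rule linear_hopf_runit) simp_all
  then show "lcoact M (hopf_runit K H M x) = ssum H (M \<box> hopf_unit H) (H \<boxtimes> M)
      (\<lambda>a z. tens K H M a (hopf_runit K H M z)) (lcoact (M \<box> hopf_unit H) x)"
    by (simp only:) (simp add: hopf_runit_apply, simp add: ssum_tens_ident)
qed (simp_all, simp add: hopf_runit_def)

end

lemma hopf_lunit_iso:
  assumes [simp]: "M \<in> Obj"
  shows "hopf_lunit K H M \<in> category.iso (hopf_Hom K H) hopf_Id hopf_Comp (hopf_unit H \<box> M) M"
  by (intro hopf_isoI hopf_lunit_in_Hom hopf_lunit_bij) simp_all

lemma hopf_runit_iso:
  assumes [simp]: "M \<in> Obj"
  shows "hopf_runit K H M \<in> category.iso (hopf_Hom K H) hopf_Id hopf_Comp (M \<box> hopf_unit H) M"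
  by (intro hopf_isoI hopf_runit_in_Hom hopf_runit_bij) simp_all

lemma hopf_lunit_natural:
  assumes o [simp]: "A \<in> Obj" "A' \<in> Obj" and f: "f \<in> hopf_Hom K H A A'"
  shows "hopf_Comp (hopf_unit H \<box> A) (hopf_unit H \<box> A') A' (hopf_lunit K H A')
      (cotensor_map K H (hopf_unit H) (hopf_unit H) A A' (hopf_Id (hopf_unit H)) f)
    = hopf_Comp (hopf_unit H \<box> A) A A' f (hopf_lunit K H A)"
    (is "?lhs = ?rhs")
proof (rule extensionalityI[where A = "carrier (hopf_unit H \<box> A)"])
  note id = hopf_Id_in_Hom[OF unit_in_Obj]
  note [simp] = Obj_simps[OF o(1)] Obj_simps[OF o(2)] Hom_simps[OF o f]
    cotensor_map_closed[OF unit_in_Obj unit_in_Obj o id f]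
    ssum_cotensor_map[OF unit_in_Obj unit_in_Obj o id f, unfolded hopf_unit_space]
  fix x assume [simp]: "x \<in> carrier (hopf_unit H \<box> A)"
  show "?lhs x = ?rhs x"
    by (simp add: hopf_lunit_apply[of A'] linear_hopf_lunit[where f = f and U = A'])
qed simp_all

lemma hopf_runit_natural:
  assumes o [simp]: "A \<in> Obj" "A' \<in> Obj" and f: "f \<in> hopf_Hom K H A A'"
  shows "hopf_Comp (A \<box> hopf_unit H) (A' \<box> hopf_unit H) A' (hopf_runit K H A')
      (cotensor_map K H A A' (hopf_unit H) (hopf_unit H) f (hopf_Id (hopf_unit H)))
    = hopf_Comp (A \<box> hopf_unit H) A A' f (hopf_runit K H A)"
    (is "?lhs = ?rhs")
proof (rule extensionalityI[where A = "carrier (A \<box> hopf_unit H)"])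
  note id = hopf_Id_in_Hom[OF unit_in_Obj]
  note [simp] = Obj_simps[OF o(1)] Obj_simps[OF o(2)] Hom_simps[OF o f]
    cotensor_map_closed[OF o unit_in_Obj unit_in_Obj f id]
    ssum_cotensor_map[OF o unit_in_Obj unit_in_Obj f id, unfolded hopf_unit_space]
  fix x assume [simp]: "x \<in> carrier (A \<box> hopf_unit H)"
  show "?lhs x = ?rhs x"
    by (simp add: hopf_runit_apply[of A'] linear_hopf_runit[where f = f and U = A'])
qed simp_all

text \<open>Both composites are (a \<otimes> g) \<otimes> b \<mapsto> \<epsilon>(g) a \<otimes> b.
  Their values lie in A \<box> B, literally a subset of A \<otimes> B, so they are compared without
  an inclusion.\<close>

lemma hopf_triangle:
  assumes o [simp]: "A \<in> Obj" "B \<in> Obj"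
  shows "hopf_Comp ((A \<box> hopf_unit H) \<box> B) (A \<box> (hopf_unit H \<box> B)) (A \<box> B)
      (cotensor_map K H A A (hopf_unit H \<box> B) B (hopf_Id A) (hopf_lunit K H B))
      (hopf_assoc K H A (hopf_unit H) B)
    = cotensor_map K H (A \<box> hopf_unit H) A B B (hopf_runit K H A) (hopf_Id B)"
    (is "?lhs = ?rhs")
proof (rule extensionalityI[where A = "carrier ((A \<box> hopf_unit H) \<box> B)"])
  note [simp] = Obj_simps[OF o(1)] Obj_simps[OF o(2)]
    ssum_hopf_assoc[OF o(1) unit_in_Obj o(2), unfolded hopf_unit_space]
  fix x assume [simp]: "x \<in> carrier ((A \<box> hopf_unit H) \<box> B)"
  have "cotensor_map K H A A (hopf_unit H \<box> B) B (hopf_Id A) (hopf_lunit K H B)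
      (hopf_assoc K H A (hopf_unit H) B x)
    = cotensor_map K H (A \<box> hopf_unit H) A B B (hopf_runit K H A) (hopf_Id B) x"
    by (simp add: cotensor_map_apply) (simp add: hopf_lunit_apply hopf_runit_apply, simp)
  then show "?lhs x = ?rhs x"
    by simp
qed simp_all

theorem monoidal_category_hopf:
  "monoidal_category (hopf_Obj K H) (hopf_Hom K H) hopf_Id hopf_Comp
    (cotensor K H) (cotensor_map K H) (hopf_unit H)
    (hopf_assoc K H) (hopf_lunit K H) (hopf_runit K H)"
  by (intro monoidal_category.intro category_hopf monoidal_category_axioms.intro
      cotensor_in_Obj cotensor_map_in_Hom cotensor_map_Id cotensor_map_Comp unit_in_Obj
      hopf_assoc_iso hopf_assoc_natural hopf_lunit_iso hopf_lunit_natural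
      hopf_runit_iso hopf_runit_natural hopf_pentagon hopf_triangle)

end

theorem proposition2p12:
  fixes K :: "('k,'r) ring_scheme" and H :: "('k,'a univ) hom_hopf"
  assumes "field K"
    and "hom_hopf_algebra K H"
    and "bij_betw (twist H) (carrier H) (carrier H)"
  shows "monoidal_category
      (hopf_Obj K H) (hopf_Hom K H) hopf_Id hopf_Comp
      (cotensor K H) (cotensor_map K H) (hopf_unit H)
      (hopf_assoc K H) (hopf_lunit K H) (hopf_runit K H)
    \<and> (\<forall>M \<in> hopf_Obj K H. \<forall>N \<in> hopf_Obj K H. \<forall>x \<in> carrier (cotensor K H M N).
        tmap K H (tensor K M N) id id (lcoact (cotensor K H M N) x)
          = tassoc K H M N (tmap K (tensor K H M) N (lcoact M) (twist N) x)
        \<and> tassoc K M N H (tmap K (tensor K M N) H id id (rcoact (cotensor K H M N) x))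
          = tmap K M (tensor K N H) (twist M) (rcoact N) x)
    \<and> (\<forall>M \<in> hopf_Obj K H. \<forall>N \<in> hopf_Obj K H. \<forall>P \<in> hopf_Obj K H.
        \<forall>x \<in> carrier (cotensor K H (cotensor K H M N) P).
        tmap K M (tensor K N P) id id (hopf_assoc K H M N P x)
          = tassoc K M N P (tmap K (tensor K M N) P id id x))"
proof -
  interpret hopf_category K H
    using assms by (simp add: hopf_category_def hopf_category_axioms_def)
  show ?thesis
    \<comment> \<open>The last three facts say that the elements picked by the definite descriptions
      have the prescribed images, so that the coactions and the associator are the intended
      maps.\<close>
    by (intro conjI ballI monoidal_category_hopf lcoact_cotensor(2) rcoact_cotensor(2) hopf_assoc(2))
qed

end
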